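(* Let $m\in\mathbb Z\setminus\{0\}$ and $\xi\in\mathbb Z_m$. Then $\widetilde{BS}(m,\xi)$ is hopfian (every surjective endomorphism is injective) but not co-hopfian (there is an injective endomorphism which is not surjective).
   Context: $\mathbb Z_m$ is the ring of $m$-adic integers. The functions $r_i$: $r_0(\xi)=0$, $s_0(\xi)=1$, and for $i\ge1$, $r_i(\xi)\in\{0,\dots,|m|-1\}$, $s_i(\xi)\in\mathbb Z_m$ unique with $\xi s_{i-1}(\xi)=ms_i(\xi)+r_i(\xi)$. Let $E$ be the free abelian group with basis $e_0,e_1,\dots$, $E_{m,\xi}\le E$ with basis $me_0,\ e_i-r_i(\xi)e_0$ ($i\ge1$), $E_1\le E$ with basis $e_1,e_2,\dots$, and $\phi:E_{m,\xi}\to E_1$ the isomorphism $\phi(me_0)=e_1$, $\phi(e_i-r_i(\xi)e_0)=e_{i+1}$. $\widetilde{BS}(m,\xi)=\langle E,a\mid axa^{-1}=\phi(x)\ \forall x\in E_{m,\xi}\rangle$ (HNN extension). *)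

theory Defs
  imports "HOL-Algebra.Group"
begin

text \<open>An m-adic integer is represented by its compatible system of residues:
  x k is the residue modulo |m|^k (in 0..|m|^k-1), and x (k+1) reduces to x k.\<close>

definition madic :: "int \<Rightarrow> (nat \<Rightarrow> int) set" where
  "madic m = {x. \<forall>k. 0 \<le> x k \<and> x k < \<bar>m\<bar> ^ k \<and> x (Suc k) mod \<bar>m\<bar> ^ k = x k}"

definition madd :: "int \<Rightarrow> (nat \<Rightarrow> int) \<Rightarrow> (nat \<Rightarrow> int) \<Rightarrow> (nat \<Rightarrow> int)" where
  "madd m x y = (\<lambda>k. (x k + y k) mod \<bar>m\<bar> ^ k)"

definition mmul :: "int \<Rightarrow> (nat \<Rightarrow> int) \<Rightarrow> (nat \<Rightarrow> int) \<Rightarrow> (nat \<Rightarrow> int)" where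
  "mmul m x y = (\<lambda>k. (x k * y k) mod \<bar>m\<bar> ^ k)"

definition mint :: "int \<Rightarrow> int \<Rightarrow> (nat \<Rightarrow> int)" where
  "mint m c = (\<lambda>k. c mod \<bar>m\<bar> ^ k)"

fun rs :: "int \<Rightarrow> (nat \<Rightarrow> int) \<Rightarrow> nat \<Rightarrow> int \<times> (nat \<Rightarrow> int)" where
  "rs m \<xi> 0 = (0, mint m 1)"
| "rs m \<xi> (Suc i) = (THE p. fst p \<in> {0..\<bar>m\<bar> - 1} \<and> snd p \<in> madic m \<and>
      mmul m \<xi> (snd (rs m \<xi> i)) = madd m (mmul m (mint m m) (snd p)) (mint m (fst p)))"

definition r_fun :: "int \<Rightarrow> (nat \<Rightarrow> int) \<Rightarrow> nat \<Rightarrow> int" where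
  "r_fun m \<xi> i = fst (rs m \<xi> i)"

definition s_fun :: "int \<Rightarrow> (nat \<Rightarrow> int) \<Rightarrow> nat \<Rightarrow> (nat \<Rightarrow> int)" where
  "s_fun m \<xi> i = snd (rs m \<xi> i)"

text \<open>Words over generators 'g: a letter (g, False) is g, (g, True) is g^-1.\<close>
type_synonym 'g word = "('g \<times> bool) list"

definition inv_word :: "'g word \<Rightarrow> 'g word" where
  "inv_word w = rev (map (\<lambda>(g, b). (g, \<not> b)) w)"

definition gpow :: "'g \<Rightarrow> int \<Rightarrow> 'g word" where
  "gpow g k = (if 0 \<le> k then replicate (nat k) (g, False) else replicate (nat (- k)) (g, True))"

inductive_set pres_eq :: "'g word set \<Rightarrow> ('g word \<times> 'g word) set" for R where
  pe_refl: "(w, w) \<in> pres_eq R"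
| pe_sym: "(u, w) \<in> pres_eq R \<Longrightarrow> (w, u) \<in> pres_eq R"
| pe_trans: "(u, v) \<in> pres_eq R \<Longrightarrow> (v, w) \<in> pres_eq R \<Longrightarrow> (u, w) \<in> pres_eq R"
| pe_cancel: "(u @ [(g, b), (g, \<not> b)] @ v, u @ v) \<in> pres_eq R"
| pe_rel: "r \<in> R \<Longrightarrow> (u @ r @ v, u @ v) \<in> pres_eq R"

definition presented_group :: "'g word set \<Rightarrow> ('g word set) monoid" where
  "presented_group R = \<lparr> carrier = UNIV // pres_eq R,
     mult = (\<lambda>X Y. \<Union>x\<in>X. \<Union>y\<in>Y. pres_eq R `` {x @ y}),
     one = pres_eq R `` {[]} \<rparr>"

text \<open>Generators: the stable letter a and the basis e_0, e_1, ... of E.\<close>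
datatype gen = A | E nat

definition E_word :: "nat \<Rightarrow> (nat \<Rightarrow> int) \<Rightarrow> gen word" where
  "E_word n f = concat (map (\<lambda>i. gpow (E i) (f i)) [0..<n])"

definition E_relators :: "gen word set" where
  "E_relators = {[(E i, False), (E j, False), (E i, True), (E j, True)] | i j. True}"

text \<open>For coefficients c (with c i = 0 for i >= n), the element
  x = c 0 * (m e_0) + sum_(i>=1) c i * (e_i - r_i e_0) of E_(m,xi), written in
  coordinates, and its image phi(x) = c 0 * e_1 + sum_(i>=1) c i * e_(i+1).\<close>
definition Emx_elem :: "int \<Rightarrow> (nat \<Rightarrow> int) \<Rightarrow> nat \<Rightarrow> (nat \<Rightarrow> int) \<Rightarrow> (nat \<Rightarrow> int)" where
  "Emx_elem m \<xi> n c = (\<lambda>i. if i = 0 then m * c 0 - (\<Sum>j\<in>{1..<n}. c j * r_fun m \<xi> j) else c i)"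

definition phi_elem :: "(nat \<Rightarrow> int) \<Rightarrow> (nat \<Rightarrow> int)" where
  "phi_elem c = (\<lambda>i. if i = 0 then 0 else c (i - 1))"

definition HNN_relators :: "int \<Rightarrow> (nat \<Rightarrow> int) \<Rightarrow> gen word set" where
  "HNN_relators m \<xi> = {[(A, False)] @ E_word (Suc n) (Emx_elem m \<xi> n c) @ [(A, True)]
        @ inv_word (E_word (Suc n) (phi_elem c)) | n c. \<forall>i\<ge>n. c i = 0}"

definition BS_tilde :: "int \<Rightarrow> (nat \<Rightarrow> int) \<Rightarrow> (gen word set) monoid" where
  "BS_tilde m \<xi> = presented_group (E_relators \<union> HNN_relators m \<xi>)"

definition hopfian :: "('a, 'b) monoid_scheme \<Rightarrow> bool" where
  "hopfian G \<longleftrightarrow> (\<forall>h \<in> hom G G. h ` carrier G = carrier G \<longrightarrow> inj_on h (carrier G))"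

definition cohopfian :: "('a, 'b) monoid_scheme \<Rightarrow> bool" where
  "cohopfian G \<longleftrightarrow> (\<forall>h \<in> hom G G. inj_on h (carrier G) \<longrightarrow> h ` carrier G = carrier G)"

end

theory Submission
  imports Defs "HOL-Computational_Algebra.Polynomial_Factorial"
begin

text \<open>Write G for the group, b for e_0, and h for a surjective endomorphism. The group acts on its
  Bass--Serre tree and maps onto the wreath product of Z by Z, a to multiplication by t on Z[t,1/t] and b to
  translation by 1; this map is injective on E, with e_1 going to mt and e_(i+1) to t(e_i - r_i).

  In the wreath product one sees that h(b) has exponent 0 in a, so that, replacing h by its square, h preserves the
  exponent and multiplies translation parts by a unit P of Z[t,1/t]; in particular the kernel of h dies in
  the wreath product, which settles the case |m| = 1. If |m| > 1, then h(b) fixes a vertex: otherwise it commutes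
  with h(a)h(b)^m h(a)^-1, so its axis is invariant under h(a) and h(b), hence under G, which is
  impossible. Up to conjugation h(b) lies in E, and P being a unit forces h(b) to be b or b^-1. Since E is the
  centralizer of b, h acts on E by a sign, and u = h(a)^-1 a centralizes E_(m,xi).

  The fixed points of b^m have height at most 0, so u lies in the group B generated by the a^-i E a^i, i \<ge> 0. As
  B is the amalgam of E and a^-1 B a over E_(m,xi), and every element of exponent 0 is conjugate into B by a power of a,
  a ping-pong argument shows that h is injective. The same argument applies to
  the endomorphism fixing a and multiplying E by |m| + 1, which is not surjective.\<close>


section \<open>Words and presented groups\<close>

text \<open>The presented group is realised by concrete pairs of a permutation of normal forms and
  an affine map, whose generators visibly satisfy the relations. The normal form of a word is
  recovered from the place to which it moves the base vertex, and E embeds in the translations;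
  hence the model is faithful and every later argument takes place in it. The obstacle to
  injectivity is that h(a) is only known to be a u^-1 with u centralizing E_(m,xi). Nothing puts u
  into E, so the image of a reduced word need not be visibly reduced. Ping-pong is restored by
  replacing the half-tree behind the edge from the base vertex to its image under a^-1 by its
  translate under u z, where z in a^-1 B a is chosen to cancel the end of u.\<close>

lemma pres_eq_ctxt:
  assumes "(u, v) \<in> pres_eq R"
  shows "(x @ u @ y, x @ v @ y) \<in> pres_eq R"
  using assms
proof induction
  case (pe_cancel u g b v)
  show ?case using pres_eq.pe_cancel[of "x @ u" g b "v @ y" R] by simp
next
  case (pe_rel r u v)
  then show ?case using pres_eq.pe_rel[of r R "x @ u" "v @ y"] by simp
qed (auto intro: pres_eq.intros)

lemma pres_eq_append:
  assumes "(u, u') \<in> pres_eq R" "(v, v') \<in> pres_eq R"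
  shows "(u @ v, u' @ v') \<in> pres_eq R"
  using pres_eq_ctxt[OF assms(1), of "[]" v] pres_eq_ctxt[OF assms(2), of u' "[]"]
  by (auto intro: pe_trans)

lemma inv_word_Nil [simp]: "inv_word [] = []"
  and inv_word_Cons: "inv_word ((g, b) # w) = inv_word w @ [(g, \<not> b)]"
  and inv_word_append: "inv_word (u @ v) = inv_word v @ inv_word u"
  by (simp_all add: inv_word_def)

lemma inv_word_inv_word [simp]: "inv_word (inv_word w) = w"
  by (induction w) (auto simp: inv_word_Cons inv_word_append)

lemma append_inv_word: "(w @ inv_word w, []) \<in> pres_eq R"
proof (induction w)
  case (Cons x w)
  obtain g b where x: "x = (g, b)" by (cases x)
  have "(x # w @ inv_word w @ [(g, \<not> b)], [(g, b), (g, \<not> b)]) \<in> pres_eq R"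
    using pres_eq_ctxt[OF Cons.IH, of "[x]" "[(g, \<not> b)]"] x by simp
  moreover have "([(g, b), (g, \<not> b)], []) \<in> pres_eq R"
    using pe_cancel[of "[]" g b "[]" R] by simp
  ultimately show ?case by (auto simp: x inv_word_Cons intro: pe_trans)
qed (auto intro: pe_refl)

lemma inv_word_append_self: "(inv_word w @ w, []) \<in> pres_eq R"
  using append_inv_word[of "inv_word w" R] by simp

lemma equiv_pres_eq: "equiv UNIV (pres_eq R)"
  by (auto simp: equiv_def refl_on_def sym_def trans_def intro: pres_eq.intros)

abbreviation word_class :: "'g word set \<Rightarrow> 'g word \<Rightarrow> 'g word set"
  where "word_class R w \<equiv> pres_eq R `` {w}"

lemma word_class_eq_iff: "word_class R u = word_class R v \<longleftrightarrow> (u, v) \<in> pres_eq R"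
  using equiv_pres_eq[of R] by (simp add: eq_equiv_class_iff)

lemma carrier_presented_group: "carrier (presented_group R) = range (word_class R)"
  by (auto simp: presented_group_def quotient_def)

lemma mult_presented_group:
  "word_class R u \<otimes>\<^bsub>presented_group R\<^esub> word_class R v = word_class R (u @ v)"
proof -
  have "word_class R (x @ y) = word_class R (u @ v)"
    if "x \<in> word_class R u" "y \<in> word_class R v" for x y
    using that pres_eq_append[of u x R v y] by (auto simp: word_class_eq_iff intro: pe_sym)
  then have "(\<Union>x\<in>word_class R u. \<Union>y\<in>word_class R v. word_class R (x @ y)) =
      (\<Union>x\<in>word_class R u. \<Union>y\<in>word_class R v. word_class R (u @ v))"
    by (intro SUP_cong refl) auto
  also have "\<dots> = word_class R (u @ v)"
  proof -
    have ne: "word_class R u \<noteq> {}" "word_class R v \<noteq> {}" using pe_refl by blast+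
    show ?thesis by (simp only: SUP_const[OF ne(1)] SUP_const[OF ne(2)])
  qed
  finally show ?thesis by (simp only: presented_group_def monoid.simps partial_object.simps)
qed

fun eval_word :: "('g \<Rightarrow> 'x::group_add) \<Rightarrow> 'g word \<Rightarrow> 'x" where
  "eval_word f [] = 0"
| "eval_word f ((g, b) # w) = (if b then - f g else f g) + eval_word f w"

lemma eval_word_append [simp]: "eval_word f (u @ v) = eval_word f u + eval_word f v"
  by (induction f u rule: eval_word.induct) (auto simp: add.assoc)

lemma eval_word_inv_word [simp]: "eval_word f (inv_word w) = - eval_word f w"
  by (induction f w rule: eval_word.induct) (auto simp: inv_word_Cons minus_add simp del: add_uminus_conv_diff)

lemma eval_word_pres_eq:
  assumes "(u, v) \<in> pres_eq R" "\<And>r. r \<in> R \<Longrightarrow> eval_word f r = 0"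
  shows "eval_word f u = eval_word f v"
  using assms by (induction rule: pres_eq.induct) (auto simp: add.assoc)


section \<open>Additive groups\<close>

definition add_subgroup :: "'a::group_add set \<Rightarrow> bool" where
  "add_subgroup H \<longleftrightarrow> 0 \<in> H \<and> (\<forall>x\<in>H. \<forall>y\<in>H. x + y \<in> H) \<and> (\<forall>x\<in>H. - x \<in> H)"

lemma add_subgroupD:
  assumes "add_subgroup H"
  shows "0 \<in> H" "x \<in> H \<Longrightarrow> y \<in> H \<Longrightarrow> x + y \<in> H" "x \<in> H \<Longrightarrow> - x \<in> H"
    "x \<in> H \<Longrightarrow> y \<in> H \<Longrightarrow> x - y \<in> H"
  using assms by (auto simp: add_subgroup_def diff_conv_add_uminus simp del: add_uminus_conv_diff)

definition additive_on :: "'a::group_add set \<Rightarrow> ('a \<Rightarrow> 'a) \<Rightarrow> bool" where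
  "additive_on H f \<longleftrightarrow> f ` H \<subseteq> H \<and> (\<forall>x\<in>H. \<forall>y\<in>H. f (x + y) = f x + f y)"

lemma additive_on_0:
  assumes "additive_on H f" "add_subgroup H" shows "f 0 = 0"
proof -
  have "f 0 + f 0 = f 0 + 0"
    using assms by (metis add.right_neutral additive_on_def add_subgroupD(1))
  then show ?thesis by (metis add_left_cancel)
qed

lemma additive_on_add:
  assumes "additive_on H f" "x \<in> H" "y \<in> H" shows "f (x + y) = f x + f y"
  using assms by (auto simp: additive_on_def)

lemma additive_on_uminus:
  assumes "additive_on H f" "add_subgroup H" "x \<in> H" shows "f (- x) = - f x"
proof -
  have "f (- x) + f x = 0"
    using assms additive_on_add[of H f "- x" x] by (simp add: add_subgroupD additive_on_0)
  then show ?thesis by (metis add.inverse_unique minus_minus)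
qed

lemma additive_on_mem: "additive_on H f \<Longrightarrow> x \<in> H \<Longrightarrow> f x \<in> H"
  by (auto simp: additive_on_def)

lemma additive_on_inj:
  assumes f: "additive_on H f" and H: "add_subgroup H" and ker: "\<And>x. x \<in> H \<Longrightarrow> f x = 0 \<Longrightarrow> x = 0"
  shows "inj_on f H"
proof (rule inj_onI)
  fix x y assume xy: "x \<in> H" "y \<in> H" "f x = f y"
  have "f (x + - y) = f x + - f y"
    using xy additive_on_add[OF f, of x "- y"] additive_on_uminus[OF f H, of y] add_subgroupD(3)[OF H, of y] by simp
  then have "f (x + - y) = 0" using xy(3) by simp
  moreover have "x + - y \<in> H" by (rule add_subgroupD(2)[OF H xy(1) add_subgroupD(3)[OF H xy(2)]])
  ultimately have "x + - y = 0" by (rule ker[rotated])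
  then show "x = y" by simp
qed

text \<open>Moves the problem to an additively written group \<open>H\<close>. Closure under the
  product is bundled with the homomorphism law because \<open>G\<close> is merely a record
  here.\<close>

lemma hopfian_transfer:
  assumes bij: "bij_betw \<Psi> (carrier G) H"
    and hom: "\<And>x y. x \<in> carrier G \<Longrightarrow> y \<in> carrier G \<Longrightarrow>
      x \<otimes>\<^bsub>G\<^esub> y \<in> carrier G \<and> \<Psi> (x \<otimes>\<^bsub>G\<^esub> y) = \<Psi> x + \<Psi> y"
    and hopf: "\<And>f. additive_on H f \<Longrightarrow> f ` H = H \<Longrightarrow> inj_on f H"
  shows "hopfian G"
  unfolding hopfian_def
proof (intro ballI impI)
  fix h assume h: "h \<in> hom G G" and surj: "h ` carrier G = carrier G"
  define \<Psi>' where "\<Psi>' = inv_into (carrier G) \<Psi>"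
  define f where "f = \<Psi> \<circ> h \<circ> \<Psi>'"
  have bij': "bij_betw \<Psi>' H (carrier G)"
    unfolding \<Psi>'_def by (rule bij_betw_inv_into[OF bij])
  have P: "\<Psi> (\<Psi>' x) = x" if "x \<in> H" for x
    using bij that unfolding \<Psi>'_def by (meson bij_betw_inv_into_right)
  have Q: "\<Psi>' (\<Psi> x) = x" if "x \<in> carrier G" for x
    using bij that unfolding \<Psi>'_def by (meson bij_betw_inv_into_left)
  have mem: "\<Psi>' x \<in> carrier G" if "x \<in> H" for x using bij' that by (auto simp: bij_betw_def)
  have add: "\<Psi>' (x + y) = \<Psi>' x \<otimes>\<^bsub>G\<^esub> \<Psi>' y" if "x \<in> H" "y \<in> H" for x y
    using that hom[of "\<Psi>' x" "\<Psi>' y"] mem P Q by metis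
  have im: "f ` H = H"
    unfolding f_def image_comp[symmetric] using bij bij' surj by (simp add: bij_betw_def)
  have "additive_on H f"
    unfolding additive_on_def
    using im h mem add hom by (auto simp: f_def hom_def Pi_iff)
  then have inj: "inj_on f H" using hopf im by blast
  show "inj_on h (carrier G)"
  proof (rule inj_onI)
    fix x y assume xy: "x \<in> carrier G" "y \<in> carrier G" "h x = h y"
    have "f (\<Psi> x) = f (\<Psi> y)" using xy by (simp add: f_def Q)
    moreover have "\<Psi> x \<in> H" "\<Psi> y \<in> H" using xy bij by (auto simp: bij_betw_def)
    ultimately have "\<Psi> x = \<Psi> y" using inj by (simp add: inj_on_def)
    then show "x = y" using Q xy by metis
  qed
qed

lemma not_cohopfian_transfer:
  assumes bij: "bij_betw \<Psi> (carrier G) H"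
    and hom: "\<And>x y. x \<in> carrier G \<Longrightarrow> y \<in> carrier G \<Longrightarrow>
      x \<otimes>\<^bsub>G\<^esub> y \<in> carrier G \<and> \<Psi> (x \<otimes>\<^bsub>G\<^esub> y) = \<Psi> x + \<Psi> y"
    and f: "additive_on H f" "inj_on f H" "f ` H \<noteq> H"
  shows "\<not> cohopfian G"
proof
  assume co: "cohopfian G"
  define \<Psi>' where "\<Psi>' = inv_into (carrier G) \<Psi>"
  define h where "h = \<Psi>' \<circ> f \<circ> \<Psi>"
  have bij': "bij_betw \<Psi>' H (carrier G)"
    unfolding \<Psi>'_def by (rule bij_betw_inv_into[OF bij])
  have P: "\<Psi> (\<Psi>' x) = x" if "x \<in> H" for x
    using bij that unfolding \<Psi>'_def by (meson bij_betw_inv_into_right)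
  have Q: "\<Psi>' (\<Psi> x) = x" if "x \<in> carrier G" for x
    using bij that unfolding \<Psi>'_def by (meson bij_betw_inv_into_left)
  have mem': "\<Psi>' x \<in> carrier G" if "x \<in> H" for x using bij' that by (auto simp: bij_betw_def)
  have mem: "\<Psi> x \<in> H" if "x \<in> carrier G" for x using bij that by (auto simp: bij_betw_def)
  have add: "\<Psi>' (x + y) = \<Psi>' x \<otimes>\<^bsub>G\<^esub> \<Psi>' y" if "x \<in> H" "y \<in> H" for x y
    using that hom[of "\<Psi>' x" "\<Psi>' y"] mem' P Q by metis
  have fmem: "f x \<in> H" if "x \<in> H" for x using f(1) that by (rule additive_on_mem)
  have "h \<in> hom G G"
    unfolding hom_def using mem mem' fmem hom add additive_on_add[OF f(1)]
    by (auto simp: h_def Pi_iff)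
  moreover have "inj_on h (carrier G)"
  proof -
    have "inj_on f (\<Psi> ` carrier G)" using bij f by (simp add: bij_betw_def)
    moreover have "inj_on \<Psi>' (f ` \<Psi> ` carrier G)"
      using bij bij' f fmem by (auto simp: bij_betw_def intro: inj_on_subset)
    ultimately show ?thesis
      unfolding h_def using bij by (auto simp: bij_betw_def image_comp intro!: comp_inj_on)
  qed
  ultimately have "h ` carrier G = carrier G" using co by (auto simp: cohopfian_def)
  have "H \<subseteq> f ` H"
  proof
    fix x assume x: "x \<in> H"
    then obtain y where y: "y \<in> carrier G" "\<Psi>' x = \<Psi>' (f (\<Psi> y))"
      using mem'[OF x] \<open>h ` carrier G = carrier G\<close> by (auto simp: h_def image_iff)
    have "x = f (\<Psi> y)" using P[OF x] P[OF fmem[OF mem[OF y(1)]]] y(2) by metis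
    then show "x \<in> f ` H" using mem[OF y(1)] by blast
  qed
  then have "f ` H = H" using fmem by blast
  with f show False by blast
qed


section \<open>Permutations and affine maps as additive groups\<close>

typedef 'a perm = "{f :: 'a \<Rightarrow> 'a. bij f}"
  morphisms papp Abs_perm by (rule exI[of _ id]) simp

setup_lifting type_definition_perm

instantiation perm :: (type) group_add
begin

lift_definition zero_perm :: "'a perm" is id by simp
lift_definition plus_perm :: "'a perm \<Rightarrow> 'a perm \<Rightarrow> 'a perm" is "(\<circ>)" by (rule bij_comp)
lift_definition uminus_perm :: "'a perm \<Rightarrow> 'a perm" is "inv_into UNIV" by (rule bij_imp_bij_inv)
definition minus_perm :: "'a perm \<Rightarrow> 'a perm \<Rightarrow> 'a perm" where "minus_perm f g = f + - g"

instance
proof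
  fix a b c :: "'a perm"
  show "a + b + c = a + (b + c)" by transfer (simp add: comp_assoc)
  show "0 + a = a" "a + 0 = a" by (transfer, simp)+
  show "- a + a = 0" by transfer (simp add: bij_is_inj)
  show "a + - b = a - b" by (simp add: minus_perm_def)
qed

end

lemma papp_0 [simp]: "papp 0 x = x" by transfer simp
lemma papp_add [simp]: "papp (f + g) x = papp f (papp g x)" by transfer simp

lemma perm_eqI: "(\<And>x. papp f x = papp g x) \<Longrightarrow> f = g" by transfer auto

section \<open>The wreath product of Z by Z as affine maps\<close>

abbreviation "tt \<equiv> to_fract [:0, 1 :: int:]"

lemma tt_nonzero [simp]: "tt \<noteq> 0" by simp

lemma tt_power: "tt ^ n = to_fract (monom 1 n)"
proof (induction n)
  case (Suc n)
  have "monom 1 (Suc n) = [:0, 1 :: int:] * monom 1 n" by (simp add: monom_Suc)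
  then show ?case using Suc by (metis power_Suc to_fract_mult)
qed simp

lemma tt_power_int_eq_1_iff: "tt powi i = 1 \<longleftrightarrow> i = 0"
proof -
  have *: "tt ^ n = 1 \<longleftrightarrow> n = 0" for n
    by (metis tt_power to_fract_1 to_fract_eq_iff degree_monom_eq degree_1 one_neq_zero power_0)
  show ?thesis
  proof (cases "i \<ge> 0")
    case True
    then show ?thesis using *[of "nat i"] by (simp only: power_int_def) simp
  next
    case False
    then have "tt powi i = inverse (tt ^ nat (- i))" by (simp only: power_int_def) (simp add: power_inverse)
    then show ?thesis using *[of "nat (- i)"] False by (simp only: inverse_eq_1_iff) simp
  qed
qed

text \<open>\<open>Aff i f\<close> stands for the map x to t^i x + f. Translations are taken in the
  fraction field of Z[t], where t is invertible; the elements that occur have Laurent polynomials as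
  translation parts (\<open>\<tau>_Laurent\<close>).\<close>

datatype aff = Aff (deg_of: int) (transl: "int poly fract")

instantiation aff :: group_add
begin

definition zero_aff :: aff where "zero_aff = Aff 0 0"
definition plus_aff :: "aff \<Rightarrow> aff \<Rightarrow> aff" where
  "plus_aff f g = Aff (deg_of f + deg_of g) (transl f + tt powi deg_of f * transl g)"
definition uminus_aff :: "aff \<Rightarrow> aff" where
  "uminus_aff f = Aff (- deg_of f) (- (tt powi (- deg_of f) * transl f))"
definition minus_aff :: "aff \<Rightarrow> aff \<Rightarrow> aff" where "minus_aff f g = f + - g"

instance
proof
  fix a b c :: aff
  show "a + b + c = a + (b + c)"
    by (simp add: plus_aff_def power_int_add ring_distribs mult.assoc add.assoc)
  show "0 + a = a" "a + 0 = a" by (simp_all add: zero_aff_def plus_aff_def)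
  show "- a + a = 0" by (simp add: zero_aff_def plus_aff_def uminus_aff_def)
  show "a + - b = a - b" by (simp add: minus_aff_def)
qed

end

lemma deg_of_simps [simp]:
  "deg_of 0 = 0" "deg_of (f + g) = deg_of f + deg_of g" "deg_of (- f) = - deg_of f"
  "deg_of (f - g) = deg_of f - deg_of g"
  by (simp_all add: zero_aff_def plus_aff_def uminus_aff_def minus_aff_def del: add_uminus_conv_diff)

lemma transl_simps [simp]:
  "transl 0 = 0" "transl (f + g) = transl f + tt powi deg_of f * transl g"
  "transl (- f) = - (tt powi (- deg_of f) * transl f)"
  by (simp_all add: zero_aff_def plus_aff_def uminus_aff_def)


section \<open>The base group and the associated subgroups\<close>

text \<open>The linear extension to E of the assignment of \<open>s i\<close> to the basis element
  e_i.\<close>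

definition lin :: "(nat \<Rightarrow> 'a::comm_ring_1) \<Rightarrow> int poly \<Rightarrow> 'a" where
  "lin s p = (\<Sum>i\<le>degree p. of_int (coeff p i) * s i)"

lemma lin_eq_sum:
  assumes "degree p \<le> n"
  shows "lin s p = (\<Sum>i\<le>n. of_int (coeff p i) * s i)"
  unfolding lin_def using assms
  by (intro sum.mono_neutral_left) (auto simp: coeff_eq_0)

lemma lin_0 [simp]: "lin s 0 = 0"
  by (simp add: lin_def)

lemma lin_add [simp]: "lin s (p + q) = lin s p + lin s q"
proof -
  define n where "n = max (degree p) (degree q)"
  have "degree p \<le> n" "degree q \<le> n" "degree (p + q) \<le> n"
    by (auto simp: n_def degree_add_le)
  then show ?thesis by (simp add: lin_eq_sum[of _ n] sum.distrib algebra_simps)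
qed

lemma lin_minus [simp]: "lin s (- p) = - lin s p"
  using lin_add[of s p "- p"] by (simp add: eq_neg_iff_add_eq_0 add.commute del: lin_add)

lemma lin_smult [simp]: "lin s (smult c p) = of_int c * lin s p"
  by (simp add: lin_eq_sum[of _ "degree p"] degree_smult_le sum_distrib_left mult.assoc)

lemma lin_pCons [simp]: "lin s (pCons c p) = of_int c * s 0 + lin (\<lambda>i. s (Suc i)) p"
  by (simp add: lin_eq_sum[of "pCons c p" "Suc (degree p)"] degree_pCons_le
      sum.atMost_Suc_shift lin_def del: sum.atMost_Suc)

lemma lin_affine: "lin (\<lambda>i. x * (s i - of_int (u i))) p = x * (lin s p - of_int (lin u p))"
  by (simp add: lin_def sum_distrib_left algebra_simps flip: sum_subtractf)

definition tail :: "int poly \<Rightarrow> int poly" where "tail p = poly_shift 1 p"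

lemma pCons_coeff_tail: "pCons (coeff p 0) (tail p) = p"
  by (rule poly_eqI) (auto simp: coeff_pCons tail_def coeff_poly_shift split: nat.split)

lemma tail_pCons [simp]: "tail (pCons c p) = p"
  by (rule poly_eqI) (auto simp: tail_def coeff_poly_shift)

lemma tail_simps [simp]: "tail (p + q) = tail p + tail q" "tail 0 = 0" "tail (smult c p) = smult c (tail p)"
  by (rule poly_eqI, auto simp: tail_def coeff_poly_shift)+

lemma coeff_tail [simp]: "coeff (tail p) i = coeff p (Suc i)"
  by (simp add: tail_def coeff_poly_shift)

abbreviation head :: "int poly \<Rightarrow> int" where "head p \<equiv> coeff p 0"

locale bs =
  fixes m :: int and \<xi> :: "nat \<Rightarrow> int"
  assumes m_nonzero: "m \<noteq> 0"
begin

abbreviation r :: "nat \<Rightarrow> int" where "r \<equiv> r_fun m \<xi>"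

definition \<rho> :: "int poly \<Rightarrow> int" where
  "\<rho> = lin (\<lambda>i. if i = 0 then 1 else r i)"

text \<open>In the basis m e_0, e_i - r_i e_0 of E_(m,xi), the coordinates of \<open>p\<close> are
  \<open>\<rho> p div m\<close> and the coefficients of \<open>p\<close> from index 1 on; they are
  shifted up by one place.\<close>

definition \<phi> :: "int poly \<Rightarrow> int poly" where
  "\<phi> p = pCons 0 (pCons (\<rho> p div m) (tail p))"

text \<open>The sum of p_1 (m e_0) and the p_(i+1) (e_i - r_i e_0). The coefficient of e_0 is
  ignored, so \<open>\<psi>\<close> is additive on all of E and acts as if that coefficient had been
  removed.\<close>

definition \<psi> :: "int poly \<Rightarrow> int poly" where
  "\<psi> p = pCons (m * head (tail p) - \<rho> (pCons 0 (tail (tail p)))) (tail (tail p))"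

text \<open>The base group E is \<^typ>\<open>int poly\<close>, with the monomials as the basis e_i. The subgroup
  E_(m,xi) consists of the \<^term>\<open>p\<close> with \<^term>\<open>m dvd \<rho> p\<close>, and E_1 of those with \<^term>\<open>head p = 0\<close>;
  outside these subgroups \<^term>\<open>\<phi>\<close> and its inverse \<^term>\<open>\<psi>\<close> take junk values.\<close>

lemma \<rho>_simps [simp]: "\<rho> 0 = 0" "\<rho> (p + q) = \<rho> p + \<rho> q" "\<rho> (- p) = - \<rho> p" "\<rho> (smult c p) = c * \<rho> p"
  by (simp_all add: \<rho>_def)

lemma \<rho>_pCons: "\<rho> (pCons c p) = c + lin (\<lambda>i. r (Suc i)) p"
  by (simp add: \<rho>_def)

lemma \<rho>_const [simp]: "\<rho> [:c:] = c"
  by (simp add: \<rho>_pCons)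

lemma \<rho>_\<psi> [simp]: "\<rho> (\<psi> p) = m * head (tail p)"
  by (simp add: \<psi>_def \<rho>_pCons)

lemma head_\<phi> [simp]: "head (\<phi> p) = 0"
  by (simp add: \<phi>_def)

lemma \<psi>_\<phi>: assumes "m dvd \<rho> p" shows "\<psi> (\<phi> p) = p"
proof -
  have "\<rho> p = head p + lin (\<lambda>i. r (Suc i)) (tail p)"
    by (metis \<rho>_pCons pCons_coeff_tail)
  then show ?thesis using assms by (simp add: \<psi>_def \<phi>_def \<rho>_pCons pCons_coeff_tail)
qed

lemma \<phi>_\<psi>: assumes "head p = 0" shows "\<phi> (\<psi> p) = p"
proof -
  have "\<phi> (\<psi> p) = pCons 0 (pCons (head (tail p)) (tail (tail p)))"
    using m_nonzero unfolding \<phi>_def \<rho>_\<psi> by (simp add: \<psi>_def)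
  then show ?thesis using assms by (metis pCons_coeff_tail)
qed

lemma \<phi>_0 [simp]: "\<phi> 0 = 0" by (simp add: \<phi>_def)
lemma \<psi>_0 [simp]: "\<psi> 0 = 0" by (simp add: \<psi>_def)

lemma \<phi>_add: "m dvd \<rho> p \<Longrightarrow> \<phi> (p + q) = \<phi> p + \<phi> q"
  by (simp add: \<phi>_def div_plus_div_distrib_dvd_left)

lemma \<phi>_smult: "m dvd \<rho> p \<Longrightarrow> \<phi> (smult k p) = smult k (\<phi> p)"
  by (simp add: \<phi>_def div_mult_swap)

lemma \<psi>_add: "\<psi> (p + q) = \<psi> p + \<psi> q"
  by (simp add: \<psi>_def \<rho>_pCons algebra_simps)

lemma \<psi>_const [simp]: "\<psi> [:c:] = 0"
  by (simp add: \<psi>_def)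

text \<open>The image of e_i in Z[t]. The recursion is dictated by the relations: conjugation by a
  must become multiplication by t (\<open>\<pi>_\<phi>\<close>).\<close>

primrec \<epsilon> :: "nat \<Rightarrow> int poly" where
  "\<epsilon> 0 = 1"
| "\<epsilon> (Suc i) = [:0, 1:] * (if i = 0 then [:m:] else \<epsilon> i - of_int (r i))"

definition \<pi> :: "int poly \<Rightarrow> int poly" where "\<pi> = lin \<epsilon>"

lemma \<pi>_simps [simp]:
  "\<pi> 0 = 0" "\<pi> (p + q) = \<pi> p + \<pi> q" "\<pi> (- p) = - \<pi> p" "\<pi> (smult c p) = of_int c * \<pi> p"
  "\<pi> [:c:] = of_int c"
  by (simp_all add: \<pi>_def)

lemma \<pi>_\<phi>: assumes "m dvd \<rho> p" shows "\<pi> (\<phi> p) = [:0, 1:] * \<pi> p"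
proof -
  define c s where "c = head p" and "s = tail p"
  have p: "p = pCons c s" by (simp add: c_def s_def pCons_coeff_tail)
  obtain d where d: "\<rho> p = m * d" using assms by blast
  have l: "lin (\<lambda>i. r (Suc i)) s = m * d - c" using d by (simp add: p \<rho>_pCons)
  have "\<phi> p = pCons 0 (pCons d s)" using d m_nonzero by (simp add: \<phi>_def s_def)
  then have "\<pi> (\<phi> p) = of_int d * ([:0, 1:] * [:m:]) + lin (\<lambda>i. [:0, 1:] * (\<epsilon> (Suc i) - of_int (r (Suc i)))) s"
    by (simp add: \<pi>_def del: mult_pCons_left)
  also have "\<dots> = of_int d * ([:0, 1:] * of_int m) + [:0, 1:] * (lin (\<lambda>i. \<epsilon> (Suc i)) s - of_int (m * d - c))"
    unfolding lin_affine l by (simp add: of_int_poly)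
  also have "\<dots> = [:0, 1:] * (of_int c + lin (\<lambda>i. \<epsilon> (Suc i)) s)"
    unfolding of_int_diff of_int_mult by (simp only: algebra_simps)
  also have "of_int c + lin (\<lambda>i. \<epsilon> (Suc i)) s = \<pi> p" by (simp add: \<pi>_def p)
  finally show ?thesis .
qed

lemma coeff_\<epsilon>: "coeff (\<epsilon> i) i = (if i = 0 then 1 else m)" "j > i \<Longrightarrow> coeff (\<epsilon> i) j = 0"
proof (induction i arbitrary: j)
  case (Suc i)
  {
    case 1
    show ?case using Suc.IH(1) by (auto simp: of_int_poly coeff_pCons split: nat.split)
  next
    case 2
    then show ?case using Suc.IH(2)[of "j - 1"]
      by (cases j) (auto simp: of_int_poly coeff_pCons split: nat.split)
  }
qed auto

text \<open>\<open>\<epsilon> i\<close> has degree i, with leading coefficient m for i > 0, so only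
  the top term of \<open>p\<close> contributes. This gives injectivity on E, and later shows that
  for |m| > 1 only constants can map to units of the Laurent ring.\<close>

lemma coeff_\<pi>_degree: "coeff (\<pi> p) (degree p) = (if degree p = 0 then 1 else m) * lead_coeff p"
proof -
  have "coeff (\<pi> p) (degree p) = (\<Sum>i\<le>degree p. coeff p i * coeff (\<epsilon> i) (degree p))"
    by (simp add: \<pi>_def lin_def coeff_sum of_int_poly)
  also have "\<dots> = coeff p (degree p) * coeff (\<epsilon> (degree p)) (degree p)"
    by (subst sum.remove[of _ "degree p"]) (auto intro!: sum.neutral simp: coeff_\<epsilon>)
  finally show ?thesis by (simp add: coeff_\<epsilon>)
qed

lemma degree_\<pi>: "degree (\<pi> p) = degree p"
proof (rule antisym)
  show "degree (\<pi> p) \<le> degree p"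
    by (rule degree_le) (auto simp: \<pi>_def lin_def coeff_sum of_int_poly coeff_\<epsilon> intro!: sum.neutral)
  show "degree p \<le> degree (\<pi> p)"
    using coeff_\<pi>_degree[of p] m_nonzero by (cases "p = 0") (auto intro!: le_degree split: if_splits)
qed

lemma \<pi>_eq_0_iff [simp]: "\<pi> p = 0 \<longleftrightarrow> p = 0"
proof
  assume "\<pi> p = 0"
  then have "lead_coeff p = 0" using coeff_\<pi>_degree[of p] m_nonzero by (simp split: if_splits)
  then show "p = 0" by (simp only: leading_coeff_0_iff)
qed simp

lemma \<pi>_inj: assumes "\<pi> p = \<pi> q" shows "p = q"
proof -
  have "\<pi> (p + - q) = 0" using assms by (simp del: add_uminus_conv_diff)
  then show ?thesis by simp
qed


section \<open>Normal forms and the action on the Bass--Serre tree\<close>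

text \<open>A vertex of the tree, that is a coset of the base group, is coded by its normal form: \<^term>\<open>(k, True)\<close> stands
  for b^k a and \<^term>\<open>(k, False)\<close> for b^k a^-1, where b = e_0. Multiples of b represent the cosets both of
  E_(m,xi) and of E_1.\<close>

fun valid :: "(int \<times> bool) list \<Rightarrow> bool" where
  "valid [] \<longleftrightarrow> True"
| "valid ((k, b) # l) \<longleftrightarrow> (b \<or> 0 \<le> k \<and> k < \<bar>m\<bar>) \<and> (l = [] \<or> snd (hd l) = b \<or> fst (hd l) \<noteq> 0) \<and> valid l"

text \<open>Moves an element of E through a normal form from left to right: p b^k a is b^(k + head
  p) a times an element of E, and p b^k a^-1 is b^k' a^-1 times another, with k' the residue of k +
  \<open>\<rho> p\<close>. The element of E left at the end is absorbed by the coset.\<close>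

fun eact :: "int poly \<Rightarrow> (int \<times> bool) list \<Rightarrow> (int \<times> bool) list" where
  "eact p [] = []"
| "eact p ((k, True) # l) = (k + head p, True) # eact (\<psi> p) l"
| "eact p ((k, False) # l) =
    ((k + \<rho> p) mod \<bar>m\<bar>, False) # eact (\<phi> (p + [:k - (k + \<rho> p) mod \<bar>m\<bar>:])) l"

lemma carry_dvd: "m dvd \<rho> (p + [:k - (k + \<rho> p) mod \<bar>m\<bar>:])"
proof -
  have "\<bar>m\<bar> dvd (k + \<rho> p) - (k + \<rho> p) mod \<bar>m\<bar>" by (rule dvd_minus_mod)
  then have "m dvd k + \<rho> p - (k + \<rho> p) mod \<bar>m\<bar>" by (simp only: abs_dvd_iff)
  then show ?thesis by (simp add: algebra_simps)
qed

lemma length_eact [simp]: "length (eact p l) = length l"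
  by (induction p l rule: eact.induct) auto

lemma eact_eq_Nil_iff [simp]: "eact p l = [] \<longleftrightarrow> l = []"
  using length_eact[of p l] by (metis length_0_conv)

text \<open>In the descending case the two carries telescope, and the elements fed to
  \<open>\<phi>\<close> lie in E_(m,xi), where it is additive.\<close>

lemma eact_add: "eact (p + q) l = eact p (eact q l)"
proof (induction q l arbitrary: p rule: eact.induct)
  case (2 q k l)
  then show ?case by (simp add: \<psi>_add)
next
  case (3 q k l)
  define k' where "k' = (k + \<rho> q) mod \<bar>m\<bar>"
  define k'' where "k'' = (k' + \<rho> p) mod \<bar>m\<bar>"
  have k'': "(k + (\<rho> p + \<rho> q)) mod \<bar>m\<bar> = k''"
    unfolding k'_def k''_def by (metis add.assoc add.commute mod_add_left_eq)
  have "m dvd \<rho> (p + [:k' - k'':])" "m dvd \<rho> (q + [:k - k':])"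
    using carry_dvd[of p k'] carry_dvd[of q k] by (simp_all add: k''_def k'_def)
  moreover have "p + q + [:k - k'':] = (p + [:k' - k'':]) + (q + [:k - k':])"
    by (simp add: algebra_simps)
  ultimately have "\<phi> (p + q + [:k - k'':]) = \<phi> (p + [:k' - k'':]) + \<phi> (q + [:k - k':])"
    by (metis \<phi>_add)
  then show ?case using 3 by (simp add: k'' flip: k'_def k''_def)
qed auto

lemma eact_0: "valid l \<Longrightarrow> eact 0 l = l"
  by (induction "0 :: int poly" l rule: eact.induct) auto

lemma hd_eact:
  assumes "l \<noteq> []"
  shows "snd (hd (eact p l)) = snd (hd l)"
    "snd (hd l) \<Longrightarrow> fst (hd (eact p l)) = fst (hd l) + head p"
    "\<not> snd (hd l) \<Longrightarrow> fst (hd (eact p l)) = (fst (hd l) + \<rho> p) mod \<bar>m\<bar>"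
  using assms by (induction p l rule: eact.induct) auto

lemma mod_carry_0: "0 \<le> k \<Longrightarrow> k < \<bar>m\<bar> \<Longrightarrow> m dvd c \<Longrightarrow> (k + c) mod \<bar>m\<bar> = k"
  by (metis abs_dvd_iff dvd_eq_mod_eq_0 mod_add_right_eq mod_pos_pos_trivial add.right_neutral)

lemma valid_hd:
  "valid l \<Longrightarrow> l \<noteq> [] \<Longrightarrow> \<not> snd (hd l) \<Longrightarrow> 0 \<le> fst (hd l) \<and> fst (hd l) < \<bar>m\<bar>"
  by (cases l rule: valid.cases) auto

text \<open>What is passed on after a letter lies in E_(m,xi) or in E_1, exactly the subgroup that
  leaves the exponent of a following letter of opposite sign unchanged. A nonzero exponent
  preventing cancellation therefore stays nonzero.\<close>

lemma valid_eact: "valid l \<Longrightarrow> valid (eact p l)"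
proof (induction p l rule: eact.induct)
  case (2 p k l)
  show ?case
  proof (cases "l \<noteq> [] \<and> \<not> snd (hd l)")
    case True
    then have "fst (hd (eact (\<psi> p) l)) = fst (hd l)"
      using valid_hd[of l] 2 by (simp add: hd_eact mod_carry_0)
    then show ?thesis using 2 True by (auto simp: hd_eact(1))
  qed (use 2 in \<open>auto simp: hd_eact(1)\<close>)
next
  case (3 p k l)
  show ?case
  proof (cases "l \<noteq> [] \<and> snd (hd l)")
    case True
    then have "fst (hd (eact (\<phi> (p + [:k - (k + \<rho> p) mod \<bar>m\<bar>:])) l)) = fst (hd l)"
      by (subst hd_eact(2)) auto
    then show ?thesis using 3 True m_nonzero by (auto simp: hd_eact(1))
  qed (use 3 m_nonzero in \<open>auto simp: hd_eact(1)\<close>)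
qed auto

text \<open>Left multiplication by a on normal forms, cancelling against a leading a^-1;
  \<open>down\<close> does the same for a^-1.\<close>

definition up :: "(int \<times> bool) list \<Rightarrow> (int \<times> bool) list" where
  "up l = (if l \<noteq> [] \<and> hd l = (0, False) then tl l else (0, True) # l)"

definition down :: "(int \<times> bool) list \<Rightarrow> (int \<times> bool) list" where
  "down l = (if l \<noteq> [] \<and> hd l = (0, True) then tl l else (0, False) # l)"

lemma valid_up: "valid l \<Longrightarrow> valid (up l)"
  by (cases l rule: valid.cases) (auto simp: up_def prod_eq_iff)

lemma valid_down: "valid l \<Longrightarrow> valid (down l)"
  using m_nonzero by (cases l rule: valid.cases) (auto simp: down_def prod_eq_iff)

lemma down_up: "valid l \<Longrightarrow> down (up l) = l"
  by (cases l rule: valid.cases) (auto simp: up_def down_def prod_eq_iff)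

lemma up_down: "valid l \<Longrightarrow> up (down l) = l"
  by (cases l rule: valid.cases) (auto simp: up_def down_def prod_eq_iff)

text \<open>The HNN relation on vertices. Since \<open>p\<close> lies in E_(m,xi), it fixes the edge
  towards a^-1, so cancellation occurs before applying \<open>p\<close> exactly when it occurs
  after.\<close>

lemma up_eact:
  assumes "m dvd \<rho> p" "valid l"
  shows "up (eact p l) = eact (\<phi> p) (up l)"
proof (cases "l \<noteq> [] \<and> hd l = (0, False)")
  case True
  then obtain l' where l: "l = (0, False) # l'" by (cases l) auto
  have "\<rho> p mod \<bar>m\<bar> = 0" using assms by simp
  then show ?thesis by (simp add: l up_def)
next
  case False
  have "\<not> (eact p l \<noteq> [] \<and> hd (eact p l) = (0, False))"
  proof
    assume a: "eact p l \<noteq> [] \<and> hd (eact p l) = (0, False)"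
    then have l: "l \<noteq> []" by auto
    then have "\<not> snd (hd l)" using a hd_eact(1)[of l p] by auto
    then have "fst (hd l) = 0"
      using a l hd_eact(3)[of l p] valid_hd[of l] mod_carry_0[of "fst (hd l)" "\<rho> p"] assms by auto
    then show False using False l \<open>\<not> snd (hd l)\<close> by (auto simp: prod_eq_iff)
  qed
  then show ?thesis using False assms by (auto simp: up_def \<psi>_\<phi>)
qed

text \<open>The identity off the valid lists, because \<open>perm\<close> consists of bijections of
  the whole type.\<close>

definition perm_of :: "((int \<times> bool) list \<Rightarrow> (int \<times> bool) list) \<Rightarrow> (int \<times> bool) list perm" where
  "perm_of f = Abs_perm (\<lambda>l. if valid l then f l else l)"

lemma papp_perm_of:
  assumes "\<And>l. valid l \<Longrightarrow> valid (f l)" "\<And>l. valid l \<Longrightarrow> valid (g l)"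
    "\<And>l. valid l \<Longrightarrow> f (g l) = l" "\<And>l. valid l \<Longrightarrow> g (f l) = l"
  shows "papp (perm_of f) l = (if valid l then f l else l)"
proof -
  have "bij (\<lambda>l. if valid l then f l else l)"
    by (rule o_bij[of "\<lambda>l. if valid l then g l else l"]) (auto simp: fun_eq_iff assms)
  then show ?thesis by (simp add: perm_of_def Abs_perm_inverse)
qed

lemma papp_eact: "papp (perm_of (eact p)) l = (if valid l then eact p l else l)"
  by (rule papp_perm_of[of _ "eact (- p)"]) (auto simp: valid_eact eact_0 simp flip: eact_add)

lemma papp_up: "papp (perm_of up) l = (if valid l then up l else l)"
  by (rule papp_perm_of[of _ down]) (auto simp: valid_up valid_down up_down down_up)

end


section \<open>The concrete model\<close>

text \<open>Noncommutative groups are written additively, to have them as instances of \<^class>\<open>group_add\<close>.\<close>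

datatype model = Model (perm_part: "(int \<times> bool) list perm") (aff_part: aff)

instantiation model :: group_add
begin

definition zero_model :: model where "zero_model = Model 0 0"
definition plus_model :: "model \<Rightarrow> model \<Rightarrow> model" where
  "plus_model g h = Model (perm_part g + perm_part h) (aff_part g + aff_part h)"
definition uminus_model :: "model \<Rightarrow> model" where
  "uminus_model g = Model (- perm_part g) (- aff_part g)"
definition minus_model :: "model \<Rightarrow> model \<Rightarrow> model" where "minus_model g h = g + - h"

instance
proof
  fix a b c :: model
  show "a + b + c = a + (b + c)" by (simp add: plus_model_def add.assoc)
  show "0 + a = a" "a + 0 = a" by (simp_all add: zero_model_def plus_model_def)
  show "- a + a = 0" by (simp add: zero_model_def plus_model_def uminus_model_def)
  show "a + - b = a - b" by (simp add: minus_model_def)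
qed

end

lemma model_part_simps [simp]:
  "perm_part 0 = 0" "perm_part (g + h) = perm_part g + perm_part h" "perm_part (- g) = - perm_part g"
  "aff_part 0 = 0" "aff_part (g + h) = aff_part g + aff_part h" "aff_part (- g) = - aff_part g"
  "aff_part (g - h) = aff_part g - aff_part h"
  by (simp_all add: zero_model_def plus_model_def uminus_model_def minus_model_def)

definition act :: "model \<Rightarrow> (int \<times> bool) list \<Rightarrow> (int \<times> bool) list" where
  "act g l = papp (perm_part g) l"

definition \<chi> :: "model \<Rightarrow> int" where "\<chi> g = deg_of (aff_part g)"

definition \<tau> :: "model \<Rightarrow> int poly fract" where "\<tau> g = transl (aff_part g)"

lemma act_simps [simp]: "act 0 l = l" "act (g + h) l = act g (act h l)"
  by (simp_all add: act_def)

lemma act_uminus_cancel [simp]: "act (- g) (act g l) = l" "act g (act (- g) l) = l"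
  by (simp_all flip: act_simps(2))

lemma \<chi>_simps [simp]:
  "\<chi> 0 = 0" "\<chi> (g + h) = \<chi> g + \<chi> h" "\<chi> (- g) = - \<chi> g" "\<chi> (g - h) = \<chi> g - \<chi> h"
  by (simp_all add: \<chi>_def)

lemma \<tau>_simps [simp]: "\<tau> 0 = 0" "\<tau> (g + h) = \<tau> g + tt powi \<chi> g * \<tau> h"
  "\<tau> (- g) = - (tt powi (- \<chi> g) * \<tau> g)"
  by (simp_all add: \<chi>_def \<tau>_def)

lemma model_eqI:
  "(\<And>l. act g l = act h l) \<Longrightarrow> \<chi> g = \<chi> h \<Longrightarrow> \<tau> g = \<tau> h \<Longrightarrow> g = h"
  by (auto simp: act_def \<chi>_def \<tau>_def intro: perm_eqI intro!: model.expand aff.expand)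

context bs begin

definition eh :: "int poly \<Rightarrow> model" where
  "eh p = Model (perm_of (eact p)) (Aff 0 (to_fract (\<pi> p)))"

definition ga :: model where "ga = Model (perm_of up) (Aff 1 0)"

lemma act_eh: "act (eh p) l = (if valid l then eact p l else l)"
  by (simp add: act_def eh_def papp_eact)

lemma act_ga: "act ga l = (if valid l then up l else l)"
  by (simp add: act_def ga_def papp_up)

lemma act_uminus_ga: "valid l \<Longrightarrow> act (- ga) l = down l"
  by (metis act_ga act_uminus_cancel(1) up_down valid_down)

lemma \<chi>_\<tau>_gen [simp]: "\<chi> (eh p) = 0" "\<tau> (eh p) = to_fract (\<pi> p)" "\<chi> ga = 1" "\<tau> ga = 0"
  by (simp_all add: \<chi>_def \<tau>_def eh_def ga_def)

lemma eh_add: "eh (p + q) = eh p + eh q"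
  by (rule model_eqI) (auto simp: act_eh eact_add valid_eact)

lemma eh_0 [simp]: "eh 0 = 0"
  by (rule model_eqI) (auto simp: act_eh eact_0)

lemma eh_minus: "eh (- p) = - eh p"
  using eh_add[of "- p" p] by (simp add: eq_neg_iff_add_eq_0)

lemma eh_commute: "eh p + eh q = eh q + eh p"
  by (metis add.commute eh_add)

lemma eh_inj: "eh p = eh q \<longleftrightarrow> p = q"
proof
  assume "eh p = eh q"
  then have "to_fract (\<pi> p) = to_fract (\<pi> q)" by (metis \<chi>_\<tau>_gen(2))
  then show "p = q" by (simp add: \<pi>_inj)
qed simp

lemma ga_eh: assumes "m dvd \<rho> p" shows "ga + eh p = eh (\<phi> p) + ga"
  by (rule model_eqI)
    (auto simp: act_eh act_ga valid_up valid_eact up_eact[OF assms] \<pi>_\<phi>[OF assms]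
      simp flip: to_fract_mult simp del: to_fract_mult mult_pCons_left)

lemma eh_ga: "head p = 0 \<Longrightarrow> eh p + ga = ga + eh (\<psi> p)"
  using ga_eh[of "\<psi> p"] by (simp add: \<phi>_\<psi>)

end


section \<open>The presentation and the model agree\<close>

lemma pres_eq_move:
  assumes "(x @ u @ inv_word x @ inv_word v, []) \<in> pres_eq R"
  shows "(x @ u, v @ x) \<in> pres_eq R"
proof -
  note [trans] = pe_trans
  have "(x @ u, x @ u @ inv_word x @ inv_word v @ v @ x) \<in> pres_eq R"
  proof (rule pe_sym)
    have "(x @ u @ inv_word x @ inv_word v @ v @ x, x @ u @ inv_word x @ x) \<in> pres_eq R"
      using pres_eq_ctxt[OF inv_word_append_self[of v], of "x @ u @ inv_word x" x] by simp
    also have "(x @ u @ inv_word x @ x, x @ u) \<in> pres_eq R"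
      using pres_eq_ctxt[OF inv_word_append_self[of x], of "x @ u" "[]"] by simp
    finally show "(x @ u @ inv_word x @ inv_word v @ v @ x, x @ u) \<in> pres_eq R" .
  qed
  also have "(x @ u @ inv_word x @ inv_word v @ v @ x, v @ x) \<in> pres_eq R"
    using pres_eq_ctxt[OF assms, of "[]" "v @ x"] by simp
  finally show ?thesis .
qed

lemma pres_eq_move_inv:
  assumes "(x @ u, v @ x) \<in> pres_eq R"
  shows "(inv_word x @ v, u @ inv_word x) \<in> pres_eq R"
proof -
  note [trans] = pe_trans
  have "(inv_word x @ v, inv_word x @ v @ x @ inv_word x) \<in> pres_eq R"
    using pe_sym[OF pres_eq_ctxt[OF append_inv_word[of x R], of "inv_word x @ v" "[]"]] by simp
  also have "(inv_word x @ v @ x @ inv_word x, inv_word x @ x @ u @ inv_word x) \<in> pres_eq R"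
    using pe_sym[OF pres_eq_ctxt[OF assms, of "inv_word x" "inv_word x"]] by simp
  also have "(inv_word x @ x @ u @ inv_word x, u @ inv_word x) \<in> pres_eq R"
    using pres_eq_ctxt[OF inv_word_append_self[of x], of "[]" "u @ inv_word x"] by simp
  finally show ?thesis .
qed

lemma gpow_step:
  "((g, b) # gpow g c, gpow g (if b then c - 1 else c + 1)) \<in> pres_eq R"
proof -
  have *: "((g, b) # (g, \<not> b) # w, w) \<in> pres_eq R" for w
    using pe_cancel[of "[]" g b w R] by simp
  consider "\<not> b" "0 \<le> c" | "\<not> b" "c < 0" | b "0 < c" | b "c \<le> 0" by linarith
  then show ?thesis
  proof cases
    case 1
    then have "nat (c + 1) = Suc (nat c)" by simp
    with 1 show ?thesis by (simp add: gpow_def pe_refl)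
  next
    case 2
    then have "nat (- c) = Suc (nat (- (c + 1)))" by linarith
    moreover have "gpow g (c + 1) = replicate (nat (- (c + 1))) (g, True)"
      using 2 by (cases "c = - 1") (auto simp: gpow_def)
    ultimately have "gpow g c = (g, True) # gpow g (c + 1)"
      using 2 by (simp add: gpow_def)
    with 2 show ?thesis using *[of "gpow g (c + 1)"] by simp
  next
    case 3
    then have "nat c = Suc (nat (c - 1))" by linarith
    then have "gpow g c = (g, False) # gpow g (c - 1)"
      using 3 by (simp add: gpow_def)
    with 3 show ?thesis using *[of "gpow g (c - 1)"] by simp
  next
    case 4
    then have "nat (1 - c) = Suc (nat (- c))" by linarith
    with 4 show ?thesis by (auto simp: gpow_def pe_refl)
  qed
qed

definition vec :: "nat \<Rightarrow> (nat \<Rightarrow> int) \<Rightarrow> int poly" where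
  "vec n f = (\<Sum>i<n. monom (f i) i)"

lemma coeff_vec: "coeff (vec n f) j = (if j < n then f j else 0)"
proof -
  have "coeff (vec n f) j = (\<Sum>i<n. if i = j then f i else 0)"
    by (simp add: vec_def coeff_sum)
  then show ?thesis by (simp add: sum.delta)
qed

lemma E_word_Suc: "E_word (Suc n) f = E_word n f @ gpow (E n) (f n)"
  by (simp add: E_word_def)

lemma E_word_0: "E_word n (\<lambda>_. 0) = []"
  by (induction n) (auto simp: E_word_Suc gpow_def, simp add: E_word_def)

section \<open>Words in the letters of E\<close>

definition eword :: "gen word \<Rightarrow> bool" where
  "eword w \<longleftrightarrow> (\<forall>(g, b)\<in>set w. g \<noteq> A)"

lemma eword_simps [simp]:
  "eword []" "eword (u @ v) \<longleftrightarrow> eword u \<and> eword v" "eword (x # v) \<longleftrightarrow> fst x \<noteq> A \<and> eword v"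
  by (auto simp: eword_def)

lemma eword_gpow [simp]: "eword (gpow (E i) c)"
  by (auto simp: eword_def gpow_def)

lemma eword_E_word [simp]: "eword (E_word n f)"
  by (induction n) (simp_all add: E_word_Suc, simp add: E_word_def)

definition exps :: "gen word \<Rightarrow> int poly" where
  "exps = eval_word (\<lambda>g. case g of A \<Rightarrow> 0 | E i \<Rightarrow> monom 1 i)"

lemma exps_simps [simp]: "exps [] = 0" "exps (u @ v) = exps u + exps v"
  by (simp_all add: exps_def)

context bs begin

abbreviation relators :: "gen word set" where
  "relators \<equiv> E_relators \<union> HNN_relators m \<xi>"

abbreviation word_eq :: "gen word \<Rightarrow> gen word \<Rightarrow> bool" (infix "\<approx>" 50) where
  "u \<approx> v \<equiv> (u, v) \<in> pres_eq relators"

lemma eq_trans [trans]: "u \<approx> v \<Longrightarrow> v \<approx> w \<Longrightarrow> u \<approx> w"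
  by (rule pe_trans)

lemma E_letters_commute: "[(E i, b), (E j, c)] \<approx> [(E j, c), (E i, b)]"
proof -
  have *: "[(E i, False)] @ [(E j, False)] \<approx> [(E j, False)] @ [(E i, False)]" for i j
    by (rule pres_eq_move)
      (use pe_rel[of "[(E i, False), (E j, False), (E i, True), (E j, True)]" relators "[]" "[]"] in
        \<open>auto simp: inv_word_def E_relators_def\<close>)
  have **: "[(E i, b)] @ [(E j, False)] \<approx> [(E j, False)] @ [(E i, b)]" for i j b
    using * pres_eq_move_inv[OF *[of i j]] by (cases b) (auto simp: inv_word_def)
  have "[(E j, c)] @ [(E i, b)] \<approx> [(E i, b)] @ [(E j, c)]"
    using pe_sym[OF **[of i b j]] pres_eq_move_inv[OF pe_sym[OF **[of i b j]]]
    by (cases c) (auto simp: inv_word_def)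
  then show ?thesis by (auto intro: pe_sym)
qed

lemma E_letter_eword: "eword w \<Longrightarrow> (E i, b) # w \<approx> w @ [(E i, b)]"
proof (induction w)
  case (Cons x w)
  then obtain j c where x: "x = (E j, c)" by (cases x, cases "fst x") auto
  have "(E i, b) # x # w \<approx> x # (E i, b) # w"
    using pres_eq_ctxt[OF E_letters_commute[of i b j c], of "[]" w] x by simp
  also have "x # (E i, b) # w \<approx> x # w @ [(E i, b)]"
    using pres_eq_ctxt[OF Cons.IH, of "[x]" "[]"] Cons.prems by simp
  finally show ?case by simp
qed (auto intro: pe_refl)

lemma E_letter_E_word:
  "i < n \<Longrightarrow> (E i, b) # E_word n f \<approx> E_word n (f(i := if b then f i - 1 else f i + 1))"
proof (induction n)
  case (Suc n)
  define f' where "f' = f(i := if b then f i - 1 else f i + 1)"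
  show ?case
  proof (cases "i = n")
    case True
    have "(E i, b) # E_word n f @ gpow (E n) (f n) \<approx> E_word n f @ (E i, b) # gpow (E n) (f n)"
      using pres_eq_ctxt[OF E_letter_eword[of "E_word n f" i b], of "[]" "gpow (E n) (f n)"] by simp
    also have "E_word n f @ (E i, b) # gpow (E n) (f n) \<approx> E_word n f @ gpow (E n) (f' n)"
      using pres_eq_ctxt[OF gpow_step[of "E n" b "f n" relators], of "E_word n f" "[]"]
      unfolding f'_def True by (simp split del: if_split)
    finally have "(E i, b) # E_word n f @ gpow (E n) (f n) \<approx> E_word n f @ gpow (E n) (f' n)" .
    moreover have "E_word n f' = E_word n f"
      unfolding E_word_def using True by (auto simp: f'_def intro!: arg_cong[of _ _ concat])
    ultimately show ?thesis unfolding E_word_Suc f'_def[symmetric] by simp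
  next
    case False
    then have "i < n" using Suc.prems by simp
    then have "(E i, b) # E_word n f \<approx> E_word n f'" unfolding f'_def by (rule Suc.IH)
    moreover have "f' n = f n" using False by (simp add: f'_def)
    ultimately have "(E i, b) # E_word n f @ gpow (E n) (f n) \<approx> E_word n f' @ gpow (E n) (f' n)"
      using pres_eq_ctxt[of "(E i, b) # E_word n f" _ _ "[]" "gpow (E n) (f n)"] by fastforce
    then show ?thesis unfolding E_word_Suc f'_def[symmetric] by simp
  qed
qed simp

lemma eword_eq_E_word:
  assumes "\<forall>(g, b)\<in>set w. \<exists>i<n. g = E i"
  shows "w \<approx> E_word n (coeff (exps w))"
  using assms
proof (induction w)
  case Nil
  have "coeff 0 = (\<lambda>_. 0 :: int)" by auto
  then show ?case by (simp add: E_word_0 pe_refl)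
next
  case (Cons x w)
  then obtain i b where x: "x = (E i, b)" "i < n" by (cases x) auto
  have "x # w \<approx> x # E_word n (coeff (exps w))"
    using pres_eq_ctxt[OF Cons.IH, of "[x]" "[]"] Cons.prems by simp
  also have "x # E_word n (coeff (exps w)) \<approx> E_word n ((coeff (exps w))(i := if b then coeff (exps w) i - 1 else coeff (exps w) i + 1))"
    using E_letter_E_word x by simp
  also have "(coeff (exps w))(i := if b then coeff (exps w) i - 1 else coeff (exps w) i + 1) = coeff (exps (x # w))"
    by (auto simp: x exps_def)
  finally show ?case .
qed

text \<open>The commutation relators suffice to sort a word, so the exponent vector determines its
  class. All word identities inside E reduce to this.\<close>

lemma eword_eqI:
  assumes "eword u" "eword v" "exps u = exps v"
  shows "u \<approx> v"
proof -
  have "\<exists>n. \<forall>(g, b)\<in>set w. \<exists>i<n. g = E i" if "eword w" for w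
    using that
  proof (induction w)
    case (Cons x w)
    then obtain n where n: "\<forall>(g, b)\<in>set w. \<exists>i<n. g = E i" by auto
    obtain j where "fst x = E j" using Cons.prems by (cases "fst x") auto
    then have "\<forall>(g, b)\<in>set (x # w). \<exists>i<max n (Suc j). g = E i"
      using n by (cases x) (auto simp: less_max_iff_disj)
    then show ?case by blast
  qed auto
  from this[of "u @ v"] obtain n where n: "\<forall>(g, b)\<in>set (u @ v). \<exists>i<n. g = E i" using assms by auto
  have "u \<approx> E_word n (coeff (exps u))" (is "_ \<approx> ?w1") by (rule eword_eq_E_word) (use n in auto)
  also have "?w1 \<approx> v" unfolding assms(3) by (rule pe_sym, rule eword_eq_E_word) (use n in auto)
  finally show ?thesis .
qed

text \<open>With \<open>k = 1\<close> this is the model itself. Every other \<open>k\<close>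
  respects the relators as well, \<open>\<phi>\<close> being linear on E_(m,xi); the endomorphism
  refuting the co-hopfian property arises in this way.\<close>

fun gen_map :: "int \<Rightarrow> gen \<Rightarrow> model" where
  "gen_map k A = ga"
| "gen_map k (E i) = eh (monom k i)"

lemma exps_gpow [simp]: "exps (gpow (E i) c) = monom c i"
proof -
  have "exps (replicate n (E i, b)) = monom (if b then - int n else int n) i" for n b
    by (induction n) (auto simp: exps_def add_monom minus_monom)
  then show ?thesis by (auto simp: gpow_def)
qed

lemma exps_E_word [simp]: "exps (E_word n f) = vec n f"
  by (induction n) (simp_all add: E_word_Suc vec_def, simp add: E_word_def)

lemma eval_eword: "eword w \<Longrightarrow> eval_word (gen_map k) w = eh (smult k (exps w))"
proof (induction w)
  case (Cons x w)
  then obtain i b where x: "x = (E i, b)" by (cases x, cases "fst x") auto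
  have "exps (x # w) = monom (if b then -1 else 1) i + exps w" by (simp add: exps_def x minus_monom)
  moreover have "eval_word (gen_map k) (x # w) = eh (monom (if b then - k else k) i) + eh (smult k (exps w))"
    using Cons x by (auto simp flip: eh_minus minus_monom)
  ultimately show ?case by (auto simp: smult_add_right smult_monom simp flip: eh_add)
qed (simp add: exps_def)

text \<open>Matches the coordinates used in the relators with the intrinsic description by
  \<open>\<rho>\<close> and \<open>\<phi>\<close>.\<close>

lemma vec_Emx_elem:
  assumes "\<forall>i\<ge>n. c i = 0"
  shows "\<rho> (vec (Suc n) (Emx_elem m \<xi> n c)) = m * c 0"
    and "\<phi> (vec (Suc n) (Emx_elem m \<xi> n c)) = vec (Suc n) (phi_elem c)"
proof -
  let ?P = "vec (Suc n) (Emx_elem m \<xi> n c)"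
  have "degree ?P \<le> n" by (rule degree_le) (auto simp: coeff_vec)
  then have "\<rho> ?P = (\<Sum>i\<le>n. coeff ?P i * (if i = 0 then 1 else r i))"
    by (simp add: \<rho>_def lin_eq_sum)
  also have "\<dots> = coeff ?P 0 + (\<Sum>i\<in>{1..n}. coeff ?P i * r i)"
    by (simp add: atMost_atLeast0 sum.atLeast_Suc_atMost)
  also have "(\<Sum>i\<in>{1..n}. coeff ?P i * r i) = (\<Sum>i\<in>{1..<n}. c i * r i)"
    using assms by (intro sum.mono_neutral_cong_right) (auto simp: coeff_vec Emx_elem_def)
  finally show \<rho>: "\<rho> ?P = m * c 0" by (simp add: coeff_vec Emx_elem_def)
  show "\<phi> ?P = vec (Suc n) (phi_elem c)"
  proof (rule poly_eqI)
    fix j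
    consider "j = 0" | "j = 1" | i where "j = Suc (Suc i)"
      by (metis One_nat_def not0_implies_Suc)
    then show "coeff (\<phi> ?P) j = coeff (vec (Suc n) (phi_elem c)) j"
    proof cases
      case 2
      have "n = 0 \<Longrightarrow> c 0 = 0" using assms by simp
      then show ?thesis unfolding \<phi>_def \<rho> using 2 m_nonzero by (auto simp: coeff_vec phi_elem_def)
    next
      case (3 i)
      have "i < n \<Longrightarrow> \<not> Suc i < n \<Longrightarrow> c (Suc i) = 0" using assms by (metis not_less)
      then show ?thesis using 3 by (auto simp: \<phi>_def coeff_vec phi_elem_def Emx_elem_def)
    qed (simp add: coeff_vec phi_elem_def)
  qed
qed

lemma eval_relator:
  assumes "w \<in> relators"
  shows "eval_word (gen_map k) w = 0"
proof (cases "w \<in> E_relators")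
  case True
  then obtain i j where w: "w = [(E i, False), (E j, False), (E i, True), (E j, True)]"
    by (auto simp: E_relators_def)
  then have "eval_word (gen_map k) w = eh (smult k (exps w))" by (intro eval_eword) simp
  then show ?thesis by (simp add: w exps_def)
next
  case False
  then obtain n c where c: "\<forall>i\<ge>n. c i = 0" and w: "w = [(A, False)] @ E_word (Suc n) (Emx_elem m \<xi> n c) @
      [(A, True)] @ inv_word (E_word (Suc n) (phi_elem c))"
    using assms by (auto simp: HNN_relators_def)
  let ?P = "vec (Suc n) (Emx_elem m \<xi> n c)"
  have "m dvd \<rho> ?P" using vec_Emx_elem[OF c] by simp
  then have "ga + eh (smult k ?P) = eh (smult k (vec (Suc n) (phi_elem c))) + ga"
    using ga_eh[of "smult k ?P"] vec_Emx_elem(2)[OF c] by (simp add: \<phi>_smult)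
  moreover have "eval_word (gen_map k) w = ga + eh (smult k ?P) + (- ga + - eh (smult k (vec (Suc n) (phi_elem c))))"
    unfolding w by (simp add: eval_eword add.assoc del: add_uminus_conv_diff)
  ultimately show ?thesis by (simp add: add.assoc del: add_uminus_conv_diff)
qed

lemma eval_cong: "u \<approx> v \<Longrightarrow> eval_word (gen_map k) u = eval_word (gen_map k) v"
  by (erule eval_word_pres_eq) (rule eval_relator)

section \<open>Normal forms of words\<close>

definition ew :: "int poly \<Rightarrow> gen word" where
  "ew p = E_word (Suc (degree p)) (coeff p)"

lemma eword_ew [simp]: "eword (ew p)" by (simp add: ew_def)

lemma exps_ew [simp]: "exps (ew p) = p"
  by (rule poly_eqI) (auto simp: ew_def coeff_vec coeff_eq_0)

lemma A_ew: assumes "m dvd \<rho> p" shows "(A, False) # ew p \<approx> ew (\<phi> p) @ [(A, False)]"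
proof -
  define n where "n = Suc (degree p)"
  \<comment> \<open>The coordinates of \<open>p\<close> in the basis m e_0, e_i - r_i e_0, so that
    \<open>p\<close> is the element occurring in a relator.\<close>
  define c where "c i = (if i = 0 then \<rho> p div m else coeff p i)" for i
  have c: "\<forall>i\<ge>n. c i = 0" by (auto simp: n_def c_def coeff_eq_0)
  let ?P = "vec (Suc n) (Emx_elem m \<xi> n c)"
  have \<rho>: "\<rho> ?P = \<rho> p" using vec_Emx_elem(1)[OF c] c_def[of 0] assms by simp
  have t: "tail ?P = tail p"
    by (rule poly_eqI) (auto simp: coeff_vec Emx_elem_def n_def coeff_eq_0 c_def)
  then have P: "?P = p"
    by (metis \<rho> \<rho>_pCons add_right_cancel pCons_coeff_tail)
  let ?u = "E_word (Suc n) (Emx_elem m \<xi> n c)" and ?v = "E_word (Suc n) (phi_elem c)"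
  have "[(A, False)] @ ?u @ inv_word [(A, False)] @ inv_word ?v \<in> relators"
    using c unfolding HNN_relators_def by (simp add: inv_word_def) blast
  then have "[(A, False)] @ ?u @ inv_word [(A, False)] @ inv_word ?v \<approx> []"
    using pe_rel[of _ relators "[]" "[]"] by simp
  then have *: "[(A, False)] @ ?u \<approx> ?v @ [(A, False)]" by (rule pres_eq_move)
  have "ew p \<approx> ?u" "?v \<approx> ew (\<phi> p)"
    using P vec_Emx_elem(2)[OF c] by (auto intro!: eword_eqI)
  then have "[(A, False)] @ ew p \<approx> [(A, False)] @ ?u" "?v @ [(A, False)] \<approx> ew (\<phi> p) @ [(A, False)]"
    by (blast intro: pres_eq_append pe_refl)+
  with * have "[(A, False)] @ ew p \<approx> ew (\<phi> p) @ [(A, False)]" by (meson pe_trans)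
  then show ?thesis by simp
qed

lemma ew_A: assumes "head p = 0" shows "ew p @ [(A, False)] \<approx> (A, False) # ew (\<psi> p)"
  using A_ew[of "\<psi> p"] assms by (simp add: \<phi>_\<psi> pe_sym)

lemma ew_A_inv: assumes "m dvd \<rho> p" shows "ew p @ [(A, True)] \<approx> (A, True) # ew (\<phi> p)"
  using pe_sym[OF pres_eq_move_inv[of "[(A, False)]" "ew p" "ew (\<phi> p)"]] A_ew[OF assms]
  by (simp add: inv_word_def)

fun repw :: "(int \<times> bool) list \<Rightarrow> gen word" where
  "repw [] = []"
| "repw ((k, b) # l) = gpow (E 0) k @ (A, \<not> b) # repw l"

text \<open>\<open>eact\<close> carried out inside the presentation; \<open>q\<close> is the element
  of E that comes out on the right.\<close>

lemma ew_repw: "\<exists>q. ew p @ repw l \<approx> repw (eact p l) @ ew q"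
proof (induction p l rule: eact.induct)
  case (1 p)
  show ?case by (auto intro: pe_refl)
next
  case (2 p k l)
  then obtain q where q: "ew (\<psi> p) @ repw l \<approx> repw (eact (\<psi> p) l) @ ew q" by blast
  define p' where "p' = p + [:- head p:]"
  have "\<psi> p' = \<psi> p" "head p' = 0" by (simp_all add: p'_def \<psi>_add)
  have "ew p @ gpow (E 0) k \<approx> gpow (E 0) (k + head p) @ ew p'"
    by (rule eword_eqI) (auto simp: p'_def monom_0)
  then have "ew p @ repw ((k, True) # l) \<approx> gpow (E 0) (k + head p) @ ew p' @ (A, False) # repw l" (is "_ \<approx> ?w2")
    using pres_eq_ctxt[of "ew p @ gpow (E 0) k" _ _ "[]" "(A, False) # repw l"] by fastforce
  also have "?w2 \<approx> gpow (E 0) (k + head p) @ (A, False) # ew (\<psi> p) @ repw l" (is "_ \<approx> ?w3")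
    using pres_eq_ctxt[OF ew_A[OF \<open>head p' = 0\<close>], of "gpow (E 0) (k + head p)" "repw l"]
    by (simp add: \<open>\<psi> p' = \<psi> p\<close>)
  also have "?w3 \<approx> gpow (E 0) (k + head p) @ (A, False) # repw (eact (\<psi> p) l) @ ew q"
    using pres_eq_ctxt[OF q, of "gpow (E 0) (k + head p) @ [(A, False)]" "[]"] by simp
  finally show ?case by auto
next
  case (3 p k l)
  define k' where "k' = (k + \<rho> p) mod \<bar>m\<bar>"
  define p' where "p' = p + [:k - k':]"
  obtain q where q: "ew (\<phi> p') @ repw l \<approx> repw (eact (\<phi> p') l) @ ew q"
    using 3 unfolding k'_def p'_def by blast
  have "ew p @ gpow (E 0) k \<approx> gpow (E 0) k' @ ew p'"
    by (rule eword_eqI) (auto simp: p'_def monom_0)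
  then have "ew p @ repw ((k, False) # l) \<approx> gpow (E 0) k' @ ew p' @ (A, True) # repw l" (is "_ \<approx> ?w4")
    using pres_eq_ctxt[of "ew p @ gpow (E 0) k" _ _ "[]" "(A, True) # repw l"] by fastforce
  also have "?w4 \<approx> gpow (E 0) k' @ (A, True) # ew (\<phi> p') @ repw l" (is "_ \<approx> ?w5")
    using pres_eq_ctxt[OF ew_A_inv, of p' "gpow (E 0) k'" "repw l"] carry_dvd[of p k]
    by (simp add: p'_def k'_def)
  also have "?w5 \<approx> gpow (E 0) k' @ (A, True) # repw (eact (\<phi> p') l) @ ew q"
    using pres_eq_ctxt[OF q, of "gpow (E 0) k' @ [(A, True)]" "[]"] by simp
  finally show ?case by (auto simp: k'_def p'_def)
qed

lemma gpow_0 [simp]: "gpow g 0 = []" by (simp add: gpow_def)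

lemma up_repw: "(A, False) # repw l \<approx> repw (up l)"
proof (cases "l \<noteq> [] \<and> hd l = (0, False)")
  case True
  then obtain l' where l: "l = (0, False) # l'" by (cases l) auto
  show ?thesis using pe_cancel[of "[]" A False "repw l'" relators] by (simp add: l up_def)
qed (auto simp: up_def pe_refl)

lemma down_repw: "(A, True) # repw l \<approx> repw (down l)"
proof (cases "l \<noteq> [] \<and> hd l = (0, True)")
  case True
  then obtain l' where l: "l = (0, True) # l'" by (cases l) auto
  show ?thesis using pe_cancel[of "[]" A True "repw l'" relators] by (simp add: l down_def)
qed (auto simp: down_def pe_refl)

text \<open>Existence only; uniqueness is read off from the action on the base vertex by
  \<open>act_rep\<close>.\<close>

lemma normal_form: "\<exists>l p. valid l \<and> w \<approx> repw l @ ew p"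
proof (induction w)
  case Nil
  have "[] \<approx> repw [] @ ew 0" by (rule eword_eqI) auto
  then show ?case using valid.simps(1) by blast
next
  case (Cons x w)
  then obtain l p where l: "valid l" "w \<approx> repw l @ ew p" by blast
  obtain g b where x: "x = (g, b)" by (cases x)
  have *: "x # w \<approx> x # repw l @ ew p"
    using pres_eq_ctxt[OF l(2), of "[x]" "[]"] by simp
  show ?case
  proof (cases g)
    case A
    define l' where "l' = (if b then down l else up l)"
    have "x # repw l \<approx> repw l'"
      using up_repw[of l] down_repw[of l] by (auto simp: x A l'_def)
    then have "x # repw l @ ew p \<approx> repw l' @ ew p"
      using pres_eq_ctxt[of "x # repw l" _ _ "[]" "ew p"] by fastforce
    with * have "x # w \<approx> repw l' @ ew p" by (rule pe_trans)
    moreover have "valid l'" using l by (simp add: l'_def valid_up valid_down)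
    ultimately show ?thesis by blast
  next
    case (E i)
    define p1 where "p1 = exps [x]"
    obtain q where q: "ew p1 @ repw l \<approx> repw (eact p1 l) @ ew q" using ew_repw by blast
    have "[x] \<approx> ew p1" by (rule eword_eqI) (auto simp: x E p1_def)
    then have "x # repw l @ ew p \<approx> ew p1 @ repw l @ ew p" (is "_ \<approx> ?w6")
      using pres_eq_ctxt[of "[x]" _ _ "[]" "repw l @ ew p"] by fastforce
    also have "?w6 \<approx> repw (eact p1 l) @ ew q @ ew p" (is "_ \<approx> ?w7")
      using pres_eq_ctxt[OF q, of "[]" "ew p"] by simp
    also have "?w7 \<approx> repw (eact p1 l) @ ew (q + p)"
      using eword_eqI[of "ew q @ ew p" "ew (q + p)"] by (auto intro: pres_eq_append pe_refl)
    finally have "x # w \<approx> repw (eact p1 l) @ ew (q + p)" using * by (blast intro: pe_trans)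
    then show ?thesis using valid_eact[OF l(1)] by blast
  qed
qed

section \<open>Faithfulness of the model\<close>

abbreviation ev :: "gen word \<Rightarrow> model" where "ev \<equiv> eval_word (gen_map 1)"

definition rep :: "(int \<times> bool) list \<Rightarrow> model" where "rep l = ev (repw l)"

lemma rep_simps [simp]: "rep [] = 0"
  "rep ((k, b) # l) = eh [:k:] + ((if b then ga else - ga) + rep l)"
  by (simp_all add: rep_def eval_eword monom_0)

lemma ev_ew [simp]: "ev (ew p) = eh p" by (simp add: eval_eword)

lemma act_rep: "valid l \<Longrightarrow> act (rep l) [] = l"
proof (induction l rule: valid.induct)
  case (2 k b l)
  then have l: "act (rep l) [] = l" "valid l" by auto
  show ?case
  proof (cases b)
    case True
    then have "up l = (0, True) # l" using 2 by (cases l) (auto simp: up_def)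
    then show ?thesis using True 2 valid_up[OF l(2)] l by (auto simp: act_ga act_eh eact_0)
  next
    case False
    then have "down l = (0, False) # l" using 2 by (cases l) (auto simp: down_def)
    then show ?thesis using False 2 valid_down[OF l(2)] l by (auto simp: act_uminus_ga act_eh eact_0)
  qed
qed auto

text \<open>A trivial value fixes the base vertex, so the tree part of the normal form is empty;
  what remains lies in E, on which the translation part is faithful.\<close>

lemma ev_eq_0: assumes "ev w = 0" shows "w \<approx> []"
proof -
  obtain l p where l: "valid l" "w \<approx> repw l @ ew p" using normal_form by blast
  then have e: "rep l + eh p = 0" using eval_cong[OF l(2), of 1] assms by (simp add: rep_def)
  have "act (rep l + eh p) [] = l" using l by (simp add: act_eh act_rep)
  then have "l = []" using e by simp
  then have "eh p = eh 0" using e by simp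
  then have "p = 0" by (simp only: eh_inj)
  have "ew 0 \<approx> []" by (rule eword_eqI) auto
  then show ?thesis using l \<open>l = []\<close> \<open>p = 0\<close> by (auto intro: pe_trans)
qed

lemma ev_eq_iff: "ev u = ev v \<longleftrightarrow> u \<approx> v"
proof
  assume "ev u = ev v"
  then have "u @ inv_word v \<approx> []" by (intro ev_eq_0) simp
  then have "u @ inv_word v @ v \<approx> v" using pres_eq_ctxt[of "u @ inv_word v" "[]" _ "[]" v] by simp
  moreover have "u @ inv_word v @ v \<approx> u"
    using pres_eq_ctxt[OF inv_word_append_self[of v], of u "[]"] by simp
  ultimately show "u \<approx> v" by (blast intro: pe_trans pe_sym)
qed (rule eval_cong)

definition S :: "model set" where "S = range ev"

lemma add_subgroup_S: "add_subgroup S"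
  unfolding add_subgroup_def S_def
proof (intro conjI ballI)
  show "0 \<in> range ev" by (rule range_eqI[of _ _ "[]"]) simp
  fix x y assume "x \<in> range ev"
  then obtain u where u: "x = ev u" by blast
  then show "- x \<in> range ev" by (intro range_eqI[of _ _ "inv_word u"]) simp
  assume "y \<in> range ev"
  then obtain v where v: "y = ev v" by blast
  then show "x + y \<in> range ev" using u by (intro range_eqI[of _ _ "u @ v"]) simp
qed

lemmas S_closed [simp, intro] = add_subgroupD[OF add_subgroup_S]

lemma eh_in_S [simp, intro]: "eh p \<in> S"
  unfolding S_def by (rule range_eqI[of _ _ "ew p"]) simp

lemma ga_in_S [simp, intro]: "ga \<in> S"
  unfolding S_def by (rule range_eqI[of _ _ "[(A, False)]"]) simp

definition \<Psi> :: "gen word set \<Rightarrow> model" where "\<Psi> X = ev (SOME w. w \<in> X)"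

lemma \<Psi>_word_class: "\<Psi> (word_class relators w) = ev w"
proof -
  have "(SOME u. u \<in> word_class relators w) \<in> word_class relators w"
    by (rule someI[of _ w]) (auto intro: pe_refl)
  then show ?thesis unfolding \<Psi>_def ev_eq_iff by (auto intro: pe_sym)
qed

lemma bij_betw_\<Psi>: "bij_betw \<Psi> (carrier (BS_tilde m \<xi>)) S"
  unfolding bij_betw_def BS_tilde_def carrier_presented_group S_def
  by (auto simp: inj_on_def \<Psi>_word_class image_image ev_eq_iff word_class_eq_iff)

lemma \<Psi>_mult:
  assumes "x \<in> carrier (BS_tilde m \<xi>)" "y \<in> carrier (BS_tilde m \<xi>)"
  shows "x \<otimes>\<^bsub>BS_tilde m \<xi>\<^esub> y \<in> carrier (BS_tilde m \<xi>) \<and> \<Psi> (x \<otimes>\<^bsub>BS_tilde m \<xi>\<^esub> y) = \<Psi> x + \<Psi> y"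
  using assms unfolding BS_tilde_def carrier_presented_group
  by (auto simp: mult_presented_group \<Psi>_word_class)

lemma S_cases:
  assumes "g \<in> S"
  obtains l p where "valid l" "g = rep l + eh p" "act g [] = l"
proof -
  obtain w where w: "g = ev w" using assms by (auto simp: S_def)
  obtain l p where l: "valid l" "w \<approx> repw l @ ew p" using normal_form by blast
  have "g = rep l + eh p" using eval_cong[OF l(2), of 1] w by (simp add: rep_def)
  moreover have "act (rep l + eh p) [] = l" using l by (simp add: act_eh act_rep)
  ultimately show ?thesis using that l by blast
qed

lemma rep_in_S [simp, intro]: "rep l \<in> S" by (simp add: S_def rep_def)

lemma stabilizer_Nil:
  assumes "g \<in> S" "act g [] = []" obtains p where "g = eh p"
  using S_cases[OF assms(1)] assms(2) by (metis add_0 rep_simps(1))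

text \<open>a and b generate: e_1 is the conjugate of b^m by a, and e_(i+1) that of e_i - r_i
  b.\<close>

lemma S_subset_subgroup:
  assumes H: "add_subgroup H" and a: "ga \<in> H" and b: "eh [:1:] \<in> H"
  shows "S \<subseteq> H"
proof -
  have mult: "eh (smult c p) \<in> H" if p: "eh p \<in> H" for c p
  proof (induction c rule: int_induct[of _ 0])
    case (step1 i)
    then show ?case using add_subgroupD(2)[OF H] p by (simp add: smult_add_left eh_add)
  next
    case (step2 i)
    then show ?case using add_subgroupD(2)[OF H step2(2) add_subgroupD(3)[OF H p]]
      by (simp add: smult_diff_left eh_add[of _ "- p", simplified] eh_minus)
  qed (simp add: add_subgroupD(1)[OF H])
  have const: "eh [:c:] \<in> H" for c using mult[OF b, of c] by simp
  have conj: "eh (\<phi> p) \<in> H" if "eh p \<in> H" "m dvd \<rho> p" for p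
  proof -
    have "eh (\<phi> p) = ga + eh p - ga" using ga_eh[OF that(2)] by simp
    then show ?thesis using add_subgroupD(2,4)[OF H] a that(1) by metis
  qed
  have mon: "eh (monom 1 i) \<in> H" for i
  proof (induction i)
    case 0
    show ?case using b by (simp add: monom_0)
  next
    case (Suc i)
    define p where "p = (if i = 0 then [:m:] else monom 1 i + [:- r i:])"
    have "\<rho> (monom 1 i) = r i" if "i \<noteq> 0"
    proof -
      have "\<rho> (monom 1 i) = (\<Sum>j\<le>i. coeff (monom 1 i) j * (if j = 0 then 1 else r j))"
        by (simp add: \<rho>_def lin_eq_sum[OF degree_monom_le])
      also have "\<dots> = (\<Sum>j\<le>i. if i = j then r i else 0)"
        using that by (intro sum.cong) auto
      finally show ?thesis by simp
    qed
    then have \<rho>: "\<rho> p = (if i = 0 then m else 0)" by (auto simp: p_def)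
    have "\<phi> p = monom 1 (Suc i)"
    proof (cases i)
      case 0
      then show ?thesis using \<rho> m_nonzero by (simp add: \<phi>_def p_def monom_Suc monom_0)
    next
      case (Suc j)
      then show ?thesis using \<rho> by (simp add: \<phi>_def p_def monom_Suc)
    qed
    moreover have "eh p \<in> H"
      using Suc const by (auto simp: p_def eh_add intro: add_subgroupD(2)[OF H])
    ultimately show ?case using conj[of p] \<rho> by (metis dvd_0_right dvd_refl)
  qed
  have eh: "eh p \<in> H" for p
  proof -
    have "eh (\<Sum>i\<in>I. monom (coeff p i) i) \<in> H" if "finite I" for I
      using that
    proof induction
      case (insert i I)
      then show ?case using add_subgroupD(2)[OF H _ insert.IH] mult[OF mon[of i], of "coeff p i"]
        by (simp add: eh_add smult_monom)
    qed (simp add: add_subgroupD(1)[OF H])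
    from this[of "{..degree p}"] show ?thesis by (simp add: poly_as_sum_of_monoms)
  qed
  have "ev w \<in> H" for w
  proof (induction w)
    case (Cons x w)
    obtain g c where x: "x = (g, c)" by (cases x)
    have "gen_map 1 g \<in> H" using a eh by (cases g) auto
    then show ?case using x add_subgroupD(2,3)[OF H] Cons by auto
  qed (simp add: add_subgroupD(1)[OF H])
  then show ?thesis by (auto simp: S_def)
qed

end


section \<open>A ping-pong criterion for injectivity\<close>

text \<open>Brings both sides of an identity in a noncommutative group to a right-nested form with
  adjacent inverses cancelled.\<close>

lemmas group_add_norm = diff_conv_add_uminus minus_add minus_minus minus_zero add.assoc add_0_left add_0_right
  minus_add_cancel add_minus_cancel left_minus right_minus

context bs begin

lemma S_induct [consumes 1, case_names zero up down base]:
  assumes "g \<in> S" "P 0" "\<And>g. g \<in> S \<Longrightarrow> P g \<Longrightarrow> P (ga + g)" "\<And>g. g \<in> S \<Longrightarrow> P g \<Longrightarrow> P (- ga + g)"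
    "\<And>p g. g \<in> S \<Longrightarrow> P g \<Longrightarrow> P (eh p + g)"
  shows "P g"
proof -
  have "P (ev w)" for w
  proof (induction w)
    case (Cons x w)
    have "ev w \<in> S" by (simp add: S_def)
    obtain h b where x: "x = (h, b)" by (cases x)
    show ?case
      using Cons \<open>ev w \<in> S\<close> assms(3,4) assms(5)[of "ev w" "- monom 1 i" for i] assms(5)
      by (cases h) (auto simp: x eh_minus)
  qed (simp add: assms)
  then show ?thesis using assms(1) by (auto simp: S_def)
qed

lemma valid_act_iff: "g \<in> S \<Longrightarrow> valid (act g l) \<longleftrightarrow> valid l"
proof -
  let ?H = "{g. \<forall>l. valid (act g l) \<longleftrightarrow> valid l}"
  have "- g \<in> ?H" if g: "\<forall>l. valid (act g l) \<longleftrightarrow> valid l" for g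
  proof -
    have "valid (act (- g) l) \<longleftrightarrow> valid l" for l
      using spec[OF g, of "act (- g) l"] by (simp only: act_uminus_cancel(2))
    then show ?thesis by blast
  qed
  then have "add_subgroup ?H" by (auto simp: add_subgroup_def)
  moreover have "ga \<in> ?H" by (auto simp: act_ga valid_up)
  moreover have "eh [:1:] \<in> ?H" by (auto simp: act_eh valid_eact)
  ultimately have "S \<subseteq> ?H" by (rule S_subset_subgroup)
  then show "g \<in> S \<Longrightarrow> ?thesis" by blast
qed

primrec apow :: "nat \<Rightarrow> model" where
  "apow 0 = 0"
| "apow (Suc i) = apow i + ga"

lemma apow_Suc: "apow (Suc i) = ga + apow i"
  by (induction i) (auto simp: add.assoc)

lemma apow_in_S [simp, intro]: "apow i \<in> S" by (induction i) auto

lemma \<chi>_apow [simp]: "\<chi> (apow i) = int i" by (induction i) auto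

definition conj_a :: "model \<Rightarrow> model" where "conj_a x = - ga + x + ga"

lemma conj_a_add: "conj_a (x + y) = conj_a x + conj_a y"
  unfolding conj_a_def by (simp only: group_add_norm)

lemma conj_a_minus: "conj_a (- x) = - conj_a x"
  unfolding conj_a_def by (simp only: group_add_norm)

lemma conj_a_0 [simp]: "conj_a 0 = 0" by (simp add: conj_a_def)

lemma \<chi>_conj_a [simp]: "\<chi> (conj_a x) = \<chi> x" by (simp add: conj_a_def)

lemma conj_a_in_S: "x \<in> S \<Longrightarrow> conj_a x \<in> S" by (auto simp: conj_a_def)

lemma conj_a_eh: "head p = 0 \<Longrightarrow> conj_a (eh p) = eh (\<psi> p)"
  using eh_ga[of p] by (simp add: conj_a_def add.assoc)

lemma conj_a_eh_eq: "m dvd \<rho> p \<Longrightarrow> conj_a x = eh p \<Longrightarrow> x = eh (\<phi> p)"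
proof -
  assume p: "m dvd \<rho> p" "conj_a x = eh p"
  have "x = ga + conj_a x - ga" unfolding conj_a_def by (simp only: group_add_norm)
  then show "x = eh (\<phi> p)" using ga_eh[OF p(1)] p(2) by simp
qed

definition Em :: "model set" where "Em = {eh p |p. m dvd \<rho> p}"

lemma eh_in_Em_iff [simp]: "eh p \<in> Em \<longleftrightarrow> m dvd \<rho> p"
  by (auto simp: Em_def eh_inj)

text \<open>\<^term>\<open>B n\<close> is generated by the conjugates a^-i E a^i with \<^term>\<open>i \<le> n\<close>; their union stabilizes the component
  of the base vertex in the part of the tree at height at most 0.\<close>

inductive_set B :: "nat \<Rightarrow> model set" for n where
  B_0: "0 \<in> B n"
| B_add: "i \<le> n \<Longrightarrow> g \<in> B n \<Longrightarrow> (conj_a ^^ i) (eh p) + g \<in> B n"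

lemma conj_a_funpow_minus: "(conj_a ^^ i) (- x) = - (conj_a ^^ i) x"
  by (induction i) (auto simp: conj_a_minus)

lemma conj_a_funpow: "(conj_a ^^ i) x = - apow i + x + apow i"
proof (induction i)
  case (Suc i)
  have "(conj_a ^^ Suc i) x = - ga + (- apow i + x + apow i) + ga" by (simp add: Suc conj_a_def)
  also have "\<dots> = - apow (Suc i) + x + apow (Suc i)" by (simp only: apow.simps group_add_norm)
  finally show ?case .
qed simp

lemma B_plus: "x \<in> B n \<Longrightarrow> y \<in> B n \<Longrightarrow> x + y \<in> B n"
  by (induction rule: B.induct) (auto simp: add.assoc intro: B.intros)

lemma B_gen: "i \<le> n \<Longrightarrow> (conj_a ^^ i) (eh p) \<in> B n"
  using B_add[OF _ B_0] by fastforce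

lemma B_minus: "x \<in> B n \<Longrightarrow> - x \<in> B n"
proof (induction rule: B.induct)
  case (B_add i g p)
  have "- ((conj_a ^^ i) (eh p) + g) = - g + (conj_a ^^ i) (eh (- p))"
    by (simp add: minus_add eh_minus conj_a_funpow_minus del: add_uminus_conv_diff)
  then show ?case using B_add by (simp only: B_plus B_gen)
qed (auto intro: B_0)

lemma add_subgroup_B: "add_subgroup (B n)"
  by (auto simp: add_subgroup_def B_0 B_plus B_minus)

lemma B_mono: "n \<le> n' \<Longrightarrow> B n \<subseteq> B n'"
proof
  fix x assume "x \<in> B n" "n \<le> n'"
  then show "x \<in> B n'" by (induction rule: B.induct) (auto intro: B.intros)
qed

lemma conj_a_B: "x \<in> B n \<Longrightarrow> conj_a x \<in> B (Suc n)"
proof (induction rule: B.induct)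
  case (B_add i g p)
  then show ?case using B.B_add[of "Suc i" "Suc n" "conj_a g" p] by (simp add: conj_a_add)
qed (auto intro: B_0)

lemma B_zero_eq: "x \<in> B 0 \<Longrightarrow> x \<in> range eh"
proof (induction rule: B.induct)
  case B_0
  show ?case by (rule range_eqI[of _ _ 0]) simp
next
  case (B_add i g p)
  then show ?case by (auto simp flip: eh_add)
qed

lemma eh_in_B [simp, intro]: "eh p \<in> B n" using B_gen[of 0 n p] by simp

text \<open>E_(m,xi) is a^-1 E_1 a, hence contained in both factors of the amalgam.\<close>

lemma conj_a_Em: "x \<in> Em \<Longrightarrow> x \<in> conj_a ` B n"
proof -
  assume "x \<in> Em"
  then obtain p where p: "x = eh p" "m dvd \<rho> p" by (auto simp: Em_def)
  then have "x = conj_a (eh (\<phi> p))" using conj_a_eh[of "\<phi> p"] by (simp add: \<psi>_\<phi>)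
  then show ?thesis by blast
qed

text \<open>Reduced words of the amalgam of E and \<open>V\<close> over E_(m,xi) that begin with a
  letter from \<open>V\<close>. The last letter from E is unrestricted; \<open>nf\<close> also
  allows an arbitrary one in front.\<close>

inductive_set alt :: "model set \<Rightarrow> model set" for V where
  alt_base: "v \<in> V \<Longrightarrow> v \<notin> Em \<Longrightarrow> v + eh p \<in> alt V"
| alt_step: "v \<in> V \<Longrightarrow> v \<notin> Em \<Longrightarrow> \<not> m dvd \<rho> p \<Longrightarrow> w \<in> alt V \<Longrightarrow> v + (eh p + w) \<in> alt V"

definition nf :: "model set \<Rightarrow> model set" where
  "nf V = range eh \<union> {eh p + w |p w. w \<in> alt V}"

lemma nf_eh_add: "x \<in> nf V \<Longrightarrow> eh p + x \<in> nf V"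
  unfolding nf_def by (auto simp flip: eh_add simp: eh_add[symmetric] add.assoc[symmetric])

lemma nf_eh_0_add: "w \<in> alt V \<Longrightarrow> eh 0 + w \<in> nf V"
  unfolding nf_def by blast

lemma alt_nf: "w \<in> alt V \<Longrightarrow> w \<in> nf V"
  using nf_eh_0_add[of w V] by simp

lemma nf_V_add_alt:
  assumes V: "add_subgroup V" "Em \<subseteq> V" and v: "v \<in> V" and w: "w \<in> alt V"
  shows "v + w \<in> nf V"
  using w
proof cases
  case (alt_base v' p)
  have "v + v' \<in> V" using V v alt_base by (simp add: add_subgroupD)
  show ?thesis
  proof (cases "v + v' \<in> Em")
    case True
    then obtain q where "v + v' = eh q" by (auto simp: Em_def)
    then have "v + w = eh (q + p)" by (simp add: alt_base eh_add flip: add.assoc)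
    then show ?thesis by (simp add: nf_def)
  next
    case False
    then have "0 + (v + v' + eh p) \<in> nf V"
      using alt.alt_base[OF \<open>v + v' \<in> V\<close>] alt_nf by simp
    then show ?thesis by (simp add: alt_base add.assoc)
  qed
next
  case (alt_step v' p w')
  have "v + v' \<in> V" using V v alt_step by (simp add: add_subgroupD)
  show ?thesis
  proof (cases "v + v' \<in> Em")
    case True
    then obtain q where q: "v + v' = eh q" by (auto simp: Em_def)
    have "v + w = (v + v') + eh p + w'" by (simp add: alt_step add.assoc)
    then have "v + w = eh (q + p) + w'" by (simp add: q eh_add)
    then show ?thesis using alt_step by (auto simp: nf_def)
  next
    case False
    then have "0 + (v + v' + (eh p + w')) \<in> nf V"
      using alt.alt_step[OF \<open>v + v' \<in> V\<close>] alt_step alt_nf by simp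
    then show ?thesis by (simp add: alt_step add.assoc)
  qed
qed

text \<open>With \<open>nf_eh_add\<close> this makes the reduced words stable under left
  multiplication by both factors, hence they exhaust the group generated. A product of
  \<open>V\<close>-letters that falls into E_(m,xi) is absorbed by its neighbour from E.\<close>

lemma nf_V_add:
  assumes V: "add_subgroup V" "Em \<subseteq> V" and v: "v \<in> V" and x: "x \<in> nf V"
  shows "v + x \<in> nf V"
proof -
  consider p where "x = eh p" | p w where "x = eh p + w" "w \<in> alt V" using x by (auto simp: nf_def)
  then show ?thesis
  proof cases
    case 1
    show ?thesis
    proof (cases "v \<in> Em")
      case True
      then obtain q where "v = eh q" by (auto simp: Em_def)
      then have "v + x = eh (q + p)" by (simp add: 1 eh_add)
      then show ?thesis by (simp add: nf_def)
    next
      case False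
      then show ?thesis using alt_base[OF v] 1 alt_nf by blast
    qed
  next
    case 2
    show ?thesis
    proof (cases "m dvd \<rho> p")
      case True
      then have "v + eh p \<in> V" using V v by (auto intro!: add_subgroupD(2)[of V])
      then show ?thesis using nf_V_add_alt[OF V _ 2(2)] by (simp add: 2(1) flip: add.assoc)
    next
      case p: False
      show ?thesis
      proof (cases "v \<in> Em")
        case True
        then obtain q where "v = eh q" by (auto simp: Em_def)
        then have "v + x = eh (q + p) + w" by (simp add: 2 eh_add add.assoc)
        then show ?thesis using 2 by (auto simp: nf_def)
      next
        case False
        then show ?thesis using alt_step[OF v False p 2(2)] 2 alt_nf by blast
      qed
    qed
  qed
qed

lemma add_subgroup_conj_a: "add_subgroup H \<Longrightarrow> add_subgroup (conj_a ` H)"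
proof -
  assume H: "add_subgroup H"
  have "0 \<in> conj_a ` H" using add_subgroupD(1)[OF H] by force
  then show ?thesis
    unfolding add_subgroup_def
    using add_subgroupD(2,3)[OF H] by (auto simp flip: conj_a_add conj_a_minus)
qed

lemma B_Suc_nf: "x \<in> B (Suc n) \<Longrightarrow> x \<in> nf (conj_a ` B n)"
proof (induction rule: B.induct)
  case B_0
  have "0 \<in> range eh" by (rule range_eqI[of _ _ 0]) simp
  then show ?case by (simp add: nf_def)
next
  case (B_add i g p)
  show ?case
  proof (cases i)
    case 0
    then show ?thesis using nf_eh_add[OF B_add.IH] by simp
  next
    case (Suc j)
    have "(conj_a ^^ j) (eh p) \<in> B n" using B_add(1) Suc by (intro B_gen) simp
    then have "(conj_a ^^ i) (eh p) \<in> conj_a ` B n" using Suc by simp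
    then show ?thesis
      using conj_a_Em B_add.IH by (intro nf_V_add add_subgroup_conj_a add_subgroup_B) auto
  qed
qed

text \<open>The half-tree behind the edge from the base vertex to its image under a^-1;
  \<open>above\<close> is the one behind the edge to its image under a.\<close>

definition below :: "(int \<times> bool) list set" where
  "below = {l. valid l \<and> l \<noteq> [] \<and> hd l = (0, False)}"

definition above :: "(int \<times> bool) list set" where
  "above = {l. valid l \<and> l \<noteq> [] \<and> hd l = (0, True)}"

definition no_down :: "(int \<times> bool) list set" where
  "no_down = {l. valid l \<and> (l = [] \<or> snd (hd l))}"

text \<open>E permutes the descending edges at the base vertex like the cosets of E_(m,xi), so an
  element outside this subgroup moves the edge in question.\<close>

lemma eh_below:
  assumes "\<not> m dvd \<rho> p" "l \<in> below"
  shows "act (eh p) l \<notin> below"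
proof -
  have "fst (hd (eact p l)) = \<rho> p mod \<bar>m\<bar>" using assms by (auto simp: below_def hd_eact)
  moreover have "\<rho> p mod \<bar>m\<bar> \<noteq> 0" using assms by (simp add: mod_eq_0_iff_dvd)
  ultimately show ?thesis using assms by (auto simp: below_def act_eh)
qed

lemma eh_no_down: "l \<in> no_down \<Longrightarrow> act (eh p) l \<in> no_down"
  using hd_eact(1)[of l p] by (auto simp: no_down_def act_eh valid_eact)

text \<open>a carries the complement of \<open>below\<close> into \<open>above\<close>, and a^-1
  carries the complement of \<open>above\<close> into \<open>below\<close>; it is enough that
  \<open>g\<close> leads out of \<open>above\<close> in between.\<close>

lemma conj_a_ping_pong:
  assumes "\<And>l. l \<in> above \<Longrightarrow> act g l \<notin> above" "g \<in> S" "valid l" "l \<notin> below"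
  shows "act (conj_a g) l \<in> below"
proof -
  have "up l = (0, True) # l" using assms by (auto simp: up_def below_def)
  then have "up l \<in> above" using assms valid_up[of l] by (auto simp: above_def)
  then have n: "act g (up l) \<notin> above" "valid (act g (up l))"
    using assms valid_act_iff valid_up by auto
  then have "down (act g (up l)) = (0, False) # act g (up l)" by (auto simp: above_def down_def)
  then have "down (act g (up l)) \<in> below" using valid_down[OF n(2)] by (auto simp: below_def)
  then show ?thesis using n assms by (simp add: conj_a_def act_ga act_uminus_ga)
qed

text \<open>Letters from \<open>V\<close> lead into \<open>below\<close>, inner letters from E lead
  out of it again. The last letter from E is harmless, since E preserves
  \<open>no_down\<close>.\<close>

lemma alt_ping_pong:
  assumes V: "\<And>v l. v \<in> V \<Longrightarrow> v \<notin> Em \<Longrightarrow> valid l \<Longrightarrow> l \<notin> below \<Longrightarrow> act v l \<in> below"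
    and w: "w \<in> alt V" and l: "l \<in> no_down"
  shows "act w l \<in> below"
  using w
proof induction
  case (alt_base v p)
  have "act (eh p) l \<in> no_down" using eh_no_down[OF l] .
  then have "valid (act (eh p) l)" "act (eh p) l \<notin> below" by (auto simp: no_down_def below_def)
  then show ?case using V[OF alt_base] by simp
next
  case (alt_step v p w)
  then have "act (eh p) (act w l) \<notin> below" "valid (act (eh p) (act w l))"
    using eh_below by (auto simp: below_def act_eh valid_eact)
  then show ?case using V alt_step by simp
qed

lemma B_in_S: "x \<in> B n \<Longrightarrow> x \<in> S"
proof (induction rule: B.induct)
  case (B_add i g p)
  have "(conj_a ^^ i) (eh p) \<in> S" by (induction i) (auto intro: conj_a_in_S)
  then show ?case using B_add by auto
qed auto

lemma \<chi>_B: "x \<in> B n \<Longrightarrow> \<chi> x = 0"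
proof (induction rule: B.induct)
  case (B_add i g p)
  have "\<chi> ((conj_a ^^ i) (eh p)) = 0" by (induction i) auto
  then show ?case using B_add by simp
qed auto

text \<open>In the induction, an element of the smaller group outside E_1 becomes, conjugated by a,
  a \<open>V\<close>-letter outside E_(m,xi) that plays ping-pong. A reduced word then sends
  \<open>above\<close> into \<open>below\<close>, and a leading element of E cannot turn a
  descending first edge into an ascending one.\<close>

lemma B_ping_pong:
  assumes "g \<in> B n" "\<nexists>p. g = eh p \<and> head p = 0" "l \<in> above"
  shows "act g l \<notin> above"
  using assms
proof (induction n arbitrary: g l)
  case (0 g l)
  then obtain p where p: "g = eh p" "head p \<noteq> 0" using B_zero_eq[OF 0(1)] by auto
  then show ?case using 0(3) by (auto simp: above_def act_eh hd_eact prod_eq_iff)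
next
  case (Suc n g l)
  have V: "act v l \<in> below" if v: "v \<in> conj_a ` B n" "v \<notin> Em" and l: "valid l" "l \<notin> below" for v l
  proof -
    obtain g where g: "g \<in> B n" "v = conj_a g" using v by blast
    have "\<nexists>p. g = eh p \<and> head p = 0" using v g conj_a_eh by auto
    then show ?thesis using Suc.IH[OF g(1)] conj_a_ping_pong[OF _ B_in_S[OF g(1)] l] g(2) by blast
  qed
  have l: "l \<in> no_down" using Suc.prems by (auto simp: above_def no_down_def)
  consider p where "g = eh p" | p w where "g = eh p + w" "w \<in> alt (conj_a ` B n)"
    using B_Suc_nf[OF Suc.prems(1)] by (auto simp: nf_def)
  then show ?case
  proof cases
    case 1
    then show ?thesis using Suc.prems by (auto simp: above_def act_eh hd_eact prod_eq_iff)
  next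
    case 2
    have "act w l \<in> below" using alt_ping_pong[OF V 2(2) l] by blast
    then show ?thesis by (auto simp: below_def above_def 2 act_eh hd_eact(1) prod_eq_iff)
  qed
qed

definition BB :: "model set" where "BB = (\<Union>n. B n)"

lemma add_subgroup_BB: "add_subgroup BB"
proof -
  have "x + y \<in> BB" if xy: "x \<in> BB" "y \<in> BB" for x y
  proof -
    obtain n n' where n: "x \<in> B n" "y \<in> B n'" using xy by (auto simp: BB_def)
    then have "x \<in> B (max n n')" "y \<in> B (max n n')"
      using B_mono[of n "max n n'"] B_mono[of n' "max n n'"] by auto
    then show ?thesis unfolding BB_def using B_plus by blast
  qed
  moreover have "0 \<in> BB" unfolding BB_def using B_0 by blast
  moreover have "- x \<in> BB" if "x \<in> BB" for x using that B_minus unfolding BB_def by blast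
  ultimately show ?thesis unfolding add_subgroup_def by blast
qed

lemma BB_in_S: "x \<in> BB \<Longrightarrow> x \<in> S" and \<chi>_BB: "x \<in> BB \<Longrightarrow> \<chi> x = 0"
  by (auto simp: BB_def B_in_S \<chi>_B)

lemma conj_a_BB: "x \<in> BB \<Longrightarrow> conj_a x \<in> BB"
  by (auto simp: BB_def intro: conj_a_B)

lemma conj_a_funpow_BB: "(conj_a ^^ i) (eh p) \<in> BB"
  using B_gen[of i i p] by (auto simp: BB_def)

lemma conj_a_BB_ping_pong:
  assumes "v \<in> conj_a ` BB" "v \<notin> Em" "valid l" "l \<notin> below"
  shows "act v l \<in> below"
proof -
  obtain g n where g: "g \<in> B n" "v = conj_a g" using assms by (auto simp: BB_def)
  have "\<nexists>p. g = eh p \<and> head p = 0"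
    using assms(2) g(2) conj_a_eh by (metis \<rho>_\<psi> dvd_triv_left eh_in_Em_iff)
  then show ?thesis using B_ping_pong[OF g(1)] conj_a_ping_pong[OF _ B_in_S[OF g(1)] assms(3,4)] g(2) by blast
qed

lemma BB_nf: "x \<in> BB \<Longrightarrow> x \<in> nf (conj_a ` BB)"
proof -
  assume "x \<in> BB"
  then obtain n where "x \<in> B n" by (auto simp: BB_def)
  then have "x \<in> nf (conj_a ` B n)" using B_Suc_nf B_mono[of n "Suc n"] by auto
  moreover have "w \<in> alt (conj_a ` BB)" if "w \<in> alt (conj_a ` B n)" for w
    using that by (induction rule: alt.induct) (auto simp: BB_def intro!: alt.intros)
  ultimately show ?thesis by (auto simp: nf_def)
qed

text \<open>Going through a reduced form of \<open>u\<close> from its end: if the last letter from E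
  is in E_(m,xi), then \<open>z\<close> cancels it together with the preceding
  \<open>V\<close>-letter; otherwise ping-pong already starts from \<open>below\<close> and
  \<open>z = 0\<close> serves. A first letter \<open>p\<close> from E accounts for the translate on
  the right.\<close>

lemma BB_below:
  assumes "u \<in> BB"
  obtains z p where "z \<in> conj_a ` BB" "act (u + z) ` below \<subseteq> act (eh p) ` below"
proof -
  have sub: "add_subgroup (conj_a ` BB)" by (rule add_subgroup_conj_a[OF add_subgroup_BB])
  have alt: "\<exists>z\<in>conj_a ` BB. act (w + z) ` below \<subseteq> below" if "w \<in> alt (conj_a ` BB)" for w
    using that
  proof (induction rule: alt.induct)
    case (alt_base v p)
    show ?case
    proof (cases "m dvd \<rho> p")
      case True
      then have "eh p \<in> conj_a ` BB" using conj_a_Em[of "eh p" 0] by (auto simp: BB_def)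
      then have "- (v + eh p) \<in> conj_a ` BB" using alt_base sub by (simp add: add_subgroupD del: minus_add)
      then show ?thesis by (intro bexI[of _ "- (v + eh p)"]) (auto simp del: minus_add)
    next
      case False
      then have "act (v + eh p + 0) ` below \<subseteq> below"
        using eh_below conj_a_BB_ping_pong[OF alt_base] by (auto simp: below_def act_eh valid_eact)
      then show ?thesis using add_subgroupD(1)[OF sub] by blast
    qed
  next
    case (alt_step v p w)
    then obtain z where z: "z \<in> conj_a ` BB" "act (w + z) ` below \<subseteq> below" by blast
    have "act (v + (eh p + w) + z) l \<in> below" if l: "l \<in> below" for l
    proof -
      have b: "act (w + z) l \<in> below" using z l by blast
      then have "act (eh p) (act (w + z) l) \<notin> below" "valid (act (eh p) (act (w + z) l))"
        using eh_below[OF alt_step(3)] by (auto simp: below_def act_eh valid_eact)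
      then show ?thesis using conj_a_BB_ping_pong[OF alt_step(1,2)] by simp
    qed
    then show ?case using z(1) by blast
  qed
  consider p where "u = eh p" | p w where "u = eh p + w" "w \<in> alt (conj_a ` BB)"
    using BB_nf[OF assms] by (auto simp: nf_def)
  then show thesis
  proof cases
    case 1
    then show thesis using that[of 0 p] add_subgroupD(1)[OF sub] by simp
  next
    case 2
    obtain z where z: "z \<in> conj_a ` BB" "act (w + z) ` below \<subseteq> below" using alt[OF 2(2)] by blast
    then show thesis using that[OF z(1), of p] 2(1) by (auto simp: add.assoc)
  qed
qed

text \<open>As a^-1 B a is contained in B, powers of a can be collected on the outside. For exponent
  0 both powers agree, which gives the conjugation into B.\<close>

lemma S_eq_apow_BB:
  assumes "g \<in> S" shows "\<exists>i j. \<exists>x\<in>BB. g = apow i + x - apow j"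
  using assms
proof (induction rule: S_induct)
  case zero
  show ?case using add_subgroupD(1)[OF add_subgroup_BB] by (intro exI[of _ 0] bexI[of _ 0]) auto
next
  case (up g)
  then obtain i j x where x: "x \<in> BB" "g = apow i + x - apow j" by blast
  then have "ga + g = apow (Suc i) + x - apow j" unfolding apow_Suc by (simp only: group_add_norm)
  then show ?case using x by blast
next
  case (down g)
  then obtain i j x where x: "x \<in> BB" "g = apow i + x - apow j" by blast
  show ?case
  proof (cases i)
    case 0
    have "- ga + g = apow 0 + conj_a x - apow (Suc j)"
      unfolding conj_a_def x(2) 0 apow.simps by (simp only: group_add_norm)
    then show ?thesis using conj_a_BB[OF x(1)] by blast
  next
    case (Suc i')
    then have "- ga + g = apow i' + x - apow j" unfolding x(2) Suc apow_Suc by (simp only: group_add_norm)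
    then show ?thesis using x by blast
  qed
next
  case (base p g)
  then obtain i j x where x: "x \<in> BB" "g = apow i + x - apow j" by blast
  have "eh p + g = apow i + ((conj_a ^^ i) (eh p) + x) - apow j"
    unfolding conj_a_funpow x(2) by (simp only: group_add_norm)
  moreover have "(conj_a ^^ i) (eh p) + x \<in> BB"
    using conj_a_funpow_BB x add_subgroupD(2)[OF add_subgroup_BB] by blast
  ultimately show ?case by blast
qed

text \<open>An endomorphism acting on E as multiplication by \<^term>\<open>k\<close> sends the reduced words of B (as an
  amalgam of E and a^-1 B a over E_(m,xi)) to words which still play ping-pong, with
  the half-tree \<^const>\<open>below\<close> replaced by a translate.\<close>

lemma inj_endomorphism:
  assumes \<eta>: "additive_on S \<eta>" and base: "\<And>p. \<eta> (eh p) = eh (smult k p)"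
    and k: "k \<noteq> 0" "coprime k m"
    and a: "\<eta> ga = ga - u" and u: "u \<in> BB" "\<And>p. m dvd \<rho> p \<Longrightarrow> u + eh p = eh p + u"
  shows "inj_on \<eta> S"
proof -
  have add: "\<eta> (x + y) = \<eta> x + \<eta> y" if "x \<in> S" "y \<in> S" for x y
    using additive_on_add[OF \<eta>] that by blast
  have minus: "\<eta> (- x) = - \<eta> x" if "x \<in> S" for x
    using additive_on_uminus[OF \<eta> add_subgroup_S] that by blast
  have zero: "\<eta> 0 = 0" using additive_on_0[OF \<eta> add_subgroup_S] .
  have uS: "u \<in> S" using u BB_in_S by blast
  \<comment> \<open>Conjugation by the image of a is conjugation by a followed by conjugation by
    \<open>u\<close>; the ping-pong set must therefore be adapted to \<open>u\<close>.\<close>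
  have \<eta>_conj_a: "\<eta> (conj_a x) = u + conj_a (\<eta> x) - u" if "x \<in> S" for x
  proof -
    have "\<eta> (conj_a x) = - (ga - u) + \<eta> x + (ga - u)"
      unfolding conj_a_def using that by (simp add: add minus a)
    also have "\<dots> = u + conj_a (\<eta> x) - u" unfolding conj_a_def by (simp only: group_add_norm)
    finally show ?thesis .
  qed
  have \<eta>_BB: "\<eta> x \<in> BB" if "x \<in> B n" for x n
    using that
  proof (induction rule: B.induct)
    case B_0
    show ?case using zero add_subgroupD(1)[OF add_subgroup_BB] by simp
  next
    case (B_add i g p)
    have "\<eta> ((conj_a ^^ i) (eh p)) \<in> BB"
    proof (induction i)
      case 0
      show ?case using conj_a_funpow_BB[of 0] by (simp add: base)
    next
      case (Suc i)
      have "(conj_a ^^ i) (eh p) \<in> S" using conj_a_funpow_BB BB_in_S by blast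
      then have "\<eta> ((conj_a ^^ Suc i) (eh p)) = u + conj_a (\<eta> ((conj_a ^^ i) (eh p))) - u"
        by (simp add: \<eta>_conj_a)
      then show ?case using Suc u conj_a_BB add_subgroupD(2,4)[OF add_subgroup_BB] by metis
    qed
    moreover have "(conj_a ^^ i) (eh p) \<in> S" "g \<in> S"
      using conj_a_funpow_BB BB_in_S B_in_S B_add by blast+
    ultimately show ?case using B_add add_subgroupD(2)[OF add_subgroup_BB] by (simp add: add)
  qed
  \<comment> \<open>\<open>z\<close> makes u z \<open>below\<close> lie in a translate of
    \<open>below\<close> by an element of E, which keeps the base vertex outside and controls the
    action of E on it.\<close>
  obtain z p0 where z: "z \<in> conj_a ` BB" and zp: "act (u + z) ` below \<subseteq> act (eh p0) ` below"
    using BB_below[OF u(1)] by blast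
  define X where "X = act (u + z) ` below"
  have zS: "z \<in> S" and \<chi>z: "\<chi> z = 0" using z conj_a_in_S BB_in_S \<chi>_BB by auto
  have VS: "add_subgroup (conj_a ` BB)" by (rule add_subgroup_conj_a[OF add_subgroup_BB])
  have Nil: "[] \<notin> X"
  proof
    assume "[] \<in> X"
    then obtain s where "s \<in> below" "act (eh p0) s = []" using zp unfolding X_def by (metis imageE subsetD)
    then show False by (auto simp: act_eh below_def split: if_splits)
  qed
  have X_valid: "valid l" if "l \<in> X" for l
    using that valid_act_iff[of "u + z"] uS zS by (auto simp: X_def below_def)
  \<comment> \<open>Transported back by u + z, this is ping-pong for the conjugate of
    \<open>v\<close> by \<open>z\<close> on \<open>below\<close>.\<close>
  have conj_X: "act (u + v - u) l \<in> X"
    if v: "v \<in> conj_a ` BB" "- z + v + z \<notin> Em" and l: "valid l" "l \<notin> X" for v l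
  proof -
    define l' where "l' = act (- (u + z)) l"
    have l': "l = act (u + z) l'" unfolding l'_def by (rule act_uminus_cancel(2)[symmetric])
    have "valid l'" using l valid_act_iff[of "u + z" l'] uS zS unfolding l' by blast
    moreover have "l' \<notin> below" using l unfolding l' X_def by blast
    moreover have "- z + v + z \<in> conj_a ` BB" by (intro add_subgroupD(2)[OF VS] add_subgroupD(3)[OF VS] v(1) z)
    ultimately have "act (- z + v + z) l' \<in> below" using conj_a_BB_ping_pong v(2) by blast
    moreover have "act (u + v - u) l = act (u + z) (act (- z + v + z) l')"
      unfolding l' act_simps(2)[symmetric] by (simp only: group_add_norm)
    ultimately show ?thesis unfolding X_def by (metis imageI)
  qed
  \<comment> \<open>If the conjugate left E_(m,xi), then u + eh p - u would move the base vertex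
    into \<open>X\<close>; but it equals \<open>eh p\<close>, which fixes that vertex. Since
    \<open>z\<close> has exponent 0, conjugation by it preserves the translation part of
    \<open>eh p\<close>, so the conjugate is \<open>eh p\<close> itself.\<close>
  have z_comm: "- z + eh p + z = eh p" if p: "m dvd \<rho> p" for p
  proof -
    have "- z + eh p + z \<in> Em"
    proof (rule ccontr)
      assume "- z + eh p + z \<notin> Em"
      moreover have "eh p \<in> conj_a ` BB" using conj_a_Em[of "eh p" 0] p by (auto simp: BB_def)
      ultimately have "act (u + eh p - u) [] \<in> X" using conj_X Nil by simp
      moreover have "u + eh p - u = eh p" using u(2)[OF p] by simp
      ultimately show False using Nil by (simp add: act_eh)
    qed
    then obtain q where q: "- z + eh p + z = eh q" by (auto simp: Em_def)
    have "\<tau> (- z + eh p + z) = \<tau> (eh p)" using \<chi>z by (simp add: algebra_simps)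
    then have "to_fract (\<pi> p) = to_fract (\<pi> q)" using q by simp
    then have "p = q" by (rule \<pi>_inj[OF iffD1[OF to_fract_eq_iff]])
    then show ?thesis using q by simp
  qed
  have not_Em: "- z + v + z \<notin> Em" if "v \<notin> Em" for v
  proof
    assume "- z + v + z \<in> Em"
    then obtain p where p: "m dvd \<rho> p" "- z + v + z = eh p" by (auto simp: Em_def)
    have "v = z + (- z + v + z) - z" by (simp only: group_add_norm)
    also have "\<dots> = z + (- z + eh p + z) - z" using p z_comm by simp
    also have "\<dots> = eh p" by (simp only: group_add_norm)
    finally show False using that p by simp
  qed
  \<comment> \<open>E is abelian, so the translation by \<open>p0\<close> can be cancelled and the
    claim reduces to \<open>below\<close>.\<close>
  have eh_X: "act (eh p) l \<notin> X" if p: "\<not> m dvd \<rho> p" and l: "l \<in> X" for p l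
  proof
    assume "act (eh p) l \<in> X"
    then obtain s s' where s: "s \<in> below" "s' \<in> below" "l = act (eh p0) s" "act (eh p) l = act (eh p0) s'"
      using l zp unfolding X_def by blast
    have "act (eh p0) (act (eh p) s) = act (eh p) (act (eh p0) s)"
      by (metis act_simps(2) eh_commute)
    then have "act (eh p0) (act (eh p) s) = act (eh p0) s'" using s by simp
    then have "act (eh p) s = s'" by (metis act_uminus_cancel(1))
    then show False using eh_below[OF p s(1)] s(2) by simp
  qed
  \<comment> \<open>Stronger than a trivial kernel, as the induction requires: to see that a letter
    outside E_(m,xi) has its image outside as well, an element of the smaller group with image in E
    must be known to lie in E.\<close>
  have \<eta>_eh: "g \<in> range eh" if "g \<in> B n" "\<eta> g \<in> range eh" for g n
    using that
  proof (induction n arbitrary: g)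
    case 0
    then show ?case by (intro B_zero_eq)
  next
    case (Suc n)
    consider "g \<in> range eh" | p w where "g = eh p + w" "w \<in> alt (conj_a ` B n)"
      using B_Suc_nf[OF Suc.prems(1)] by (auto simp: nf_def)
    then show ?case
    proof cases
      case 2
      have \<eta>_V: "act (\<eta> v) l \<in> X" if v: "v \<in> conj_a ` B n" "v \<notin> Em" and l: "valid l" "l \<notin> X" for v l
      proof -
        obtain g where g: "g \<in> B n" "v = conj_a g" using v by blast
        have "conj_a (\<eta> g) \<notin> Em"
        proof
          assume "conj_a (\<eta> g) \<in> Em"
          then obtain p where p: "m dvd \<rho> p" "conj_a (\<eta> g) = eh p" by (auto simp: Em_def)
          then have e: "\<eta> g = eh (\<phi> p)" using conj_a_eh_eq by blast
          then obtain q where q: "g = eh q" using Suc.IH[OF g(1)] by blast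
          then have "smult k q = \<phi> p" using e by (simp add: base eh_inj)
          then have "k * head q = 0" by (metis coeff_smult head_\<phi>)
          then have "head q = 0" using k by simp
          then have "v = eh (\<psi> q)" using g q conj_a_eh by simp
          then show False using v by simp
        qed
        moreover have "conj_a (\<eta> g) \<in> conj_a ` BB" using \<eta>_BB[OF g(1)] by blast
        ultimately have "act (u + conj_a (\<eta> g) - u) l \<in> X" using conj_X not_Em l by blast
        then show ?thesis using \<eta>_conj_a[OF B_in_S[OF g(1)]] g(2) by simp
      qed
      have VnS: "v \<in> S" if "v \<in> conj_a ` B n" for v using that B_in_S conj_a_in_S by blast
      have wX: "w \<in> S \<and> act (\<eta> w) [] \<in> X" using 2(2)
      proof (induction rule: alt.induct)
        case (alt_base v p)
        then show ?case using \<eta>_V[OF alt_base, of "[]"] Nil VnS by (simp add: add base act_eh)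
      next
        case (alt_step v p w)
        define l where "l = act (\<eta> w) []"
        have l: "l \<in> X" using alt_step by (simp add: l_def)
        \<comment> \<open>Coprimality of \<open>k\<close> and \<open>m\<close> keeps the inner
          letters of a reduced word outside E_(m,xi).\<close>
        have "\<not> m dvd \<rho> (smult k p)"
          using alt_step(3) k(2) by (simp add: coprime_commute coprime_dvd_mult_right_iff)
        then have "act (eh (smult k p)) l \<notin> X" using eh_X l by blast
        moreover have "valid (act (eh (smult k p)) l)" using X_valid[OF l] by (simp add: act_eh valid_eact)
        ultimately have "act (\<eta> v) (act (eh (smult k p)) l) \<in> X" by (intro \<eta>_V alt_step(1,2))
        then show ?case using alt_step VnS by (simp add: add base l_def)
      qed
      obtain q where q: "\<eta> g = eh q" using Suc.prems by blast
      have "\<eta> g = eh (smult k p) + \<eta> w" using 2 wX by (simp add: add base)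
      then have "act (eh (smult k p)) (act (\<eta> w) []) = []" using q by (metis act_simps(2) act_eh eact.simps(1))
      then have "act (\<eta> w) [] = []" using X_valid wX by (simp add: act_eh)
      then show ?thesis using wX Nil by simp
    qed
  qed
  have \<chi>_\<eta>: "\<chi> (\<eta> g) = \<chi> g" if "g \<in> S" for g
    using that by (induction rule: S_induct) (auto simp: add minus zero a base \<chi>_BB[OF u(1)])
  have ker: "g = 0" if g: "g \<in> S" "\<eta> g = 0" for g
  proof -
    obtain i j x where x: "x \<in> BB" "g = apow i + x - apow j" using S_eq_apow_BB[OF g(1)] by blast
    have "\<chi> g = 0" using \<chi>_\<eta>[OF g(1)] g(2) by simp
    then have ij: "i = j" using x \<chi>_BB by simp
    have xg: "x = - apow i + g + apow i" unfolding x(2) ij by (simp only: group_add_norm)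
    have "\<eta> x = - \<eta> (apow i) + \<eta> g + \<eta> (apow i)" unfolding xg using g(1) by (simp add: add minus)
    then have \<eta>x: "\<eta> x = 0" using g(2) by simp
    then have "\<eta> x \<in> range eh" by (metis eh_0 rangeI)
    then obtain p where p: "x = eh p" using \<eta>_eh x(1) by (auto simp: BB_def)
    then have "eh (smult k p) = eh 0" using \<eta>x base by simp
    then have "smult k p = 0" by (simp only: eh_inj)
    then have "p = 0" using k by simp
    then show ?thesis using p x(2) ij by simp
  qed
  show ?thesis by (rule additive_on_inj[OF \<eta> add_subgroup_S ker])
qed

end


section \<open>Isometries of trees\<close>

text \<open>The four-point inequality says that the metric is 0-hyperbolic; \<open>step\<close>
  supplies geodesics. The metric laws are demanded on the whole type, while \<open>V\<close> singles
  out the actual vertices.\<close>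

locale tree_metric =
  fixes d :: "'v \<Rightarrow> 'v \<Rightarrow> int" and V :: "'v set"
  assumes d_sym: "d u w = d w u"
    and d_zero: "d u w = 0 \<longleftrightarrow> u = w"
    and four_point: "d u v + d w x \<le> max (d u w + d v x) (d u x + d v w)"
    and step: "u \<in> V \<Longrightarrow> w \<in> V \<Longrightarrow> u \<noteq> w \<Longrightarrow> \<exists>p\<in>V. d u p = 1 \<and> d p w = d u w - 1"
begin

lemma triangle: "d u w \<le> d u v + d v w"
  using four_point[of u w v v] d_zero[of v v] d_sym[of v w] by simp

lemma d_nonneg: "0 \<le> d u w"
  using triangle[of u u w] d_zero[of u u] d_sym[of w u] by simp

lemma dist_on_segment:
  assumes "d p s + d s q = d p q" "d p t + d t q = d p q"
  shows "d s t = \<bar>d p s - d p t\<bar>"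
  using assms four_point[of p q s t] triangle[of p s t] triangle[of p t s] d_sym[of s t] d_sym[of q s] d_sym[of q t]
  by linarith

definition isometry :: "('v \<Rightarrow> 'v) \<Rightarrow> bool" where
  "isometry f \<longleftrightarrow> f ` V \<subseteq> V \<and> (\<forall>u\<in>V. \<forall>w\<in>V. d (f u) (f w) = d u w)"

text \<open>For a hyperbolic isometry of translation length t, a point at distance s from the axis
  is moved by n t + 2 s under the n-th power (n > 0), so doubling characterises s = 0.\<close>

definition axis :: "('v \<Rightarrow> 'v) \<Rightarrow> 'v set" where
  "axis f = {q \<in> V. \<forall>n. d q ((f ^^ (2 * n)) q) = 2 * d q ((f ^^ n) q)}"

definition hyperbolic :: "('v \<Rightarrow> 'v) \<Rightarrow> bool" where
  "hyperbolic f \<longleftrightarrow> isometry f \<and> (\<exists>q\<in>V. \<exists>t>0. \<forall>n. d q ((f ^^ n) q) = int n * t)"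

lemma isometryD: "isometry f \<Longrightarrow> u \<in> V \<Longrightarrow> f u \<in> V"
  "isometry f \<Longrightarrow> u \<in> V \<Longrightarrow> w \<in> V \<Longrightarrow> d (f u) (f w) = d u w"
  by (auto simp: isometry_def)

lemma isometry_funpow: "isometry f \<Longrightarrow> isometry (f ^^ n)"
  by (induction n) (auto simp: isometry_def image_subset_iff)

lemma hyperbolic_not_periodic:
  assumes f: "hyperbolic f" and q: "q \<in> V" and n: "n > 0"
  shows "(f ^^ n) q \<noteq> q"
proof
  assume per: "(f ^^ n) q = q"
  obtain o' t where o: "o' \<in> V" "t > 0" "\<And>n. d o' ((f ^^ n) o') = int n * t"
    using f by (auto simp: hyperbolic_def)
  define k where "k = nat (2 * d o' q) + 1"
  have perk: "(f ^^ (n * k)) q = q" using per by (induction k) (auto simp: funpow_add)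
  have "d ((f ^^ (n * k)) q) ((f ^^ (n * k)) o') = d q o'"
    using isometry_funpow[of f "n * k"] f q o isometryD(2) by (auto simp: hyperbolic_def)
  then have "int (n * k) * t \<le> 2 * d o' q"
    using triangle[of o' "(f ^^ (n * k)) o'" q] o(3) perk d_sym[of q o'] by simp
  moreover have "int (n * k) * t \<ge> int k"
  proof -
    have "1 * int k * 1 \<le> int n * int k * t" using n o(2) by (intro mult_mono) auto
    then show ?thesis by simp
  qed
  moreover have "int k > 2 * d o' q" by (simp add: k_def)
  ultimately show False by linarith
qed

text \<open>Iterating the doubling property along powers of two gives exponential growth.\<close>

lemma axis_unbounded:
  assumes f: "hyperbolic f" and q: "q \<in> axis f"
  shows "\<exists>n. d q ((f ^^ n) q) > c"
proof -
  have "d q ((f ^^ (2 ^ k)) q) = 2 ^ k * d q (f q)" for k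
    using q by (induction k) (auto simp: axis_def)
  moreover have "d q (f q) \<ge> 1"
    using hyperbolic_not_periodic[OF f, of q 1] q d_nonneg[of q "f q"] d_zero[of q "f q"]
    by (auto simp: axis_def)
  ultimately have "d q ((f ^^ (2 ^ nat c)) q) \<ge> 2 ^ nat c" by simp
  moreover have "(2::int) ^ nat c > c"
  proof -
    have "int (nat c) < 2 ^ nat c" using of_nat_less_two_power by blast
    then show ?thesis by linarith
  qed
  ultimately show ?thesis by (intro exI[of _ "2 ^ nat c"]) linarith
qed

text \<open>A segment of length 2R whose endpoints and midpoint are all displaced by the same amount
  less than R slides along itself near its middle. The four-point inequality yields three
  equalities, and subtracting the last from the sum of the first two gives the claim.\<close>

lemma near_midpoint_on_segment:
  assumes "d p1 o' = R" "d o' p2 = R" "d p1 p2 = 2 * R"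
    and "d q1 c = R" "d c q2 = R" "d q1 q2 = 2 * R"
    and "d p1 q1 < R" "d p2 q2 < R" "d o' c < R" "d p1 q1 = d o' c" "d p2 q2 = d o' c"
  shows "d p1 c + d c p2 = d p1 p2"
proof -
  have "d p1 c + d p2 q1 = 3 * R"
    using assms four_point[of p1 p2 c q1] four_point[of p1 c p2 q1] triangle[of p2 c o']
      d_sym[of q1 c] d_sym[of p2 o'] d_sym[of c o'] d_sym[of p2 c] d_sym[of c q1]
    by linarith
  moreover have "d p2 c + d p1 q2 = 3 * R"
    using assms four_point[of p2 p1 c q2] four_point[of p2 c p1 q2] triangle[of p1 c o']
      d_sym[of q2 c] d_sym[of p1 p2] d_sym[of c o'] d_sym[of p1 c] d_sym[of c q2]
    by linarith
  moreover have "d p1 q2 + d p2 q1 = 4 * R"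
    using assms four_point[of p1 p2 q1 q2] four_point[of p1 q2 p2 q1] d_sym[of q2 q1] d_sym[of q2 p2] d_nonneg[of "o'" c]
    by linarith
  ultimately show ?thesis using assms d_sym[of p2 c] by linarith
qed

text \<open>Powers of \<open>c\<close> displace \<open>q\<close>, f^n q and f^(2n) q equally,
  because they commute with \<open>f\<close>. On a sufficiently long segment of the axis the middle
  is therefore only slid along, and displacements can be compared on a line.\<close>

lemma axis_subset_of_commute:
  assumes f: "hyperbolic f" and c: "hyperbolic c" and comm: "\<And>q. q \<in> V \<Longrightarrow> f (c q) = c (f q)"
  shows "axis f \<subseteq> axis c"
proof
  fix q assume q: "q \<in> axis f"
  then have qV: "q \<in> V" by (simp add: axis_def)
  have f_iso: "isometry (f ^^ n)" and c_iso: "isometry (c ^^ n)" for n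
    using f c isometry_funpow by (auto simp: hyperbolic_def)
  have comm1: "(f ^^ n) (c w) = c ((f ^^ n) w)" if "w \<in> V" for n w
    using that comm isometryD(1)[OF f_iso] by (induction n) auto
  have comm2: "(f ^^ n) ((c ^^ j) w) = (c ^^ j) ((f ^^ n) w)" if "w \<in> V" for n j w
    using that comm1 isometryD(1)[OF c_iso] by (induction j) auto
  have "d q ((c ^^ (2 * j)) q) = 2 * d q ((c ^^ j) q)" for j
  proof (cases "j = 0")
    case False
    obtain n where n: "d q ((f ^^ n) q) > max (d q ((c ^^ j) q)) (d q ((c ^^ (2 * j)) q))"
      using axis_unbounded[OF f q] by blast
    define R where "R = d q ((f ^^ n) q)"
    define o' where "o' = (f ^^ n) q"
    define p2 where "p2 = (f ^^ (2 * n)) q"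
    have V: "o' \<in> V" "p2 \<in> V" using isometryD(1)[OF f_iso] qV by (auto simp: o'_def p2_def)
    have p2: "p2 = (f ^^ n) o'" by (simp add: p2_def o'_def mult_2 funpow_add)
    have "d ((f ^^ n) q) ((f ^^ n) o') = d q o'" by (rule isometryD(2)[OF f_iso qV V(1)])
    moreover have "d q ((f ^^ (2 * n)) q) = 2 * d q ((f ^^ n) q)" using q unfolding axis_def by blast
    ultimately have dR: "d q o' = R" "d o' p2 = R" "d q p2 = 2 * R"
      unfolding p2[symmetric] p2_def[symmetric] R_def[symmetric] unfolding o'_def[symmetric] R_def by simp_all
    have seg: "d q ((c ^^ i) o') + d ((c ^^ i) o') p2 = d q p2" if i: "d q ((c ^^ i) q) < R" for i
    proof (rule near_midpoint_on_segment[OF dR(1,2,3)])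
      show "d ((c ^^ i) q) ((c ^^ i) o') = R" "d ((c ^^ i) o') ((c ^^ i) p2) = R"
        "d ((c ^^ i) q) ((c ^^ i) p2) = 2 * R"
        using isometryD(2)[OF c_iso] qV V dR by auto
      have "d o' ((c ^^ i) o') = d q ((c ^^ i) q)" "d p2 ((c ^^ i) p2) = d q ((c ^^ i) q)"
        unfolding o'_def p2_def comm2[OF qV, symmetric]
        using isometryD(2)[OF f_iso] qV isometryD(1)[OF c_iso qV] by auto
      then show "d q ((c ^^ i) q) < R" "d p2 ((c ^^ i) p2) < R" "d o' ((c ^^ i) o') < R"
        "d q ((c ^^ i) q) = d o' ((c ^^ i) o')" "d p2 ((c ^^ i) p2) = d o' ((c ^^ i) o')"
        using i by auto
    qed
    have do: "d o' ((c ^^ i) o') = d q ((c ^^ i) q)" for i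
      unfolding o'_def comm2[OF qV, symmetric]
      using isometryD(2)[OF f_iso] qV isometryD(1)[OF c_iso qV] by auto
    have s0: "d q o' + d o' p2 = d q p2" using dR by simp
    have s1: "d q ((c ^^ j) o') + d ((c ^^ j) o') p2 = d q p2" using seg n by (simp add: R_def)
    have s2: "d q ((c ^^ (2 * j)) o') + d ((c ^^ (2 * j)) o') p2 = d q p2" using seg n by (simp add: R_def)
    have "(c ^^ (2 * j)) o' = (c ^^ j) ((c ^^ j) o')" by (simp add: mult_2 funpow_add)
    then have "d ((c ^^ j) o') ((c ^^ (2 * j)) o') = d o' ((c ^^ j) o')"
      using isometryD(2)[OF c_iso, of o' "(c ^^ j) o'" j] isometryD(1)[OF c_iso] V by simp
    \<comment> \<open>The three points lie on one segment with equal consecutive distances. The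
      outer two are distinct, so the steps do not cancel but add up.\<close>
    moreover have "d o' ((c ^^ (2 * j)) o') \<noteq> 0"
      using hyperbolic_not_periodic[OF c V(1), of "2 * j"] False d_zero by auto
    ultimately have "d o' ((c ^^ (2 * j)) o') = 2 * d o' ((c ^^ j) o')"
      using dist_on_segment[OF s0 s1] dist_on_segment[OF s0 s2] dist_on_segment[OF s1 s2] by linarith
    then show ?thesis by (simp add: do)
  qed (simp add: d_zero)
  then show "q \<in> axis c" using qV by (simp add: axis_def)
qed

lemma axis_eq_of_commute:
  assumes "hyperbolic f" "hyperbolic c" "\<And>q. q \<in> V \<Longrightarrow> f (c q) = c (f q)"
  shows "axis f = axis c"
  using axis_subset_of_commute[of f c] axis_subset_of_commute[of c f] assms by auto

text \<open>Even displacements exclude inversions of edges, so without fixed points the least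
  displacement is at least 2. At a vertex attaining it the orbit cannot backtrack, as a neighbour
  would then be moved less.\<close>

lemma hyperbolicI:
  assumes f: "isometry f" and V: "V \<noteq> {}"
    and even: "\<And>q. q \<in> V \<Longrightarrow> even (d q (f q))" "\<And>q. q \<in> V \<Longrightarrow> even (d q (f (f q)))"
    and nofix: "\<And>q. q \<in> V \<Longrightarrow> f q \<noteq> q"
  shows "hyperbolic f"
proof -
  obtain q where q: "q \<in> V" "\<And>w. w \<in> V \<Longrightarrow> nat (d q (f q)) \<le> nat (d w (f w))"
    using V ex_has_least_nat[of "\<lambda>q. q \<in> V" _ "\<lambda>q. nat (d q (f q))"] by blast
  define t where "t = d q (f q)"
  have fV: "w \<in> V \<Longrightarrow> f w \<in> V" for w using f isometryD(1) by blast
  have fd: "u \<in> V \<Longrightarrow> w \<in> V \<Longrightarrow> d (f u) (f w) = d u w" for u w using f isometryD(2) by blast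
  have "t \<noteq> 0" "t \<ge> 0" "even t" using nofix[OF q(1)] even(1)[OF q(1)] d_nonneg d_zero by (auto simp: t_def)
  then have t: "t \<ge> 2" by presburger
  have t2: "d q (f (f q)) = 2 * t"
  proof (rule ccontr)
    assume ne: "d q (f (f q)) \<noteq> 2 * t"
    have "d q (f (f q)) \<le> 2 * t"
      using triangle[of q "f (f q)" "f q"] fd[OF q(1) fV[OF q(1)]] by (simp add: t_def)
    with ne have \<delta>: "d q (f (f q)) \<le> 2 * t - 2" using even(2)[OF q(1)] by presburger
    obtain p where p: "p \<in> V" "d q p = 1" "d p (f q) = t - 1"
      using step[OF q(1) fV[OF q(1)]] nofix[OF q(1)] unfolding t_def by metis
    have p': "d (f q) (f p) = 1" "d (f p) (f (f q)) = t - 1"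
      using p fd q fV by auto
    have "d q (f p) + d (f q) (f (f q)) \<le> max (d q (f q) + d (f p) (f (f q))) (d q (f (f q)) + d (f p) (f q))"
      by (rule four_point)
    then have "d q (f p) \<le> t - 1"
      using \<delta> p' fd[OF q(1) fV[OF q(1)]] d_sym[of "f p" "f q"] by (simp add: t_def)
    then have "d p (f p) \<le> t - 2"
      using four_point[of p "f p" q "f q"] p p' t d_sym[of p q] d_sym[of "f p" "f q"] d_sym[of "f p" q]
      by (simp add: t_def)
    then show False using q(2)[OF p(1)] t unfolding t_def[symmetric] by linarith
  qed
  have qn: "(f ^^ n) q \<in> V" for n using isometryD(1)[OF isometry_funpow[OF f] q(1)] .
  \<comment> \<open>Two consecutive distances are carried along, since the four-point inequality for
    the next one involves both.\<close>
  have "d q ((f ^^ n) q) = int n * t \<and> d q ((f ^^ Suc n) q) = int (Suc n) * t" for n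
  proof (induction n)
    case 0
    show ?case by (simp add: t_def d_zero)
  next
    case (Suc n)
    let ?a = "(f ^^ n) q" and ?b = "(f ^^ Suc n) q" and ?c = "(f ^^ Suc (Suc n)) q"
    have "d ?a ?b = t" "d ?b ?c = t" "d ?a ?c = 2 * t"
      using isometryD(2)[OF isometry_funpow[OF f], of q "f q" n]
        isometryD(2)[OF isometry_funpow[OF f], of q "f q" "Suc n"]
        isometryD(2)[OF isometry_funpow[OF f], of q "f (f q)" n] q fV t2
      by (simp_all add: t_def funpow_swap1)
    then have "d q ?c = int (Suc (Suc n)) * t"
      using four_point[of q ?b ?a ?c] triangle[of q ?c ?b] Suc t d_sym[of ?b ?a] d_sym[of ?b ?c]
      by (simp add: algebra_simps del: funpow.simps)
    then show ?case using Suc by simp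
  qed
  then show ?thesis unfolding hyperbolic_def using f q(1) t by (meson dual_order.strict_trans1 zero_less_numeral)
qed

end

section \<open>The prefix metric on lists\<close>

fun lcp :: "'a list \<Rightarrow> 'a list \<Rightarrow> nat" where
  "lcp (x # u) (y # w) = (if x = y then Suc (lcp u w) else 0)"
| "lcp _ _ = 0"

lemma lcp_sym: "lcp u w = lcp w u"
  by (induction u w rule: lcp.induct) (auto elim: lcp.elims)

lemma lcp_le: "lcp u w \<le> length u" "lcp u w \<le> length w"
  by (induction u w rule: lcp.induct) auto

lemma lcp_ultra: "min (lcp u v) (lcp v w) \<le> lcp u w"
proof (induction u w arbitrary: v rule: lcp.induct)
  case (1 x u y w)
  show ?case
  proof (cases v)
    case (Cons z v')
    then show ?thesis using 1[of v'] by (auto simp: min_def split: if_splits)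
  qed simp
qed auto

lemma lcp_self [simp]: "lcp u u = length u"
  by (induction u) auto

lemma lcp_full: "lcp u w = length u \<Longrightarrow> length u = length w \<Longrightarrow> u = w"
  by (induction u w rule: lcp.induct) (auto split: if_splits)

definition ldist :: "'a list \<Rightarrow> 'a list \<Rightarrow> int" where
  "ldist u w = int (length u) + int (length w) - 2 * int (lcp u w)"

lemma ldist_sym: "ldist u w = ldist w u"
  by (simp add: ldist_def lcp_sym[of u w])

lemma ldist_zero: "ldist u w = 0 \<longleftrightarrow> u = w"
proof
  assume "ldist u w = 0"
  then show "u = w" using lcp_le[of u w] by (intro lcp_full) (auto simp: ldist_def)
qed (simp add: ldist_def)

text \<open>\<open>lcp\<close> is the Gromov product based at the empty list, and its ultrametric
  inequality is equivalent to the four-point inequality.\<close>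

lemma ldist_four_point: "ldist u v + ldist w x \<le> max (ldist u w + ldist v x) (ldist u x + ldist v w)"
  using lcp_ultra[of u w v] lcp_ultra[of u x v] lcp_ultra[of w u x] lcp_ultra[of w v x]
    lcp_sym[of v w] lcp_sym[of v x] lcp_sym[of w x] lcp_sym[of u x] lcp_sym[of u w] lcp_sym[of u v]
  unfolding ldist_def by (simp add: min_def max_def split: if_splits)

context bs begin

text \<open>The element of E reaching a letter depends only on the letters before it and acts
  injectively on that letter, so lists first differ at the same place as before.\<close>

lemma lcp_eact: "valid u \<Longrightarrow> valid w \<Longrightarrow> lcp (eact p u) (eact p w) = lcp u w"
proof (induction u w arbitrary: p rule: lcp.induct)
  case (1 x u y w)
  obtain k b k' b' where xy: "x = (k, b)" "y = (k', b')" by (cases x, cases y)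
  show ?case
  proof (cases "b \<or> b'")
    case True
    then show ?thesis using 1 by (cases b; cases b') (auto simp: xy)
  next
    case False
    have "k = k'" if "(k + \<rho> p) mod \<bar>m\<bar> = (k' + \<rho> p) mod \<bar>m\<bar>"
    proof -
      have "k mod \<bar>m\<bar> = k' mod \<bar>m\<bar>"
        using that by (metis add_diff_cancel_right' mod_diff_left_eq)
      then show ?thesis using 1(2,3) False by (simp add: xy mod_pos_pos_trivial)
    qed
    then show ?thesis using 1 False by (auto simp: xy)
  qed
qed auto

text \<open>When only one list loses its head, validity prevents its tail from beginning with
  \<open>(0, True)\<close>; there is no common prefix before or after, and the changes of length
  cancel.\<close>

lemma ldist_up:
  assumes "valid u" "valid w" shows "ldist (up u) (up w) = ldist u w"
proof -
  have one: "ldist (up u) (up w) = ldist u w"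
    if u: "valid u" "u \<noteq> []" "hd u = (0, False)" and w: "valid w" "\<not> (w \<noteq> [] \<and> hd w = (0, False))" for u w
  proof -
    obtain u' where u': "u = (0, False) # u'" using u by (cases u) auto
    have "lcp u w = 0" using w u' by (cases w) auto
    moreover have "lcp u' ((0, True) # w) = 0" using u u' by (cases u') auto
    moreover have "up u = u'" "up w = (0, True) # w" using u' w by (auto simp: up_def)
    ultimately show ?thesis using u' by (simp add: ldist_def)
  qed
  show ?thesis
  proof (cases "u \<noteq> [] \<and> hd u = (0, False)"; cases "w \<noteq> [] \<and> hd w = (0, False)")
    assume "u \<noteq> [] \<and> hd u = (0, False)" "w \<noteq> [] \<and> hd w = (0, False)"
    then show ?thesis by (cases u; cases w) (auto simp: up_def ldist_def)
  next
    assume "u \<noteq> [] \<and> hd u = (0, False)" "\<not> (w \<noteq> [] \<and> hd w = (0, False))"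
    then show ?thesis using one assms by blast
  next
    assume "\<not> (u \<noteq> [] \<and> hd u = (0, False))" "w \<noteq> [] \<and> hd w = (0, False)"
    then show ?thesis using one[of w u] assms ldist_sym by metis
  next
    assume "\<not> (u \<noteq> [] \<and> hd u = (0, False))" "\<not> (w \<noteq> [] \<and> hd w = (0, False))"
    then show ?thesis by (auto simp: up_def ldist_def)
  qed
qed

lemma ldist_act:
  assumes "g \<in> S" "valid u" "valid w"
  shows "ldist (act g u) (act g w) = ldist u w"
  using assms(1)
proof (induction rule: S_induct)
  case (up g)
  then show ?case using assms by (simp add: act_ga valid_act_iff ldist_up)
next
  case (down g)
  have "ldist (down (act g u)) (down (act g w)) = ldist (up (down (act g u))) (up (down (act g w)))"
    using down(1) assms by (intro ldist_up[symmetric] valid_down) (simp_all add: valid_act_iff)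
  then show ?case using down assms by (simp add: act_uminus_ga valid_act_iff up_down)
next
  case (base p g)
  then show ?case using assms by (simp add: act_eh valid_act_iff ldist_def lcp_eact)
qed simp

text \<open>The tree is bipartite, and a group element exchanges the two classes exactly when its
  exponent is odd. Exponent 0 thus gives the even displacements that \<open>hyperbolicI\<close>
  needs.\<close>

lemma length_act_parity:
  assumes "g \<in> S" "valid l"
  shows "even (int (length (act g l)) + int (length l) + \<chi> g)"
  using assms(1)
proof (induction rule: S_induct)
  case (up g)
  have "even (int (length (up w)) + int (length w) + 1)" for w
    by (cases w) (auto simp: up_def)
  from this[of "act g l"] have "even (int (length (up (act g l))) + int (length l) + (1 + \<chi> g))"
    using up(2) by presburger
  then show ?case using up(1) assms by (simp add: act_ga valid_act_iff)
next
  case (down g)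
  have "even (int (length (down w)) + int (length w) + 1)" for w
    by (cases w) (auto simp: down_def)
  from this[of "act g l"] have "even (int (length (down (act g l))) + int (length l) + (1 + \<chi> g))"
    using down(2) by presburger
  then show ?case using down(1) assms by (simp add: act_uminus_ga valid_act_iff)
next
  case (base p g)
  then show ?case using assms by (simp add: act_eh valid_act_iff)
qed simp

sublocale tree: tree_metric ldist "{l. valid l}"
proof
  fix u v w x :: "(int \<times> bool) list"
  show "ldist u w = ldist w u" by (rule ldist_sym)
  show "ldist u w = 0 \<longleftrightarrow> u = w" by (rule ldist_zero)
  show "ldist u v + ldist w x \<le> max (ldist u w + ldist v x) (ldist u x + ldist v w)"
    by (rule ldist_four_point)
  assume uw: "u \<in> {l. valid l}" "w \<in> {l. valid l}" "u \<noteq> w"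
  \<comment> \<open>By transitivity \<open>u\<close> may be moved to the base vertex, where the
    first letter of the normal form is the step wanted.\<close>
  define w' where "w' = act (- rep u) w"
  have w: "w = act (rep u) w'" by (simp add: w'_def)
  have u: "u = act (rep u) []" using uw act_rep by simp
  have "valid w'" using uw w valid_act_iff[of "rep u" w'] by simp
  moreover have "w' \<noteq> []" using uw u w by metis
  ultimately obtain x l where w': "w' = x # l" "valid [x]" by (cases w' rule: valid.cases) auto
  have "ldist u (act (rep u) [x]) = ldist [] [x]"
    using ldist_act[of "rep u" "[]" "[x]"] u w' by simp
  moreover have "ldist (act (rep u) [x]) w = ldist [x] w'" "ldist u w = ldist [] w'"
    using ldist_act[of "rep u" "[x]" w'] ldist_act[of "rep u" "[]" w'] u w w' \<open>valid w'\<close> by simp_all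
  moreover have "valid (act (rep u) [x])" using w' valid_act_iff by simp
  ultimately show "\<exists>p\<in>{l. valid l}. ldist u p = 1 \<and> ldist p w = ldist u w - 1"
    by (intro bexI[of _ "act (rep u) [x]"]) (auto simp: ldist_def w')
qed

lemma isometry_act: "g \<in> S \<Longrightarrow> tree.isometry (act g)"
  by (auto simp: tree.isometry_def valid_act_iff ldist_act)

end


section \<open>Surjective endomorphisms\<close>

context bs begin

abbreviation gb :: model where "gb \<equiv> eh [:1:]"

lemma S_induct_ab:
  assumes "P 0" "\<And>g h. g \<in> S \<Longrightarrow> h \<in> S \<Longrightarrow> P g \<Longrightarrow> P h \<Longrightarrow> P (g + h)" "\<And>g. g \<in> S \<Longrightarrow> P g \<Longrightarrow> P (- g)"
    and "P ga" "P gb" "g \<in> S"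
  shows "P g"
proof -
  have "add_subgroup {g \<in> S. P g}" using assms by (auto simp: add_subgroup_def)
  then have "S \<subseteq> {g \<in> S. P g}" by (rule S_subset_subgroup) (use assms in auto)
  then show ?thesis using assms by blast
qed

lemma \<tau>_Laurent:
  assumes "g \<in> S" shows "\<exists>n q. tt ^ n * \<tau> g = to_fract q"
  using assms
proof (induction rule: S_induct)
  case zero
  show ?case by (intro exI[of _ 0]) simp
next
  case (up g)
  then obtain n q where "tt ^ n * \<tau> g = to_fract q" by blast
  then have "tt ^ n * \<tau> (ga + g) = to_fract ([:0, 1:] * q)"
    unfolding to_fract_mult by (simp add: mult.left_commute)
  then show ?case by blast
next
  case (down g)
  then obtain n q where "tt ^ n * \<tau> g = to_fract q" by blast
  then have "tt ^ Suc n * \<tau> (- ga + g) = to_fract q" by (simp add: field_simps power_int_minus)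
  then show ?case by blast
next
  case (base p g)
  then obtain n q where "tt ^ n * \<tau> g = to_fract q" by blast
  then have "tt ^ n * \<tau> (eh p + g) = to_fract (monom 1 n * \<pi> p + q)"
    by (simp add: distrib_left tt_power)
  then show ?case by blast
qed

text \<open>If b^m fixes a vertex, it fixes every prefix, that is, the path to it from the base
  vertex. This path starts at height 0 and cannot pass height 1, so each prefix is represented by x
  a^-i with x in B.\<close>

lemma centralizer_BB:
  assumes u: "u \<in> S" "\<chi> u = 0" and comm: "u + eh [:m:] = eh [:m:] + u"
  shows "u \<in> BB"
proof -
  have prefix: "\<exists>q. eact p (l @ l') = eact p l @ eact q l'" for p l l'
    by (induction p l rule: eact.induct) auto
  have valid_prefix: "valid (l @ l') \<Longrightarrow> valid l" for l l'
    by (induction l rule: valid.induct) auto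
  have rep_append: "rep (l @ l') = rep l + rep l'" for l l'
    by (induction l) (auto simp: add.assoc)
  have height: "\<chi> (rep l) \<noteq> 1" if l: "valid l" "eact [:m:] l = l" for l
  proof
    assume \<chi>: "\<chi> (rep l) = 1"
    have "act (eh [:m:] + rep l) [] = act (rep l) []" using l by (simp add: act_rep act_eh)
    then have "act (- rep l + (eh [:m:] + rep l)) [] = []" by simp
    then obtain q where q: "- rep l + (eh [:m:] + rep l) = eh q"
      by (rule stabilizer_Nil[rotated]) auto
    have "eh [:m:] + rep l = rep l + (- rep l + (eh [:m:] + rep l))" by (simp only: group_add_norm)
    then have "eh [:m:] + rep l = rep l + eh q" using q by simp
    then have "\<tau> (eh [:m:] + rep l) = \<tau> (rep l + eh q)" by simp
    \<comment> \<open>Comparing translation parts, at height 1 an element of E contributes with a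
      factor t, which cannot produce the nonzero constant m.\<close>
    then have "to_fract (of_int m) = to_fract ([:0, 1:] * \<pi> q)" unfolding to_fract_mult using \<chi> by simp
    then have "of_int m = [:0, 1:] * \<pi> q" by (simp only: to_fract_eq_iff)
    then have "coeff (of_int m) 0 = coeff ([:0, 1:] * \<pi> q) 0" by simp
    then show False using m_nonzero by (simp add: of_int_poly)
  qed
  have rep_BB: "\<exists>i. \<exists>x\<in>BB. rep l = x - apow i" if "valid l" "eact [:m:] l = l" for l
    using that
  proof (induction l rule: rev_induct)
    case Nil
    show ?case using add_subgroupD(1)[OF add_subgroup_BB] by (intro exI[of _ 0] bexI[of _ 0]) auto
  next
    case (snoc y l)
    obtain k b where y: "y = (k, b)" by (cases y)
    obtain q where "eact [:m:] (l @ [y]) = eact [:m:] l @ eact q [y]" using prefix by blast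
    then have "eact [:m:] l = l" using snoc.prems by (metis append_eq_append_conv length_eact)
    then obtain i x where x: "x \<in> BB" "rep l = x - apow i"
      using snoc.IH valid_prefix[OF snoc.prems(1)] by blast
    define x' where "x' = x + (conj_a ^^ i) (eh [:k:])"
    have x': "x' \<in> BB" unfolding x'_def using x conj_a_funpow_BB add_subgroupD(2)[OF add_subgroup_BB] by blast
    have r: "rep (l @ [y]) = x' - apow i + (if b then ga else - ga)"
      unfolding rep_append x(2) x'_def conj_a_funpow y rep_simps by (simp only: group_add_norm)
    consider "\<not> b" | j where b "i = Suc j" | b "i = 0" by (cases i) auto
    then show ?case
    proof cases
      case 1
      then have "rep (l @ [y]) = x' - apow (Suc i)" unfolding r apow_Suc by (simp only: group_add_norm if_False)
      then show ?thesis using x' by blast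
    next
      case 2
      then have "rep (l @ [y]) = x' - apow j" unfolding r 2 apow_Suc by (simp only: group_add_norm if_True)
      then show ?thesis using x' by blast
    next
      case 3
      then have "\<chi> (rep (l @ [y])) = 1" using \<chi>_BB[OF x'] by (simp add: r)
      then show ?thesis using height[OF snoc.prems] by blast
    qed
  qed
  obtain l p where l: "valid l" "u = rep l + eh p" "act u [] = l" using S_cases[OF u(1)] .
  have "act (eh [:m:] + u) [] = act (u + eh [:m:]) []" using comm by simp
  then have "act (eh [:m:]) l = l" using l(3) by (simp add: act_eh)
  then have "eact [:m:] l = l" using l by (simp add: act_eh)
  then obtain i x where x: "x \<in> BB" "rep l = x - apow i" using rep_BB l by blast
  have "i = 0" using u(2) \<chi>_BB[OF x(1)] by (simp add: l(2) x(2))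
  then have "u = x + eh p" by (simp add: l(2) x(2))
  then show ?thesis using x(1) conj_a_funpow_BB[of 0 p] add_subgroupD(2)[OF add_subgroup_BB] by simp
qed

text \<open>b and its inverse move every edge at the base vertex: ascending exponents are shifted in
  Z, descending ones modulo |m| > 1. So the base vertex is their only fixed point, and a commuting
  element must fix it.\<close>

lemma centralizer_gb:
  assumes m: "\<bar>m\<bar> \<ge> 2" and k: "\<bar>k\<bar> = 1" and g: "g \<in> S" and comm: "g + eh [:k:] = eh [:k:] + g"
  obtains p where "g = eh p"
proof -
  define l where "l = act g []"
  have v: "valid l" using valid_act_iff[OF g, of "[]"] by (simp add: l_def)
  have "act (eh [:k:] + g) [] = act (g + eh [:k:]) []" using comm by simp
  then have "act (eh [:k:]) l = l" by (simp add: act_eh l_def)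
  then have e: "eact [:k:] l = l" using v by (simp add: act_eh)
  have "l = []"
  proof (rule ccontr)
    assume l: "l \<noteq> []"
    show False
    proof (cases "snd (hd l)")
      case True
      then show False using hd_eact(2)[OF l, of "[:k:]"] e k by simp
    next
      case False
      then have "(fst (hd l) + k) mod \<bar>m\<bar> = fst (hd l) mod \<bar>m\<bar>"
        using hd_eact(3)[OF l, of "[:k:]"] e valid_hd[OF v l] by simp
      then have "\<bar>m\<bar> dvd k" by (simp add: mod_eq_dvd_iff)
      then show False using m k by (metis abs_dvd_iff dvd_abs_iff zdvd1_eq abs_abs linorder_not_le one_less_numeral_iff semiring_norm(76))
    qed
  qed
  then show ?thesis using stabilizer_Nil[OF g] that by (auto simp: l_def)
qed

section \<open>Consequences of surjectivity\<close>

context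
  fixes \<eta> assumes \<eta>: "additive_on S \<eta>" and surj: "\<eta> ` S = S"
begin

lemma \<eta>_in_S [simp]: "g \<in> S \<Longrightarrow> \<eta> g \<in> S" using surj by blast
lemma \<eta>_add: "g \<in> S \<Longrightarrow> h \<in> S \<Longrightarrow> \<eta> (g + h) = \<eta> g + \<eta> h" by (rule additive_on_add[OF \<eta>])
lemma \<eta>_minus: "g \<in> S \<Longrightarrow> \<eta> (- g) = - \<eta> g" by (rule additive_on_uminus[OF \<eta> add_subgroup_S])
lemma \<eta>_0: "\<eta> 0 = 0" by (rule additive_on_0[OF \<eta> add_subgroup_S])

lemmas \<eta>_simps = \<eta>_add \<eta>_minus \<eta>_0

text \<open>By surjectivity the images of a and b generate too, so closure properties can be checked
  on them.\<close>

lemma \<eta>_induct: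
  assumes "P 0" "\<And>g h. P g \<Longrightarrow> P h \<Longrightarrow> P (g + h)" "\<And>g. P g \<Longrightarrow> P (- g)"
    and "P (\<eta> ga)" "P (\<eta> gb)" "g \<in> S"
  shows "P g"
proof -
  have "P (\<eta> h)" if "h \<in> S" for h
    by (rule S_induct_ab[where P = "\<lambda>h. P (\<eta> h)"]) (use assms that in \<open>auto simp: \<eta>_simps\<close>)
  moreover obtain h where "h \<in> S" "g = \<eta> h" using surj assms(6) by (metis imageE)
  ultimately show ?thesis by simp
qed

lemma \<chi>_\<eta>_const: "\<chi> (\<eta> (eh [:c:])) = c * \<chi> (\<eta> gb)"
proof (induction c rule: int_induct[of _ 0])
  case base
  show ?case by (simp add: \<eta>_0)
next
  case (step1 i)
  have "[:i + 1:] = [:i:] + [:1:]" by simp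
  then show ?case using step1 by (simp only: eh_add \<eta>_add eh_in_S \<chi>_simps) (simp add: algebra_simps)
next
  case (step2 i)
  have "[:i - 1:] = [:i:] + - [:1:]" by simp
  then show ?case using step2 by (simp only: eh_add eh_minus \<eta>_add \<eta>_minus S_closed eh_in_S \<chi>_simps) (simp add: algebra_simps)
qed

lemma \<eta>_ga_eh: "m dvd \<rho> p \<Longrightarrow> \<eta> ga + \<eta> (eh p) = \<eta> (eh (\<phi> p)) + \<eta> ga"
  using ga_eh[of p] by (metis \<eta>_add eh_in_S ga_in_S)

lemma \<eta>_eh_commute: "\<eta> (eh p) + \<eta> (eh q) = \<eta> (eh q) + \<eta> (eh p)"
  by (metis \<eta>_add eh_commute eh_in_S)

text \<open>Otherwise a power of the image of b would be central in the wreath product of Z by Z.\<close>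

lemma \<chi>_\<eta>_gb: "\<chi> (\<eta> gb) = 0"
proof (rule ccontr)
  assume ne: "\<chi> (\<eta> gb) \<noteq> 0"
  define x y Y Z where "x = \<eta> ga" and "y = \<eta> gb" and "Y = \<eta> (eh [:m:])" and "Z = \<eta> (eh (\<phi> [:m:]))"
  have xY: "x + Y = Z + x" using \<eta>_ga_eh[of "[:m:]"] by (simp add: x_def Y_def Z_def)
  have yY: "y + Y = Y + y" and yZ: "y + Z = Z + y"
    using \<eta>_eh_commute by (simp_all add: y_def Y_def Z_def)
  have \<chi>Y: "\<chi> Y = m * \<chi> y" unfolding Y_def y_def by (rule \<chi>_\<eta>_const)
  have "\<chi> (x + Y) = \<chi> (Z + x)" using xY by simp
  then have \<chi>Z: "\<chi> Z = \<chi> Y" by simp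
  \<comment> \<open>In the wreath product, an element commuting with one of nonzero exponent is
    determined by its own exponent.\<close>
  have "\<tau> Z = \<tau> Y"
  proof -
    have "\<tau> (y + Y) = \<tau> (Y + y)" "\<tau> (y + Z) = \<tau> (Z + y)" using yY yZ by simp_all
    then have "(tt powi \<chi> y - 1) * (\<tau> Z - \<tau> Y) = 0" using \<chi>Z by (simp add: algebra_simps)
    moreover have "tt powi \<chi> y \<noteq> 1" using ne tt_power_int_eq_1_iff by (simp add: y_def)
    ultimately show ?thesis by simp
  qed
  then have aff: "aff_part Z = aff_part Y" using \<chi>Z by (auto simp: \<chi>_def \<tau>_def intro: aff.expand)
  \<comment> \<open>As \<open>Z\<close> and \<open>Y\<close> agree in the wreath product,
    \<open>Y\<close> commutes there with the images of a and b, hence with everything. Commuting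
    with the translation by 1 forces its exponent to be 0.\<close>
  have "aff_part gb + aff_part Y = aff_part Y + aff_part gb"
  proof (rule \<eta>_induct[where P = "\<lambda>g. aff_part g + aff_part Y = aff_part Y + aff_part g"])
    fix g h assume "aff_part g + aff_part Y = aff_part Y + aff_part g" "aff_part h + aff_part Y = aff_part Y + aff_part h"
    then show "aff_part (g + h) + aff_part Y = aff_part Y + aff_part (g + h)"
      by (metis add.assoc model_part_simps(5))
  next
    fix g assume "aff_part g + aff_part Y = aff_part Y + aff_part g"
    then have "- aff_part g + (aff_part g + aff_part Y) + - aff_part g = - aff_part g + (aff_part Y + aff_part g) + - aff_part g"
      by simp
    then show "aff_part (- g) + aff_part Y = aff_part Y + aff_part (- g)"
      unfolding model_part_simps by (simp only: group_add_norm)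
  next
    have "aff_part (x + Y) = aff_part (Z + x)" using xY by simp
    then show "aff_part (\<eta> ga) + aff_part Y = aff_part Y + aff_part (\<eta> ga)" using aff by (simp add: x_def)
    have "aff_part (y + Y) = aff_part (Y + y)" using yY by simp
    then show "aff_part (\<eta> gb) + aff_part Y = aff_part Y + aff_part (\<eta> gb)" by (simp add: y_def)
  qed auto
  then have "\<tau> (gb + Y) = \<tau> (Y + gb)" by (simp add: \<tau>_def del: \<tau>_simps)
  then have "tt powi \<chi> Y = 1" by simp
  then have "m * \<chi> y = 0" using tt_power_int_eq_1_iff \<chi>Y by simp
  then show False using ne m_nonzero by (simp add: y_def)
qed

lemma \<chi>_\<eta>: "g \<in> S \<Longrightarrow> \<chi> (\<eta> g) = \<chi> (\<eta> ga) * \<chi> g"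
  by (rule S_induct_ab[where P = "\<lambda>g. \<chi> (\<eta> g) = \<chi> (\<eta> ga) * \<chi> g"])
    (auto simp: \<eta>_simps \<chi>_\<eta>_gb algebra_simps)

lemma \<chi>_\<eta>_ga: "\<bar>\<chi> (\<eta> ga)\<bar> = 1"
proof -
  obtain g where "g \<in> S" "\<eta> g = ga" using surj by (metis ga_in_S imageE)
  then have "\<chi> (\<eta> ga) * \<chi> g = 1" using \<chi>_\<eta>[of g] by simp
  then show ?thesis by (metis zmult_eq_1_iff abs_1 abs_minus_cancel)
qed

lemma \<eta>_gb_fixes_vertex: "\<exists>q. valid q \<and> act (\<eta> gb) q = q"
proof (rule ccontr)
  assume nofix: "\<nexists>q. valid q \<and> act (\<eta> gb) q = q"
  define x y where "x = \<eta> ga" and "y = \<eta> gb"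
  define M where "M = nat \<bar>m\<bar>"
  \<comment> \<open>h(a) h(b)^|m| h(a)^-1; the absolute value makes the power an iterate. It
    commutes with h(b), both being images of elements of E.\<close>
  define z where "z = \<eta> (eh (\<phi> [:\<bar>m\<bar>:]))"
  have S: "x \<in> S" "y \<in> S" "z \<in> S" by (simp_all add: x_def y_def z_def)
  have fy: "tree.isometry (act y)" and fz: "tree.isometry (act z)" using isometry_act S by auto
  have even: "even (ldist q (act g q))" if "valid q" "g \<in> S" "\<chi> g = 0" for q g
  proof -
    have "even (int (length (act g q)) + int (length q) + 0)"
      using length_act_parity[OF that(2,1)] that(3) by simp
    then show ?thesis by (simp add: ldist_def)
  qed
  have hy: "tree.hyperbolic (act y)"
  proof (rule tree.hyperbolicI[OF fy])
    show "{l. valid l} \<noteq> {}" using valid.simps(1) by blast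
    fix q assume q: "q \<in> {l. valid l}"
    show "even (ldist q (act y q))" "even (ldist q (act y (act y q)))"
      using even[of q y] even[of q "y + y"] q S \<chi>_\<eta>_gb by (auto simp: y_def)
    show "act y q \<noteq> q" using nofix q by (auto simp: y_def)
  qed
  obtain o' t where o: "valid o'" "t > 0" "\<And>n. ldist o' ((act y ^^ n) o') = int n * t"
    using hy by (auto simp: tree.hyperbolic_def)
  have M: "M > 0" "int M = \<bar>m\<bar>" using m_nonzero by (auto simp: M_def)
  have pow: "act (\<eta> (eh [:int n:])) = act y ^^ n" for n
  proof (induction n)
    case 0
    show ?case by (auto simp: \<eta>_0)
  next
    case (Suc n)
    have "[:int (Suc n):] = [:1:] + [:int n:]" by simp
    then have "\<eta> (eh [:int (Suc n):]) = y + \<eta> (eh [:int n:])" by (simp only: eh_add \<eta>_add eh_in_S y_def)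
    then show ?case using Suc by (auto simp: fun_eq_iff)
  qed
  have zx: "act z (act x q) = act x ((act y ^^ M) q)" for q
  proof -
    have "x + \<eta> (eh [:\<bar>m\<bar>:]) = z + x" unfolding x_def z_def by (rule \<eta>_ga_eh) simp
    then have "act (x + \<eta> (eh [:\<bar>m\<bar>:])) q = act (z + x) q" by simp
    then show ?thesis using pow[of M] M by simp
  qed
  have zxn: "(act z ^^ n) (act x q) = act x (((act y ^^ M) ^^ n) q)" for n q
    by (induction n) (auto simp: zx)
  have dx: "ldist (act x u) (act x w) = ldist u w" if "valid u" "valid w" for u w
    using ldist_act S that by blast
  have yV: "valid ((act y ^^ n) q)" if "valid q" for n q
    using that valid_act_iff[OF S(2)] by (induction n) auto
  have hM: "tree.hyperbolic (act y ^^ M)"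
    unfolding tree.hyperbolic_def
  proof (intro conjI bexI[of _ o'] exI[of _ "int M * t"])
    show "tree.isometry (act y ^^ M)" using tree.isometry_funpow[OF fy] .
    show "int M * t > 0" using M o(2) by simp
    show "\<forall>n. ldist o' (((act y ^^ M) ^^ n) o') = int n * (int M * t)"
      using o(3) by (simp add: funpow_mult)
  qed (use o in simp)
  have hz: "tree.hyperbolic (act z)"
    unfolding tree.hyperbolic_def
  proof (intro conjI bexI[of _ "act x o'"] exI[of _ "int M * t"])
    show "int M * t > 0" using M o(2) by simp
    show "\<forall>n. ldist (act x o') ((act z ^^ n) (act x o')) = int n * (int M * t)"
      using o yV by (simp add: zxn dx funpow_mult)
  qed (use fz o valid_act_iff S in auto)
  \<comment> \<open>\<open>y\<close>, its power and \<open>z\<close> share one axis. Conjugation by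
    \<open>x\<close> takes the power to \<open>z\<close>, so \<open>x\<close> preserves this
    axis.\<close>
  have axM: "tree.axis (act y) = tree.axis (act y ^^ M)"
    by (rule tree.axis_eq_of_commute[OF hy hM]) (metis funpow_swap1)
  have axz: "tree.axis (act y) = tree.axis (act z)"
  proof (rule tree.axis_eq_of_commute[OF hy hz])
    fix q
    have "y + z = z + y" unfolding y_def z_def by (rule \<eta>_eh_commute)
    then show "act y (act z q) = act z (act y q)" by (metis act_simps(2))
  qed
  have yMV: "valid (((act y ^^ M) ^^ n) q)" if "valid q" for n q
    using yV[OF that] by (simp add: funpow_mult)
  have inv: "act g q \<in> tree.axis (act y) \<longleftrightarrow> q \<in> tree.axis (act y)" if "g \<in> S" for g q
  proof -
    have "\<forall>q. act g q \<in> tree.axis (act y) \<longleftrightarrow> q \<in> tree.axis (act y)"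
    proof (rule \<eta>_induct[where P = "\<lambda>g. \<forall>q. act g q \<in> tree.axis (act y) \<longleftrightarrow> q \<in> tree.axis (act y)"])
      fix g assume "\<forall>q. act g q \<in> tree.axis (act y) \<longleftrightarrow> q \<in> tree.axis (act y)"
      then have "act g (act (- g) q) \<in> tree.axis (act y) \<longleftrightarrow> act (- g) q \<in> tree.axis (act y)" for q by blast
      then show "\<forall>q. act (- g) q \<in> tree.axis (act y) \<longleftrightarrow> q \<in> tree.axis (act y)"
        by (simp only: act_uminus_cancel) blast
    next
      have "act x q \<in> tree.axis (act z) \<longleftrightarrow> q \<in> tree.axis (act y ^^ M)" for q
        using yMV valid_act_iff[OF S(1), of q] by (auto simp: tree.axis_def zxn dx)
      then show "\<forall>q. act (\<eta> ga) q \<in> tree.axis (act y) \<longleftrightarrow> q \<in> tree.axis (act y)"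
        using axM axz by (simp add: x_def)
    next
      have "(act y ^^ n) (act y q) = act y ((act y ^^ n) q)" for n q by (simp add: funpow_swap1)
      moreover have "ldist (act y u) (act y w) = ldist u w" if "valid u" "valid w" for u w
        using ldist_act S that by blast
      ultimately have "act y q \<in> tree.axis (act y) \<longleftrightarrow> q \<in> tree.axis (act y)" for q
        using yV valid_act_iff[OF S(2), of q] by (auto simp: tree.axis_def)
      then show "\<forall>q. act (\<eta> gb) q \<in> tree.axis (act y) \<longleftrightarrow> q \<in> tree.axis (act y)" by (simp add: y_def)
    qed (use that in auto)
    then show ?thesis by blast
  qed
  have "o' \<in> tree.axis (act y)" using o by (simp add: tree.axis_def)
  moreover have "act (rep o') [] = o'" using o act_rep by blast
  ultimately have "[] \<in> tree.axis (act y)" using inv[of "rep o'" "[]"] by simp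
  then have all: "w \<in> tree.axis (act y)" if "valid w" for w
    using inv[of "rep w" "[]"] act_rep[OF that] by simp
  text \<open>A neighbour of the base vertex off the axis of y gives a contradiction.\<close>
  define l1 l2 where "l1 = act y []" and "l2 = act (- y) []"
  \<comment> \<open>Infinitely many ascending edges leave the base vertex, and the paths to its
    images under \<open>y\<close> and its inverse begin with at most two of them.\<close>
  obtain k :: int where k: "(k, True) \<noteq> hd l1" "(k, True) \<noteq> hd l2"
  proof -
    have "finite {fst (hd l1), fst (hd l2)}" by simp
    then obtain k :: int where "k \<notin> {fst (hd l1), fst (hd l2)}"
      using ex_new_if_finite[OF infinite_UNIV_int] by blast
    then show thesis using that[of k] by (metis fst_conv insertCI)
  qed
  define w where "w = [(k, True)]"
  have w: "valid w" by (simp add: w_def)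
  define c where "c = ldist [] (act y [])"
  have c: "c > 0" using tree.hyperbolic_not_periodic[OF hy, of "[]" 1] ldist_zero[of "[]" "act y []"] tree.d_nonneg[of "[]" "act y []"]
    by (simp add: c_def order_less_le)
  have lcp: "lcp w l1 = 0" "lcp w l2 = 0" 
    using k by ((cases l1; auto simp: w_def), (cases l2; auto simp: w_def))
  have d1: "ldist w (act y []) = 1 + c" using lcp(1) by (simp add: c_def ldist_def w_def l1_def)
  have "ldist (act y l2) (act y w) = ldist l2 w"
    using ldist_act[OF S(2), of l2 w] w valid_act_iff[of "- y" "[]"] S by (simp add: l2_def)
  then have "ldist [] (act y w) = ldist w l2" by (simp add: l2_def ldist_sym)
  moreover have "ldist l2 [] = c"
    using ldist_act[OF S(2), of l2 "[]"] valid_act_iff[of "- y" "[]"] S by (simp add: l2_def c_def)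
  ultimately have d2: "ldist [] (act y w) = 1 + c"
    using lcp(2) by (simp add: ldist_def w_def)
  have d3: "ldist w [] = 1" "ldist (act y w) (act y []) = 1"
    using ldist_act[OF S(2) w, of "[]"] by (simp_all add: w_def ldist_def)
  \<comment> \<open>\<open>w\<close> is one step off the path, so \<open>y\<close> moves it at least
    2 further than the base vertex. Doubling would then require y^2 to move it by at least 4 + 2c,
    while the triangle inequality allows only 2 + 2c.\<close>
  have d4: "ldist w (act y w) \<ge> 2 + c"
    using tree.four_point[of w "act y []" "[]" "act y w"] d1 d2 d3 c
    by (simp add: c_def ldist_sym[of "act y []"])
  have "ldist w (act y (act y w)) = 2 * ldist w (act y w)"
    using all[OF w] unfolding tree.axis_def by (auto dest!: spec[of _ 1] simp: numeral_2_eq_2)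
  moreover have "ldist w (act y (act y w)) \<le> 1 + 2 * c + 1"
  proof -
    have "ldist (act y (act y [])) (act y (act y w)) = 1"
      using ldist_act[OF S(2), of "act y []" "act y w"] w d3 valid_act_iff[OF S(2)] by (simp add: ldist_sym[of "act y []"])
    moreover have "ldist (act y []) (act y (act y [])) = c"
      using ldist_act[OF S(2), of "[]" "act y []"] valid_act_iff[OF S(2)] by (simp add: c_def)
    ultimately show ?thesis
      using tree.triangle[of w "act y (act y w)" "act y []"] tree.triangle[of "act y []" "act y (act y w)" "act y (act y [])"] d1
      by linarith
  qed
  ultimately show False using d4 by linarith
qed

section \<open>Surjective endomorphisms preserving the exponent\<close>

context
  assumes \<chi>_id: "\<And>g. g \<in> S \<Longrightarrow> \<chi> (\<eta> g) = \<chi> g"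
begin

text \<open>Both sides are cocycles in \<^term>\<open>g\<close> that agree on the generators.\<close>

lemma \<tau>_\<eta>_cocycle:
  "g \<in> S \<Longrightarrow> (1 - tt) * \<tau> (\<eta> g) = (1 - tt powi \<chi> g) * \<tau> (\<eta> ga) + (1 - tt) * (\<tau> (\<eta> gb) * \<tau> g)"
proof (rule S_induct_ab[where P = "\<lambda>g. (1 - tt) * \<tau> (\<eta> g) =
    (1 - tt powi \<chi> g) * \<tau> (\<eta> ga) + (1 - tt) * (\<tau> (\<eta> gb) * \<tau> g)"])
  define t where "t = tt"
  have t: "t \<noteq> 0" by (simp add: t_def)
  fix g h assume gh: "g \<in> S" "h \<in> S" and
    g: "(1 - tt) * \<tau> (\<eta> g) = (1 - tt powi \<chi> g) * \<tau> (\<eta> ga) + (1 - tt) * (\<tau> (\<eta> gb) * \<tau> g)" and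
    h: "(1 - tt) * \<tau> (\<eta> h) = (1 - tt powi \<chi> h) * \<tau> (\<eta> ga) + (1 - tt) * (\<tau> (\<eta> gb) * \<tau> h)"
  have "(1 - tt) * \<tau> (\<eta> (g + h)) = (1 - tt) * \<tau> (\<eta> g) + tt powi \<chi> g * ((1 - tt) * \<tau> (\<eta> h))"
    using gh by (simp only: \<eta>_add \<tau>_simps \<chi>_id ring_distribs mult_ac)
  then show "(1 - tt) * \<tau> (\<eta> (g + h)) =
      (1 - tt powi \<chi> (g + h)) * \<tau> (\<eta> ga) + (1 - tt) * (\<tau> (\<eta> gb) * \<tau> (g + h))"
    unfolding g h \<chi>_simps \<tau>_simps power_int_add[OF disjI1[OF tt_nonzero]]
    unfolding t_def[symmetric] by (simp add: algebra_simps)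
next
  fix g assume gS: "g \<in> S" and
    g: "(1 - tt) * \<tau> (\<eta> g) = (1 - tt powi \<chi> g) * \<tau> (\<eta> ga) + (1 - tt) * (\<tau> (\<eta> gb) * \<tau> g)"
  have expand: "- (s * ((1 - w) * q + (1 - t) * (P * x))) = (s * w - s) * q + (1 - t) * (P * - (s * x))"
    for s w q t P x :: "int poly fract" by (simp add: algebra_simps)
  define s where "s = tt powi (- \<chi> g)"
  have s: "s * tt powi \<chi> g = 1" unfolding s_def by (simp flip: power_int_add)
  have "(1 - tt) * \<tau> (\<eta> (- g)) = - (s * ((1 - tt) * \<tau> (\<eta> g)))"
    using gS by (simp only: \<eta>_minus \<tau>_simps \<chi>_id s_def ring_distribs mult_ac minus_mult_right)
  also have "\<dots> = (s * tt powi \<chi> g - s) * \<tau> (\<eta> ga) + (1 - tt) * (\<tau> (\<eta> gb) * - (s * \<tau> g))"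
    unfolding g by (rule expand)
  finally show "(1 - tt) * \<tau> (\<eta> (- g)) =
      (1 - tt powi \<chi> (- g)) * \<tau> (\<eta> ga) + (1 - tt) * (\<tau> (\<eta> gb) * \<tau> (- g))"
    unfolding s by (simp only: \<chi>_simps \<tau>_simps s_def)
qed (auto simp: \<eta>_0)

text \<open>For exponent 0 the contribution of the image of a to the cocycle vanishes, and 1 - t can
  be cancelled.\<close>

lemma \<tau>_\<eta>:
  assumes "g \<in> S" "\<chi> g = 0" shows "\<tau> (\<eta> g) = \<tau> (\<eta> gb) * \<tau> g"
proof -
  have "tt \<noteq> 1" using tt_power_int_eq_1_iff[of 1] by simp
  then have "1 - tt \<noteq> 0" by simp
  moreover have "(1 - tt) * \<tau> (\<eta> g) = (1 - tt) * (\<tau> (\<eta> gb) * \<tau> g)"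
    using \<tau>_\<eta>_cocycle[OF assms(1)] assms(2) by simp
  ultimately show ?thesis by (simp only: mult_cancel_left) blast
qed

lemma \<tau>_\<eta>_gb_unit:
  obtains g where "g \<in> S" "\<tau> (\<eta> gb) * \<tau> g = 1"
proof -
  obtain g where g: "g \<in> S" "\<eta> g = gb" using surj by (metis eh_in_S imageE)
  then have "\<chi> g = 0" using \<chi>_id[OF g(1)] by simp
  then show ?thesis using \<tau>_\<eta>[OF g(1)] g that by simp
qed

text \<open>Here E_(m,xi) is all of E, so a normalizes E into itself and every element is a^-i p
  a^j. With exponent 0 it is conjugate to an element of E, which the wreath product detects.\<close>

lemma inj_if_unit_m:
  assumes m: "\<bar>m\<bar> = 1" shows "inj_on \<eta> S"
proof -
  have dvd: "m dvd c" for c using m by (metis abs_dvd_iff one_dvd)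
  have apow_eh: "\<exists>q. apow i + eh p = eh q + apow i" for i p
  proof (induction i)
    case (Suc i)
    then obtain q where "apow i + eh p = eh q + apow i" by blast
    then have "apow (Suc i) + eh p = eh (\<phi> q) + apow (Suc i)"
      unfolding apow_Suc using ga_eh[OF dvd, of q] by (metis add.assoc)
    then show ?case by blast
  qed auto
  have nf: "\<exists>i j p. g = - apow i + eh p + apow j" if "g \<in> S" for g
    using that
  proof (induction rule: S_induct)
    case zero
    show ?case by (intro exI[of _ 0]) simp
  next
    case (up g)
    then obtain i j p where g: "g = - apow i + eh p + apow j" by blast
    show ?case
    proof (cases i)
      case 0
      have "ga + g = - apow 0 + eh (\<phi> p) + apow (Suc j)"
        using ga_eh[OF dvd, of p] unfolding g 0 apow_Suc by (simp add: add.assoc[symmetric])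
      then show ?thesis by blast
    next
      case (Suc i')
      have "ga + g = - apow i' + eh p + apow j" unfolding g Suc apow.simps by (simp only: group_add_norm)
      then show ?thesis by blast
    qed
  next
    case (down g)
    then obtain i j p where g: "g = - apow i + eh p + apow j" by blast
    have "- ga + g = - apow (Suc i) + eh p + apow j" unfolding g apow.simps by (simp only: group_add_norm)
    then show ?case by blast
  next
    case (base q g)
    then obtain i j p where g: "g = - apow i + eh p + apow j" by blast
    obtain q' where q': "apow i + eh q = eh q' + apow i" using apow_eh by blast
    have "eh q + g = - apow i + (apow i + eh q) + - apow i + eh p + apow j"
      unfolding g by (simp only: group_add_norm)
    also have "\<dots> = - apow i + eh (q' + p) + apow j" unfolding q' eh_add by (simp only: group_add_norm)
    finally show ?case by blast
  qed
  obtain g0 where g0: "g0 \<in> S" "\<tau> (\<eta> gb) * \<tau> g0 = 1" by (rule \<tau>_\<eta>_gb_unit)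
  have ker: "g = 0" if g: "g \<in> S" "\<eta> g = 0" for g
  proof -
    have "\<chi> g = 0" using \<chi>_id[OF g(1)] g(2) by simp
    then have "\<tau> (\<eta> gb) * \<tau> g = 0" using \<tau>_\<eta>[OF g(1)] g(2) by simp
    then have "\<tau> g = 0" using g0 by auto
    obtain i j p where e: "g = - apow i + eh p + apow j" using nf g by blast
    have ij: "i = j" using \<open>\<chi> g = 0\<close> e by simp
    have "eh p = apow i + g + - apow i" unfolding e ij by (simp only: group_add_norm)
    then have "\<tau> (eh p) = \<tau> (apow i + g + - apow i)" by simp
    also have "\<dots> = 0"
    proof -
      have "\<tau> (apow i) = 0" by (induction i) auto
      then show ?thesis using \<open>\<tau> g = 0\<close> \<open>\<chi> g = 0\<close> by (simp del: add_uminus_conv_diff)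
    qed
    finally have "p = 0" by simp
    then show ?thesis using e ij by simp
  qed
  show ?thesis by (rule additive_on_inj[OF \<eta> add_subgroup_S ker])
qed

lemma inj_if_gb_base:
  assumes m: "\<bar>m\<bar> \<ge> 2" and p: "\<eta> gb = eh p"
  shows "inj_on \<eta> S"
proof -
  obtain g0 where g0: "g0 \<in> S" "\<tau> (\<eta> gb) * \<tau> g0 = 1" by (rule \<tau>_\<eta>_gb_unit)
  obtain n q where q: "tt ^ n * \<tau> g0 = to_fract q" using \<tau>_Laurent[OF g0(1)] by blast
  have "to_fract (\<pi> p * q) = tt ^ n * (to_fract (\<pi> p) * \<tau> g0)" by (simp flip: q add: mult_ac)
  also have "\<dots> = to_fract (monom 1 n)" using g0(2) p by (simp add: tt_power)
  finally have "\<pi> p * q = monom 1 n" by (simp only: to_fract_eq_iff)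
  \<comment> \<open>\<open>\<pi> p\<close> divides a power of t in Z[t], so its leading coefficient
    is 1 or -1; for positive degree that coefficient would be divisible by m.\<close>
  then have "lead_coeff (\<pi> p * q) = 1" by (simp add: degree_monom_eq)
  then have lead: "lead_coeff (\<pi> p) * lead_coeff q = 1" by (simp add: lead_coeff_mult)
  have "degree p = 0"
  proof (rule ccontr)
    assume "degree p \<noteq> 0"
    then have "lead_coeff (\<pi> p) = m * lead_coeff p" using coeff_\<pi>_degree[of p] by (simp add: degree_\<pi>)
    then have "m dvd 1" using lead by (metis dvd_triv_left mult.assoc)
    then show False using m by simp
  qed
  then obtain k where k: "p = [:k:]" by (metis degree_eq_zeroE)
  have k1: "\<bar>k\<bar> = 1"
  proof -
    have "lead_coeff (\<pi> p) = k" by (simp add: k of_int_poly)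
    then show ?thesis using lead by (metis zmult_eq_1_iff abs_1 abs_minus_cancel)
  qed
  then have kk: "k * k = 1" by (metis abs_mult_self_eq mult_1)
  have base: "\<eta> (eh s) = eh (smult k s)" for s
  proof -
    have "\<eta> (eh s) + eh [:k:] = eh [:k:] + \<eta> (eh s)" using \<eta>_eh_commute[of s "[:1:]"] p k by simp
    then obtain s' where s': "\<eta> (eh s) = eh s'" using centralizer_gb[OF m k1] by (metis \<eta>_in_S eh_in_S)
    have "\<tau> (\<eta> (eh s)) = \<tau> (\<eta> gb) * \<tau> (eh s)" by (rule \<tau>_\<eta>) auto
    then have "to_fract (\<pi> s') = to_fract (\<pi> (smult k s))" by (simp add: s' p k)
    then have "s' = smult k s" by (rule \<pi>_inj[OF iffD1[OF to_fract_eq_iff]])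
    then show ?thesis by (simp add: s')
  qed
  define u where "u = - \<eta> ga + ga"
  \<comment> \<open>As the sign \<open>k\<close> squares to 1, conjugation by a and by its image
    induce the same map \<open>\<phi>\<close> on E_(m,xi).\<close>
  have comm: "u + eh s = eh s + u" if s: "m dvd \<rho> s" for s
  proof -
    have s': "m dvd \<rho> (smult k s)" using s by simp
    have ss: "smult k (smult k s) = s" by (simp add: kk)
    have "\<eta> ga + eh s = eh (smult k (\<phi> (smult k s))) + \<eta> ga"
      using \<eta>_ga_eh[OF s'] by (simp only: base ss)
    also have "smult k (\<phi> (smult k s)) = \<phi> s" using \<phi>_smult[OF s', of k] by (simp only: ss)
    finally have x: "\<eta> ga + eh s = eh (\<phi> s) + \<eta> ga" .
    have "u + eh s = - \<eta> ga + (ga + eh s)" by (simp add: u_def add.assoc)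
    also have "\<dots> = - \<eta> ga + (eh (\<phi> s) + \<eta> ga) + - \<eta> ga + ga" unfolding ga_eh[OF s] by (simp only: group_add_norm)
    also have "\<dots> = eh s + u" unfolding x[symmetric] u_def by (simp only: group_add_norm)
    finally show ?thesis .
  qed
  have uS: "u \<in> S" by (auto simp: u_def)
  have "u \<in> BB"
  proof (rule centralizer_BB[OF uS])
    show "\<chi> u = 0" using \<chi>_id[of ga] by (simp add: u_def)
    show "u + eh [:m:] = eh [:m:] + u" by (rule comm) simp
  qed
  moreover have "\<eta> ga = ga - u" unfolding u_def by (simp only: group_add_norm)
  moreover have "coprime k m" using k1 by (metis coprime_1_left coprime_abs_left_iff)
  moreover have "k \<noteq> 0" using k1 by auto
  ultimately show ?thesis using inj_endomorphism[OF \<eta> base] comm by blast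
qed

end

end

text \<open>Following the endomorphism by the inner automorphism that takes the fixed vertex to the
  base vertex affects neither injectivity nor exponents, and puts the image of b into E, the
  stabilizer of the base vertex.\<close>

lemma inj_if_surj_degree:
  assumes \<eta>: "additive_on S \<eta>" "\<eta> ` S = S" and \<chi>: "\<And>g. g \<in> S \<Longrightarrow> \<chi> (\<eta> g) = \<chi> g"
  shows "inj_on \<eta> S"
proof (cases "\<bar>m\<bar> = 1")
  case True
  then show ?thesis using inj_if_unit_m[OF \<eta> \<chi>] by blast
next
  case False
  then have m: "\<bar>m\<bar> \<ge> 2" using m_nonzero by linarith
  obtain q where q: "valid q" "act (\<eta> gb) q = q" using \<eta>_gb_fixes_vertex[OF \<eta>] by blast
  define c where "c = rep q"
  have c: "c \<in> S" "act c [] = q" using q act_rep by (auto simp: c_def)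
  define \<theta> where "\<theta> g = - c + \<eta> g + c" for g
  have mem: "\<eta> g \<in> S" if "g \<in> S" for g using \<eta>(1) additive_on_mem that by blast
  have \<theta>1: "additive_on S \<theta>"
    unfolding additive_on_def
  proof (intro conjI ballI)
    show "\<theta> ` S \<subseteq> S" using mem c by (auto simp: \<theta>_def)
    fix x y assume "x \<in> S" "y \<in> S"
    then have "\<eta> (x + y) = \<eta> x + \<eta> y" by (rule additive_on_add[OF \<eta>(1)])
    then show "\<theta> (x + y) = \<theta> x + \<theta> y" unfolding \<theta>_def by (simp only: group_add_norm)
  qed
  have \<theta>2: "\<theta> ` S = S"
  proof
    show "\<theta> ` S \<subseteq> S" using \<theta>1 by (simp add: additive_on_def)
    show "S \<subseteq> \<theta> ` S"
    proof
      fix h assume h: "h \<in> S"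
      then have "c + h + - c \<in> S" using c by blast
      then obtain g where g: "g \<in> S" "\<eta> g = c + h + - c" using \<eta>(2) by (metis imageE)
      have "\<theta> g = h" unfolding \<theta>_def g(2) by (simp only: group_add_norm)
      then show "h \<in> \<theta> ` S" using g by blast
    qed
  qed
  have \<theta>3: "\<chi> (\<theta> g) = \<chi> g" if "g \<in> S" for g using \<chi>[OF that] by (simp add: \<theta>_def)
  have "act (\<theta> gb) [] = []" unfolding \<theta>_def using q c by (metis act_simps(2) act_uminus_cancel(1))
  moreover have "\<theta> gb \<in> S" using \<theta>1 additive_on_mem by blast
  ultimately obtain p where "\<theta> gb = eh p" using stabilizer_Nil by blast
  then have "inj_on \<theta> S" using inj_if_gb_base[OF \<theta>1 \<theta>2 \<theta>3 m] by blast
  then show ?thesis by (auto simp: inj_on_def \<theta>_def)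
qed

lemma inj_if_surj:
  assumes \<eta>: "additive_on S \<eta>" "\<eta> ` S = S"
  shows "inj_on \<eta> S"
proof -
  have "inj_on (\<eta> \<circ> \<eta>) S"
  proof (rule inj_if_surj_degree)
    show "additive_on S (\<eta> \<circ> \<eta>)" using \<eta>(1) by (auto simp: additive_on_def image_subset_iff)
    show "(\<eta> \<circ> \<eta>) ` S = S" by (simp only: image_comp[symmetric] \<eta>(2))
    fix g assume g: "g \<in> S"
    then have "\<eta> g \<in> S" using \<eta>(2) by blast
    then have "\<chi> ((\<eta> \<circ> \<eta>) g) = \<chi> (\<eta> ga) * \<chi> (\<eta> ga) * \<chi> g"
      using \<chi>_\<eta>[OF \<eta> g] \<chi>_\<eta>[OF \<eta>, of "\<eta> g"] by simp
    also have "\<chi> (\<eta> ga) * \<chi> (\<eta> ga) = 1" using \<chi>_\<eta>_ga[OF \<eta>] by (metis abs_mult_self_eq mult_1)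
    finally show "\<chi> ((\<eta> \<circ> \<eta>) g) = \<chi> g" by simp
  qed
  then show ?thesis by (rule inj_on_imageI2)
qed

text \<open>The factor is congruent to 1 modulo m, hence coprime to it, but it is not a unit. The
  choice of the word is immaterial: words with equal values in the faithful model are equivalent in
  the presentation.\<close>

definition scale :: "model \<Rightarrow> model" where
  "scale g = eval_word (gen_map (\<bar>m\<bar> + 1)) (SOME w. ev w = g)"

lemma scale_ev: "scale (ev w) = eval_word (gen_map (\<bar>m\<bar> + 1)) w"
proof -
  have "ev (SOME u. ev u = ev w) = ev w" by (rule someI[of _ w]) simp
  then show ?thesis unfolding scale_def by (intro eval_cong) (simp only: ev_eq_iff)
qed

lemma scale_gen: "scale ga = ga" "scale (eh p) = eh (smult (\<bar>m\<bar> + 1) p)"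
  using scale_ev[of "[(A, False)]"] scale_ev[of "ew p"] by (simp_all add: eval_eword)

lemma additive_scale: "additive_on S scale"
proof -
  have "eval_word (gen_map k) w \<in> S" for k w
  proof (induction w)
    case (Cons x w)
    obtain g b where x: "x = (g, b)" by (cases x)
    have "gen_map k g \<in> S" by (cases g) auto
    then show ?case using Cons x by auto
  qed auto
  moreover have "scale (ev u + ev v) = scale (ev u) + scale (ev v)" for u v
    using scale_ev[of "u @ v"] by (simp add: scale_ev)
  ultimately show ?thesis unfolding additive_on_def S_def by (auto simp: scale_ev)
qed

lemma inj_scale: "inj_on scale S"
proof (rule inj_endomorphism[OF additive_scale scale_gen(2), of 0])
  show "\<bar>m\<bar> + 1 \<noteq> 0" by simp
  show "coprime (\<bar>m\<bar> + 1) m"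
  proof (rule coprimeI)
    fix c assume "c dvd \<bar>m\<bar> + 1" "c dvd m"
    then show "c dvd 1" by (metis dvd_abs_iff dvd_add_right_iff)
  qed
  show "0 \<in> BB" by (rule add_subgroupD(1)[OF add_subgroup_BB])
qed (auto simp: scale_gen)

lemma to_fract_of_int: "to_fract (of_int c :: int poly) = of_int c"
  by (induction c rule: int_induct[of _ 0]) auto

text \<open>Translation parts of images are multiples of |m| + 1 in the Laurent ring, and the
  translation part 1 of b is not.\<close>

lemma scale_not_surj: "scale ` S \<noteq> S"
proof
  assume "scale ` S = S"
  then obtain g where g: "g \<in> S" "scale g = gb" by (metis eh_in_S imageE)
  have "\<chi> (scale g) = \<chi> g \<and> \<tau> (scale g) = of_int (\<bar>m\<bar> + 1) * \<tau> g"
    using g(1)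
  proof (rule S_induct_ab[
      where P = "\<lambda>g. \<chi> (scale g) = \<chi> g \<and> \<tau> (scale g) = of_int (\<bar>m\<bar> + 1) * \<tau> g", rotated -1])
    have "scale 0 = 0" by (rule additive_on_0[OF additive_scale add_subgroup_S])
    then show "\<chi> (scale 0) = \<chi> 0 \<and> \<tau> (scale 0) = of_int (\<bar>m\<bar> + 1) * \<tau> 0" by simp
  next
    fix g assume "g \<in> S" "\<chi> (scale g) = \<chi> g \<and> \<tau> (scale g) = of_int (\<bar>m\<bar> + 1) * \<tau> g"
    then show "\<chi> (scale (- g)) = \<chi> (- g) \<and> \<tau> (scale (- g)) = of_int (\<bar>m\<bar> + 1) * \<tau> (- g)"
      using additive_on_uminus[OF additive_scale add_subgroup_S] by (simp add: mult.left_commute)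
  next
    fix g h assume "g \<in> S" "h \<in> S" "\<chi> (scale g) = \<chi> g \<and> \<tau> (scale g) = of_int (\<bar>m\<bar> + 1) * \<tau> g"
      "\<chi> (scale h) = \<chi> h \<and> \<tau> (scale h) = of_int (\<bar>m\<bar> + 1) * \<tau> h"
    then show "\<chi> (scale (g + h)) = \<chi> (g + h) \<and> \<tau> (scale (g + h)) = of_int (\<bar>m\<bar> + 1) * \<tau> (g + h)"
      using additive_on_add[OF additive_scale] by (simp add: distrib_left mult.left_commute)
  next
    show "\<chi> (scale gb) = \<chi> gb \<and> \<tau> (scale gb) = of_int (\<bar>m\<bar> + 1) * \<tau> gb"
      unfolding scale_gen by (simp add: to_fract_of_int del: of_int_add)
  qed (auto simp: scale_gen)
  then have one: "of_int (\<bar>m\<bar> + 1) * \<tau> g = 1" using g by simp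
  obtain n q where q: "tt ^ n * \<tau> g = to_fract q" using \<tau>_Laurent[OF g(1)] by blast
  have "to_fract (of_int (\<bar>m\<bar> + 1) * q) = tt ^ n * (of_int (\<bar>m\<bar> + 1) * \<tau> g)"
    unfolding to_fract_mult to_fract_of_int q[symmetric] by (simp only: mult_ac)
  also have "\<dots> = to_fract (monom 1 n)" unfolding one by (simp add: tt_power)
  finally have "of_int (\<bar>m\<bar> + 1) * q = monom 1 n" by (simp only: to_fract_eq_iff)
  then have "coeff (of_int (\<bar>m\<bar> + 1) * q) n = 1" by simp
  then have "(\<bar>m\<bar> + 1) * coeff q n = 1" by (simp only: of_int_poly) simp
  then show False using m_nonzero by (auto simp: zmult_eq_1_iff)
qed

end

theorem theorem5p7:
  fixes m :: int and \<xi> :: "nat \<Rightarrow> int"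
  assumes "m \<noteq> 0" and "\<xi> \<in> madic m"
  shows "hopfian (BS_tilde m \<xi>) \<and> \<not> cohopfian (BS_tilde m \<xi>)"
proof -
  interpret bs m \<xi> by unfold_locales (rule assms(1))
  have "hopfian (BS_tilde m \<xi>)"
    by (rule hopfian_transfer[OF bij_betw_\<Psi> \<Psi>_mult inj_if_surj])
  moreover have "\<not> cohopfian (BS_tilde m \<xi>)"
    by (rule not_cohopfian_transfer[OF bij_betw_\<Psi> \<Psi>_mult additive_scale inj_scale scale_not_surj])
  ultimately show ?thesis by blast
qed

end
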